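(* Let $\mathbb K=\mathbb R$ or $\mathbb C$, let $\Gamma$ be a finitely generated word-hyperbolic group, and let $\rho:\Gamma\to\mathrm{PGL}_d(\mathbb K)$ be $(p,q,r)$-hyperconvex. Then for every $x\in\partial\Gamma$, $$\lim_{(w,y)\to(x,x)} d\big(\xi^p(w)\oplus\xi^q(y),\,\xi^r(x)\big)=0,$$ where the limit is taken over pairs $(w,y)\in\partial\Gamma\times\partial\Gamma$ with $w\ne y$.
   Context: Fix an inner (Hermitian if $\mathbb K=\mathbb C$) product on $\mathbb K^d$; $\sigma_1(g)\ge\dots\ge\sigma_d(g)$ are the singular values of $g\in \mathrm{GL}_d(\mathbb K)$ (ratios $\sigma_i/\sigma_j$ are well defined on $\mathrm{PGL}_d(\mathbb K)$). $|\cdot|$ is the word length on $\Gamma$ for a fixed finite symmetric generating set, and $\partial\Gamma$ is the Gromov boundary. A representation $\rho:\Gamma\to\mathrm{PGL}_d(\mathbb K)$ is $\{\mathsf a_p\}$-Anosov ($1\le p\le d-1$) if there are $c,\mu>0$ with $\frac{\sigma_{p+1}}{\sigma_p}(\rho(\gamma))\le ce^{-\mu|\gamma|}$ for all $\gamma\in\Gamma$; it is $\{\mathsf a_p,\mathsf a_q,\dots\}$-Anosov if this holds for each listed index. An $\{\mathsf a_p\}$-Anosov representation has continuous $\rho$-equivariant boundary maps $\xi^p:\partial\Gamma\to\mathcal G_p(\mathbb K^d)$, $\xi^{d-p}:\partial\Gamma\to\mathcal G_{d-p}(\mathbb K^d)$ into Grassmannians, with $\xi^p(x)\oplus\xi^{d-p}(y)=\mathbb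 K^d$ for $x\ne y$; explicitly, $\xi^k(x)=\lim_n U_k(\rho(\gamma_n))$ for any geodesic ray $(\gamma_n)$ converging to $x$, $k\in\{p,d-p\}$, where $U_k(g)$ is the span of the $k$ longest axes of the ellipsoid $\{gv:\|v\|=1\}$. For $p,q,r\in\{1,\dots,d-1\}$ with $p+q\le r$ (possibly $p=q$), $\rho$ is $(p,q,r)$-hyperconvex if it is $\{\mathsf a_p,\mathsf a_q,\mathsf a_r\}$-Anosov and $(\xi^p(x)\oplus\xi^q(y))\cap\xi^{d-r}(z)=\{0\}$ for all pairwise distinct $x,y,z\in\partial\Gamma$. For subspaces $P,Q$ with $\dim P\le\dim Q$, $d(P,Q)=\max_{v\in P\setminus0}\min_{w\in Q\setminus 0}\sin\angle(v,w)$, where $\sin\angle(v,w)=\|v\wedge w\|/(\|v\|\|w\|)$; it vanishes iff $P\subset Q$. *)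

theory Defs
  imports "HOL-Analysis.Analysis" "HOL-Algebra.Generated_Groups"
begin

section \<open>The ground field\<close>

text \<open>
  A single class for the two fields \<open>\<real>\<close> and \<open>\<complex>\<close>. By the Gelfand--Mazur theorem every instance
  is isometrically isomorphic, as a normed field, to one of these two, and the last axiom
  determines the conjugation (it is the identity on \<open>\<real>\<close> and the complex conjugation on \<open>\<complex>\<close>).
\<close>

class real_or_complex = real_normed_field + euclidean_space +
  fixes conjugate :: "'a \<Rightarrow> 'a"
  assumes conjugate_add: "conjugate (x + y) = conjugate x + conjugate y"
    and conjugate_mult: "conjugate (x * y) = conjugate x * conjugate y"
    and conjugate_conjugate: "conjugate (conjugate x) = x"
    and mult_conjugate: "x * conjugate x = (norm x)\<^sup>2 *\<^sub>R 1"

instantiation real :: real_or_complex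
begin
definition conjugate_real :: "real \<Rightarrow> real" where "conjugate_real x = x"
instance by standard (simp_all add: conjugate_real_def power2_eq_square)
end

instantiation complex :: real_or_complex
begin
definition conjugate_complex :: "complex \<Rightarrow> complex" where "conjugate_complex = cnj"
instance by standard (simp_all add: conjugate_complex_def complex_norm_square[symmetric] scaleR_conv_of_real)
end


section \<open>Inner products and singular values\<close>

text \<open>Throughout, \<open>d = CARD('n)\<close>, and axes and singular values are indexed by \<open>{1..d}\<close>.\<close>

type_synonym ('k, 'n) form = "'k ^ 'n \<Rightarrow> 'k ^ 'n \<Rightarrow> 'k"

definition inner_product :: "('k::real_or_complex, 'n::finite) form \<Rightarrow> bool" where
  "inner_product ip \<longleftrightarrow>
     (\<forall>u v w. ip (u + v) w = ip u w + ip v w) \<and>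
     (\<forall>c v w. ip (c *s v) w = c * ip v w) \<and>
     (\<forall>v w. ip w v = conjugate (ip v w)) \<and>
     (\<forall>v. v \<noteq> 0 \<longrightarrow> (\<exists>r>0. ip v v = of_real r))"

definition ip_norm :: "('k::real_or_complex, 'n::finite) form \<Rightarrow> 'k ^ 'n \<Rightarrow> real" where
  "ip_norm ip v = sqrt (norm (ip v v))"

definition orthonormal_basis ::
  "('k::real_or_complex, 'n::finite) form \<Rightarrow> (nat \<Rightarrow> 'k ^ 'n) \<Rightarrow> bool" where
  "orthonormal_basis ip e \<longleftrightarrow>
     (\<forall>i\<in>{1..CARD('n)}. \<forall>j\<in>{1..CARD('n)}. ip (e i) (e j) = (if i = j then 1 else 0))"

text \<open>
  A singular value decomposition: \<open>A\<close> maps the orthonormal basis \<open>e\<close> to \<open>s\<^sub>1 f\<^sub>1, \<dots>, s\<^sub>d f\<^sub>d\<close>, so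
  these vectors are the semi-axes, in order of decreasing length, of the ellipsoid which is the
  image under \<open>A\<close> of the unit sphere.
\<close>

definition singular_value_decomposition ::
  "('k::real_or_complex, 'n::finite) form \<Rightarrow> 'k ^ 'n ^ 'n \<Rightarrow>
     (nat \<Rightarrow> real) \<Rightarrow> (nat \<Rightarrow> 'k ^ 'n) \<Rightarrow> (nat \<Rightarrow> 'k ^ 'n) \<Rightarrow> bool" where
  "singular_value_decomposition ip A s e f \<longleftrightarrow>
     orthonormal_basis ip e \<and> orthonormal_basis ip f \<and>
     (\<forall>i\<in>{1..CARD('n)}. 0 \<le> s i \<and> A *v e i = of_real (s i) *s f i) \<and>
     (\<forall>i\<in>{1..CARD('n)}. \<forall>j\<in>{1..CARD('n)}. i \<le> j \<longrightarrow> s j \<le> s i)"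

definition singular_value ::
  "('k::real_or_complex, 'n::finite) form \<Rightarrow> nat \<Rightarrow> 'k ^ 'n ^ 'n \<Rightarrow> real" where
  "singular_value ip i A = (THE t. \<exists>s e f. singular_value_decomposition ip A s e f \<and> t = s i)"

text \<open>
  The space \<open>U\<^sub>k(A)\<close>. It does not depend on the decomposition when the \<open>k\<close>-th singular value is
  strictly larger than the next one; otherwise the \<open>k\<close> longest axes are not unique and some
  choice is made.
\<close>

definition longest_axes_span ::
  "('k::real_or_complex, 'n::finite) form \<Rightarrow> nat \<Rightarrow> 'k ^ 'n ^ 'n \<Rightarrow> ('k ^ 'n) set" where
  "longest_axes_span ip k A =
     (SOME U. \<exists>s e f. singular_value_decomposition ip A s e f \<and> U = vec.span (f ` {1..k}))"


section \<open>Subspaces\<close>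

definition grassmannian :: "nat \<Rightarrow> ('k::field ^ 'n::finite) set set" where
  "grassmannian k = {V. vec.subspace V \<and> vec.dim V = k}"

definition subspace_sum :: "('k::field ^ 'n::finite) set \<Rightarrow> ('k ^ 'n) set \<Rightarrow> ('k ^ 'n) set" where
  "subspace_sum P Q = {u + v | u v. u \<in> P \<and> v \<in> Q}"

text \<open>The norm of \<open>v \<and> w\<close> for the induced inner product on the exterior square, for which
  \<open>\<langle>v \<and> w, v \<and> w\<rangle>\<close> is the Gram determinant of \<open>v, w\<close>.\<close>

definition wedge_norm ::
  "('k::real_or_complex, 'n::finite) form \<Rightarrow> 'k ^ 'n \<Rightarrow> 'k ^ 'n \<Rightarrow> real" where
  "wedge_norm ip v w = sqrt (norm (ip v v * ip w w - ip v w * ip w v))"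

definition sin_angle ::
  "('k::real_or_complex, 'n::finite) form \<Rightarrow> 'k ^ 'n \<Rightarrow> 'k ^ 'n \<Rightarrow> real" where
  "sin_angle ip v w = wedge_norm ip v w / (ip_norm ip v * ip_norm ip w)"

definition subspace_dist ::
  "('k::real_or_complex, 'n::finite) form \<Rightarrow> ('k ^ 'n) set \<Rightarrow> ('k ^ 'n) set \<Rightarrow> real" where
  "subspace_dist ip P Q = (SUP v\<in>P - {0}. INF w\<in>Q - {0}. sin_angle ip v w)"


section \<open>The projective linear group\<close>

definition GL :: "('k::field ^ 'n::finite ^ 'n) monoid" where
  "GL = \<lparr>carrier = {A. invertible A}, mult = (**), one = mat 1\<rparr>"

definition scalar_matrices :: "('k::field ^ 'n::finite ^ 'n) set" where
  "scalar_matrices = {mat c | c. c \<noteq> 0}"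

text \<open>Elements of \<open>PGL\<close> are cosets, that is, sets of invertible matrices.\<close>

definition PGL :: "('k::field ^ 'n::finite ^ 'n) set monoid" where
  "PGL = GL Mod scalar_matrices"

lemma mat_mult_left: "mat c ** (A :: 'k::field ^ 'n::finite ^ 'n) = (\<chi> i j. c * A $ i $ j)"
  by (simp add: matrix_matrix_mult_def mat_def vec_eq_iff if_distrib if_distribR cong: if_cong)

lemma mat_mult_right: "(A :: 'k::field ^ 'n::finite ^ 'n) ** mat c = (\<chi> i j. c * A $ i $ j)"
  by (simp add: matrix_matrix_mult_def mat_def vec_eq_iff if_distrib if_distribR mult.commute
      cong: if_cong)

lemma group_GL: "group (GL :: ('k::field ^ 'n::finite ^ 'n) monoid)"
proof (rule groupI)
  fix A :: "'k ^ 'n ^ 'n"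
  assume "A \<in> carrier GL"
  then obtain B where "A ** B = mat 1" "B ** A = mat 1"
    by (auto simp: GL_def invertible_def)
  then show "\<exists>B\<in>carrier GL. B \<otimes>\<^bsub>GL\<^esub> A = \<one>\<^bsub>GL\<^esub>"
    by (auto simp: GL_def invertible_def)
next
  show "\<one>\<^bsub>GL\<^esub> \<in> carrier (GL :: ('k ^ 'n ^ 'n) monoid)"
    unfolding GL_def invertible_def by (auto intro: exI[of _ "mat 1"])
qed (simp_all add: GL_def invertible_mult matrix_mul_assoc)

lemma normal_scalar_matrices:
  "(scalar_matrices :: ('k::field ^ 'n::finite ^ 'n) set) \<lhd> GL"
proof -
  interpret group "GL :: ('k ^ 'n ^ 'n) monoid"
    by (rule group_GL)
  have mm: "mat a ** mat b = (mat (a * b) :: 'k ^ 'n ^ 'n)" for a b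
    by (simp add: mat_mult_left) (simp add: mat_def vec_eq_iff)
  have inv: "invertible (mat c :: 'k ^ 'n ^ 'n)" if "c \<noteq> 0" for c
    unfolding invertible_def using that by (intro exI[of _ "mat (inverse c)"]) (simp add: mm)
  have sub: "subgroup (scalar_matrices :: ('k ^ 'n ^ 'n) set) GL"
  proof (rule subgroupI)
    fix A :: "'k ^ 'n ^ 'n"
    assume "A \<in> scalar_matrices"
    then obtain c where c: "A = mat c" "c \<noteq> 0"
      by (auto simp: scalar_matrices_def)
    have "inv\<^bsub>GL\<^esub> A = mat (inverse c)"
      by (rule inv_equality) (use c inv in \<open>auto simp: GL_def mm\<close>)
    then show "inv\<^bsub>GL\<^esub> A \<in> scalar_matrices"
      using c by (auto simp: scalar_matrices_def)
  next
    have "mat 1 \<in> (scalar_matrices :: ('k ^ 'n ^ 'n) set)"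
      unfolding scalar_matrices_def mem_Collect_eq by (rule exI[of _ 1]) simp
    then show "(scalar_matrices :: ('k ^ 'n ^ 'n) set) \<noteq> {}"
      by (metis empty_iff)
  next
    fix A B :: "'k ^ 'n ^ 'n"
    assume "A \<in> scalar_matrices" "B \<in> scalar_matrices"
    then obtain a b where "A = mat a" "a \<noteq> 0" "B = mat b" "b \<noteq> 0"
      by (auto simp: scalar_matrices_def)
    then have "A ** B = mat (a * b)" "a * b \<noteq> 0"
      by (simp_all add: mm)
    then show "A \<otimes>\<^bsub>GL\<^esub> B \<in> scalar_matrices"
      unfolding GL_def scalar_matrices_def mem_Collect_eq by (intro exI[of _ "a * b"]) simp
  qed (use inv in \<open>auto simp: GL_def scalar_matrices_def\<close>)
  show ?thesis
  proof (rule normalI[OF sub], rule ballI)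
    fix A :: "'k ^ 'n ^ 'n"
    have "H ** A = A ** H" if "H \<in> scalar_matrices" for H
      using that by (auto simp: scalar_matrices_def mat_mult_left mat_mult_right)
    then show "scalar_matrices #>\<^bsub>GL\<^esub> A = A <#\<^bsub>GL\<^esub> scalar_matrices"
      by (simp add: r_coset_def l_coset_def GL_def)
  qed
qed

lemma group_PGL: "group (PGL :: ('k::field ^ 'n::finite ^ 'n) set monoid)"
  unfolding PGL_def by (rule normal.factorgroup_is_group[OF normal_scalar_matrices])


section \<open>Word-hyperbolic groups and the Gromov boundary\<close>

definition symmetric_generating_set :: "('g, 'b) monoid_scheme \<Rightarrow> 'g set \<Rightarrow> bool" where
  "symmetric_generating_set G S \<longleftrightarrow>
     S \<subseteq> carrier G \<and> (\<forall>s\<in>S. inv\<^bsub>G\<^esub> s \<in> S) \<and> generate G S = carrier G"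

definition word_length :: "('g, 'b) monoid_scheme \<Rightarrow> 'g set \<Rightarrow> 'g \<Rightarrow> nat" where
  "word_length G S g =
     (LEAST n. \<exists>ws. set ws \<subseteq> S \<and> length ws = n \<and> foldr (\<otimes>\<^bsub>G\<^esub>) ws \<one>\<^bsub>G\<^esub> = g)"

definition word_dist :: "('g, 'b) monoid_scheme \<Rightarrow> 'g set \<Rightarrow> 'g \<Rightarrow> 'g \<Rightarrow> nat" where
  "word_dist G S g h = word_length G S (inv\<^bsub>G\<^esub> g \<otimes>\<^bsub>G\<^esub> h)"

definition gromov_product :: "('g, 'b) monoid_scheme \<Rightarrow> 'g set \<Rightarrow> 'g \<Rightarrow> 'g \<Rightarrow> 'g \<Rightarrow> real" where
  "gromov_product G S o' g h =
     (real (word_dist G S o' g) + real (word_dist G S o' h) - real (word_dist G S g h)) / 2"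

definition word_hyperbolic :: "('g, 'b) monoid_scheme \<Rightarrow> 'g set \<Rightarrow> bool" where
  "word_hyperbolic G S \<longleftrightarrow>
     (\<exists>\<delta>\<ge>0. \<forall>o'\<in>carrier G. \<forall>g\<in>carrier G. \<forall>h\<in>carrier G. \<forall>k\<in>carrier G.
        min (gromov_product G S o' g h) (gromov_product G S o' h k) - \<delta> \<le> gromov_product G S o' g k)"

definition geodesic_rays :: "('g, 'b) monoid_scheme \<Rightarrow> 'g set \<Rightarrow> (nat \<Rightarrow> 'g) set" where
  "geodesic_rays G S =
     {a. (\<forall>n. a n \<in> carrier G) \<and> (\<forall>m n. m \<le> n \<longrightarrow> word_dist G S (a m) (a n) = n - m)}"

definition asymptotic :: "('g, 'b) monoid_scheme \<Rightarrow> 'g set \<Rightarrow> ((nat \<Rightarrow> 'g) \<times> (nat \<Rightarrow> 'g)) set" where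
  "asymptotic G S =
     {(a, b). a \<in> geodesic_rays G S \<and> b \<in> geodesic_rays G S \<and>
        (\<exists>C. \<forall>n. word_dist G S (a n) (b n) \<le> C)}"

text \<open>A boundary point is a class of asymptotic geodesic rays (with arbitrary starting points);
  the rays converging to \<open>x\<close> are precisely the elements of \<open>x\<close>.\<close>

definition gromov_boundary :: "('g, 'b) monoid_scheme \<Rightarrow> 'g set \<Rightarrow> (nat \<Rightarrow> 'g) set set" where
  "gromov_boundary G S = geodesic_rays G S // asymptotic G S"

text \<open>Points \<open>y\<close> with \<open>(x|y) \<ge> R\<close>, where \<open>(x|y)\<close> is the extension of the Gromov product to the
  boundary; taking another pair of rays changes it by a bounded amount only. These sets are the
  basic neighbourhoods of \<open>x\<close>, not necessarily open themselves.\<close>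

definition boundary_nbhd ::
  "('g, 'b) monoid_scheme \<Rightarrow> 'g set \<Rightarrow> (nat \<Rightarrow> 'g) set \<Rightarrow> real \<Rightarrow> (nat \<Rightarrow> 'g) set set" where
  "boundary_nbhd G S x R =
     {y \<in> gromov_boundary G S. \<exists>a\<in>x. \<exists>b\<in>y. \<exists>N. \<forall>m\<ge>N. \<forall>n\<ge>N.
        R \<le> gromov_product G S \<one>\<^bsub>G\<^esub> (a m) (b n)}"

definition boundary_topology ::
  "('g, 'b) monoid_scheme \<Rightarrow> 'g set \<Rightarrow> (nat \<Rightarrow> 'g) set topology" where
  "boundary_topology G S =
     topology (\<lambda>U. U \<subseteq> gromov_boundary G S \<and> (\<forall>x\<in>U. \<exists>R. boundary_nbhd G S x R \<subseteq> U))"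

lemma openin_boundary_topology:
  "openin (boundary_topology G S) U \<longleftrightarrow>
     U \<subseteq> gromov_boundary G S \<and> (\<forall>x\<in>U. \<exists>R. boundary_nbhd G S x R \<subseteq> U)"
proof -
  have mono: "boundary_nbhd G S x R' \<subseteq> boundary_nbhd G S x R" if "R \<le> R'" for x R R'
    unfolding boundary_nbhd_def using order_trans[OF that] by blast
  have "istopology (\<lambda>U. U \<subseteq> gromov_boundary G S \<and> (\<forall>x\<in>U. \<exists>R. boundary_nbhd G S x R \<subseteq> U))"
    unfolding istopology_def
  proof (intro conjI allI impI ballI)
    fix U V x
    assume U: "U \<subseteq> gromov_boundary G S \<and> (\<forall>x\<in>U. \<exists>R. boundary_nbhd G S x R \<subseteq> U)"
      and V: "V \<subseteq> gromov_boundary G S \<and> (\<forall>x\<in>V. \<exists>R. boundary_nbhd G S x R \<subseteq> V)"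
      and x: "x \<in> U \<inter> V"
    obtain R R' where "boundary_nbhd G S x R \<subseteq> U" "boundary_nbhd G S x R' \<subseteq> V"
      using U V x by blast
    then have "boundary_nbhd G S x (max R R') \<subseteq> U \<inter> V"
      using mono[of R "max R R'" x] mono[of R' "max R R'" x] by auto
    then show "\<exists>R. boundary_nbhd G S x R \<subseteq> U \<inter> V" ..
  next
    fix K x
    assume K: "\<forall>U\<in>K. U \<subseteq> gromov_boundary G S \<and> (\<forall>x\<in>U. \<exists>R. boundary_nbhd G S x R \<subseteq> U)"
      and x: "x \<in> \<Union>K"
    then obtain U R where "U \<in> K" "boundary_nbhd G S x R \<subseteq> U"
      by blast
    then show "\<exists>R. boundary_nbhd G S x R \<subseteq> \<Union>K"
      by blast
  qed auto
  then show ?thesis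
    by (simp add: boundary_topology_def)
qed

lemma topspace_boundary_topology: "topspace (boundary_topology G S) = gromov_boundary G S"
proof -
  have "openin (boundary_topology G S) (gromov_boundary G S)"
    by (auto simp: openin_boundary_topology boundary_nbhd_def)
  then show ?thesis
    by (metis openin_boundary_topology openin_subset openin_topspace subset_antisym)
qed


section \<open>Anosov and hyperconvex representations\<close>

text \<open>Ratios of singular values are the same for all representatives \<open>A\<close> of \<open>\<rho> g\<close>.\<close>

definition anosov ::
  "('g, 'b) monoid_scheme \<Rightarrow> 'g set \<Rightarrow> ('k::real_or_complex, 'n::finite) form \<Rightarrow>
     ('g \<Rightarrow> ('k ^ 'n ^ 'n) set) \<Rightarrow> nat \<Rightarrow> bool" where
  "anosov G S ip \<rho> p \<longleftrightarrow>
     (\<exists>c>0. \<exists>\<mu>>0. \<forall>g\<in>carrier G. \<forall>A\<in>\<rho> g.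
        singular_value ip (p + 1) A / singular_value ip p A
          \<le> c * exp (- \<mu> * real (word_length G S g)))"

text \<open>The limit in the Grassmannian is taken for the distance \<open>subspace_dist\<close> between subspaces of
  the same dimension, along arbitrary representatives \<open>A n\<close> of \<open>\<rho> (a n)\<close>.\<close>

definition boundary_map ::
  "('k::real_or_complex, 'n::finite) form \<Rightarrow> ('g \<Rightarrow> ('k ^ 'n ^ 'n) set) \<Rightarrow> nat \<Rightarrow>
     (nat \<Rightarrow> 'g) set \<Rightarrow> ('k ^ 'n) set" where
  "boundary_map ip \<rho> k x =
     (THE V. V \<in> grassmannian k \<and>
        (\<forall>a\<in>x. \<forall>A. (\<forall>n. A n \<in> \<rho> (a n)) \<longrightarrow>
           (\<lambda>n. subspace_dist ip (longest_axes_span ip k (A n)) V) \<longlonglongrightarrow> 0))"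

text \<open>The first equation in the last clause says that the sum of the two subspaces is direct.\<close>

definition hyperconvex ::
  "('g, 'b) monoid_scheme \<Rightarrow> 'g set \<Rightarrow> ('k::real_or_complex, 'n::finite) form \<Rightarrow>
     ('g \<Rightarrow> ('k ^ 'n ^ 'n) set) \<Rightarrow> nat \<Rightarrow> nat \<Rightarrow> nat \<Rightarrow> bool" where
  "hyperconvex G S ip \<rho> p q r \<longleftrightarrow>
     p \<in> {1..CARD('n) - 1} \<and> q \<in> {1..CARD('n) - 1} \<and> r \<in> {1..CARD('n) - 1} \<and> p + q \<le> r \<and>
     anosov G S ip \<rho> p \<and> anosov G S ip \<rho> q \<and> anosov G S ip \<rho> r \<and>
     (\<forall>x\<in>gromov_boundary G S. \<forall>y\<in>gromov_boundary G S. \<forall>z\<in>gromov_boundary G S.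
        x \<noteq> y \<and> y \<noteq> z \<and> x \<noteq> z \<longrightarrow>
          boundary_map ip \<rho> p x \<inter> boundary_map ip \<rho> q y = {0} \<and>
          subspace_sum (boundary_map ip \<rho> p x) (boundary_map ip \<rho> q y)
            \<inter> boundary_map ip \<rho> (CARD('n) - r) z = {0})"

end

theory Submission
  imports Defs
begin

text \<open>
  Suppose that \<open>w\<^sub>n \<noteq> y\<^sub>n\<close> tend to \<open>x\<close>, and let \<open>\<gamma>\<^sub>n\<close> be a coarse centre of the triangle with vertices
  \<open>1, w\<^sub>n, y\<^sub>n\<close>, so that \<open>\<gamma>\<^sub>n \<rightarrow> x\<close>. Seen from \<open>\<gamma>\<^sub>n\<close>, the three vertices have bounded mutual Gromov
  products; hence, along a subsequence, \<open>\<gamma>\<^sub>n\<^sup>-\<^sup>1w\<^sub>n\<close>, \<open>\<gamma>\<^sub>n\<^sup>-\<^sup>1y\<^sub>n\<close> and \<open>\<gamma>\<^sub>n\<^sup>-\<^sup>1\<close> tend to pairwise distinct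
  boundary points. By hyperconvexity at these limits, \<open>\<rho>(\<gamma>\<^sub>n)\<^sup>-\<^sup>1(\<xi>\<^sup>p(w\<^sub>n) \<oplus> \<xi>\<^sup>q(y\<^sub>n))\<close> is uniformly
  transverse to \<open>U\<^bsub>d-r\<^esub>(\<rho>(\<gamma>\<^sub>n)\<^sup>-\<^sup>1)\<close>, so \<open>\<rho>(\<gamma>\<^sub>n)\<close> maps it to within a constant times
  \<open>(\<sigma>\<^bsub>r+1\<^esub>/\<sigma>\<^sub>r)(\<rho>(\<gamma>\<^sub>n)) \<rightarrow> 0\<close> of \<open>U\<^sub>r(\<rho>(\<gamma>\<^sub>n))\<close>, which tends to \<open>\<xi>\<^sup>r(x)\<close>.

  All convergence statements, including the existence of the boundary maps, rest on the estimate
  \<open>d(U\<^sub>k(\<rho>(g)), U\<^sub>k(\<rho>(h))) \<le> C e\<^bsup>-\<mu>(g|h)\<^esup>\<close>, obtained by summing along a geodesic from \<open>g\<close> to \<open>h\<close>.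
\<close>

section \<open>Inner product spaces over the real or complex numbers\<close>

text \<open>As w and y run into x together, transversality of the original triple degenerates and
  gives no bound by itself. Recentring at \<gamma> replaces it by a configuration in bounded
  position, at the price of the matrices \<rho>(\<gamma>), whose conditioning is unbounded. Two
  devices avoid paying for it. A translated boundary point is approximated by axes far out on its
  ray, where the Anosov gap beats the conditioning of any fixed \<gamma>, so the resulting
  thresholds do not depend on \<gamma>. The way back by \<rho>(\<gamma>) is controlled through
  singular values alone. Transversality of the limit triple is condensed into one constant that
  survives small perturbations. Sequences of boundary points are never assumed to converge: limits
  are taken of group elements, by finiteness of balls. Distances are handled through the relation
  \<open>near\<close>, which satisfies a triangle inequality and is symmetric in equal dimensions;
  suprema and infima of angles occur only in translating it to and from
  \<open>subspace_dist\<close>.\<close>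

lemma conjugate_0 [simp]: "conjugate (0::'k::real_or_complex) = 0"
  using conjugate_add[of "0::'k" 0] by simp

lemma conjugate_minus: "conjugate (- x :: 'k::real_or_complex) = - conjugate x"
  using conjugate_add[of x "- x"] by (simp add: eq_neg_iff_add_eq_0 add.commute)

lemma conjugate_diff: "conjugate (x - y :: 'k::real_or_complex) = conjugate x - conjugate y"
  using conjugate_add[of x "- y"] by (simp add: conjugate_minus)

lemma norm_conjugate [simp]: "norm (conjugate (x :: 'k::real_or_complex)) = norm x"
proof (cases "x = 0")
  case False
  have "norm x * norm (conjugate x) = norm x * norm x"
    using arg_cong[OF mult_conjugate[of x], of norm] by (simp add: norm_mult power2_eq_square)
  then show ?thesis using False by simp
qed simp

lemma conjugate_of_real [simp]: "conjugate (of_real r :: 'k::real_or_complex) = of_real r"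
proof (cases "r = 0")
  case False
  have "of_real r * conjugate (of_real r :: 'k) = of_real r * of_real r"
    using mult_conjugate[of "of_real r :: 'k"] by (simp add: power2_eq_square scaleR_conv_of_real)
  then show ?thesis using False by simp
qed simp

lemma mult_conjugate_of_real: "x * conjugate x = of_real ((norm (x :: 'k::real_or_complex))\<^sup>2)"
  by (simp add: mult_conjugate scaleR_conv_of_real)

lemma continuous_on_conjugate [continuous_intros]:
  assumes "continuous_on A f"
  shows "continuous_on A (\<lambda>x. conjugate (f x :: 'k::real_or_complex))"
proof -
  have "continuous_on UNIV (conjugate :: 'k \<Rightarrow> 'k)"
    unfolding continuous_on_iff dist_norm conjugate_diff[symmetric] norm_conjugate by blast
  then show ?thesis using continuous_on_compose2[OF _ assms] by blast
qed

text \<open>Linear algebra is done over \<open>'k\<close>, while closedness and boundedness come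
  from the real normed structure; this identity is the bridge.\<close>

lemma scaleR_vec_eq: "r *\<^sub>R (v :: 'k::real_or_complex ^ 'n) = of_real r *s v"
  by (subst vec_eq_iff) (simp add: scaleR_conv_of_real[where 'a = 'k])

lemma real_subspace_if_vec_subspace:
  "vec.subspace (V :: ('k::real_or_complex ^ 'n::finite) set) \<Longrightarrow> subspace V"
  by (auto simp: subspace_def vec.subspace_def scaleR_vec_eq)

lemma closed_vec_subspace:
  "vec.subspace (V :: ('k::real_or_complex ^ 'n::finite) set) \<Longrightarrow> closed V"
  by (intro closed_subspace real_subspace_if_vec_subspace)

lemma bounded_linear_matrix_vector_mult:
  "bounded_linear ((*v) (A :: 'k::real_or_complex ^ 'n::finite ^ 'n))"
proof (rule linear_conv_bounded_linear[THEN iffD1])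
  show "linear ((*v) A)"
    by (rule linearI) (simp_all add: matrix_vector_right_distrib scaleR_vec_eq vec.scale)
qed

locale inner_product_form =
  fixes ip :: "('k::real_or_complex, 'n::finite) form"
  assumes ip: "inner_product ip"
begin

abbreviation "N \<equiv> ip_norm ip"

lemma ip_add_left: "ip (u + v) w = ip u w + ip v w"
  and ip_scale_left: "ip (c *s v) w = c * ip v w"
  and ip_conj: "ip w v = conjugate (ip v w)"
  using ip unfolding inner_product_def by blast+

lemma ip_add_right: "ip w (u + v) = ip w u + ip w v"
  by (metis ip_add_left ip_conj conjugate_add)

lemma ip_scale_right: "ip w (c *s v) = conjugate c * ip w v"
  by (metis ip_scale_left ip_conj conjugate_mult)

lemma ip_zero_left [simp]: "ip 0 w = 0"
  using ip_scale_left[of 0 0 w] by simp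

lemma ip_zero_right [simp]: "ip w 0 = 0"
  using ip_scale_right[of w 0 0] by simp

lemma ip_minus_left: "ip (- v) w = - ip v w"
  using ip_scale_left[of "- 1" v w] by simp

lemma ip_diff_left: "ip (u - v) w = ip u w - ip v w"
  using ip_add_left[of u "- v" w] by (simp add: ip_minus_left)

lemma ip_sum_left: "ip (\<Sum>i\<in>I. f i) w = (\<Sum>i\<in>I. ip (f i) w)"
  by (induction I rule: infinite_finite_induct) (simp_all add: ip_add_left)

lemma ip_sum_right: "ip w (\<Sum>i\<in>I. f i) = (\<Sum>i\<in>I. ip w (f i))"
  by (induction I rule: infinite_finite_induct) (simp_all add: ip_add_right)

lemma ip_eq_0_commute: "ip v w = 0 \<longleftrightarrow> ip w v = 0"
  by (metis ip_conj conjugate_0)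

lemma N_nonneg [simp]: "0 \<le> N v"
  by (simp add: ip_norm_def)

lemma ip_self: "ip v v = of_real ((N v)\<^sup>2)"
proof (cases "v = 0")
  case False
  then obtain r where "r > 0" "ip v v = of_real r"
    using ip unfolding inner_product_def by blast
  then show ?thesis by (simp add: ip_norm_def)
qed (simp add: ip_norm_def)

lemma N_eq_0 [simp]: "N v = 0 \<longleftrightarrow> v = 0"
proof
  show "v = 0" if "N v = 0"
  proof (rule ccontr)
    assume "v \<noteq> 0"
    then obtain r where "r > 0" "ip v v = of_real r"
      using ip unfolding inner_product_def by blast
    then show False using that by (simp add: ip_norm_def)
  qed
qed (simp add: ip_norm_def)

lemma N_zero [simp]: "N 0 = 0"
  by simp

lemma N_pos: "v \<noteq> 0 \<Longrightarrow> 0 < N v"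
  using N_nonneg[of v] N_eq_0[of v] by linarith

lemma N_scale: "N (c *s v) = norm c * N v"
  by (simp add: ip_norm_def ip_scale_left ip_scale_right norm_mult real_sqrt_mult)

lemma N_minus [simp]: "N (- v) = N v"
  using N_scale[of "- 1" v] by simp

lemma N_minus_commute: "N (v - w) = N (w - v)"
  using N_minus[of "v - w"] by simp

lemma N_pythagoras:
  assumes "ip u v = 0"
  shows "(N (u + v))\<^sup>2 = (N u)\<^sup>2 + (N v)\<^sup>2"
proof -
  have "ip v u = 0" using assms ip_eq_0_commute by blast
  then have "ip (u + v) (u + v) = ip u u + ip v v"
    using assms by (simp add: ip_add_left ip_add_right)
  then have "(of_real ((N (u + v))\<^sup>2) :: 'k) = of_real ((N u)\<^sup>2 + (N v)\<^sup>2)"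
    unfolding ip_self by simp
  then show ?thesis by (simp only: of_real_eq_iff)
qed

text \<open>Pythagoras for \<open>v\<close> and its component along \<open>w\<close>, multiplied by
  \<open>(N w)\<^sup>2\<close>. It yields both Cauchy-Schwarz and the Gram determinant inside
  \<open>wedge_norm\<close>.\<close>

lemma N_sq_line:
  assumes "w \<noteq> 0"
  shows "(N (v - (ip v w / ip w w) *s w))\<^sup>2 * (N w)\<^sup>2 = (N v)\<^sup>2 * (N w)\<^sup>2 - (norm (ip v w))\<^sup>2"
proof -
  let ?c = "ip v w / ip w w"
  have ww: "ip w w \<noteq> 0" using assms by (simp add: ip_self)
  have "ip (v - ?c *s w) (?c *s w) = 0"
    using ww by (simp add: ip_diff_left ip_scale_left ip_scale_right)
  from N_pythagoras[OF this] have "(N v)\<^sup>2 = (N (v - ?c *s w))\<^sup>2 + (N (?c *s w))\<^sup>2" by simp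
  moreover have "(N (?c *s w))\<^sup>2 * (N w)\<^sup>2 = (norm (ip v w))\<^sup>2"
  proof -
    have "norm (ip w w) = (N w)\<^sup>2" by (simp add: ip_self norm_power)
    then show ?thesis using assms
      by (simp add: N_scale norm_divide power_mult_distrib power_divide power2_eq_square)
  qed
  ultimately show ?thesis by (simp add: algebra_simps)
qed

lemma Cauchy_Schwarz: "norm (ip v w) \<le> N v * N w"
proof (cases "w = 0")
  case False
  from N_sq_line[OF False, of v] have "(norm (ip v w))\<^sup>2 \<le> (N v * N w)\<^sup>2"
    by (metis (no_types, lifting) diff_ge_0_iff_ge power_mult_distrib zero_le_mult_iff zero_le_power2)
  then show ?thesis by (rule power2_le_imp_le) simp
qed simp

lemma N_triangle: "N (u + v) \<le> N u + N v"
proof -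
  have "of_real ((N (u + v))\<^sup>2) = (of_real ((N u)\<^sup>2 + (N v)\<^sup>2) + (ip u v + ip v u) :: 'k)"
    unfolding ip_self[symmetric] of_real_add by (simp add: ip_add_left ip_add_right)
  \<comment> \<open>No real part is at hand for a general \<open>'k\<close>. That the cross terms
    have a real sum is read off from the expansion itself, and \<open>norm_of_real\<close> turns it
    into an absolute value.\<close>
  then have "ip u v + ip v u = (of_real ((N (u + v))\<^sup>2 - ((N u)\<^sup>2 + (N v)\<^sup>2)) :: 'k)"
    unfolding of_real_diff by (simp add: algebra_simps)
  then have "\<bar>(N (u + v))\<^sup>2 - ((N u)\<^sup>2 + (N v)\<^sup>2)\<bar> = norm (ip u v + ip v u)"
    by (simp only: norm_of_real)
  also have "\<dots> \<le> N u * N v + N v * N u"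
    using norm_triangle_ineq[of "ip u v" "ip v u"] Cauchy_Schwarz[of u v] Cauchy_Schwarz[of v u]
    by linarith
  finally have "(N (u + v))\<^sup>2 \<le> (N u + N v)\<^sup>2" by (simp add: power2_sum)
  then show ?thesis by (rule power2_le_imp_le) simp
qed

lemma N_triangle_diff: "N (u - w) \<le> N (u - v) + N (v - w)"
  using N_triangle[of "u - v" "v - w"] by simp

subsection \<open>Comparison with the standard norm\<close>

text \<open>In coordinates the form is a polynomial in the entries and their conjugates, which makes
  its continuity evident.\<close>

lemma ip_expand:
  "ip v w = (\<Sum>i\<in>UNIV. \<Sum>j\<in>UNIV. v $ i * conjugate (w $ j) * ip (axis i 1) (axis j 1))"
proof -
  have "ip v w = ip (\<Sum>i\<in>UNIV. v $ i *s axis i 1) (\<Sum>j\<in>UNIV. w $ j *s axis j 1)"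
    unfolding basis_expansion ..
  also have "\<dots> = (\<Sum>i\<in>UNIV. \<Sum>j\<in>UNIV. v $ i * conjugate (w $ j) * ip (axis i 1) (axis j 1))"
    unfolding ip_sum_left
    by (intro sum.cong refl)
      (simp add: ip_scale_left ip_sum_right ip_scale_right sum_distrib_left mult_ac)
  finally show ?thesis .
qed

lemma continuous_on_N [continuous_intros]:
  assumes "continuous_on A f"
  shows "continuous_on A (\<lambda>x. N (f x))"
  unfolding ip_norm_def by (subst ip_expand) (intro continuous_intros assms)

text \<open>The constants are the extreme values of \<open>N\<close> on the compact Euclidean unit
  sphere; homogeneity does the rest.\<close>

lemma norm_equiv: obtains c C where "0 < c" "0 < C" "\<And>v. c * norm v \<le> N v" "\<And>v. N v \<le> C * norm v"
proof -
  let ?S = "sphere (0 :: 'k ^ 'n) 1"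
  have comp: "compact ?S" by simp
  have ne: "?S \<noteq> {}" by simp
  have cont: "continuous_on ?S N" by (intro continuous_intros)
  obtain a where a: "a \<in> ?S" "\<forall>v\<in>?S. N a \<le> N v"
    using continuous_attains_inf[OF comp ne cont] by blast
  obtain b where b: "b \<in> ?S" "\<forall>v\<in>?S. N v \<le> N b"
    using continuous_attains_sup[OF comp ne cont] by blast
  have "N a * norm v \<le> N v \<and> N v \<le> N b * norm v" for v
  proof (cases "v = 0")
    case False
    let ?u = "(1 / norm v) *\<^sub>R v"
    have "?u \<in> ?S" using False by simp
    moreover have "N ?u = N v / norm v"
      unfolding scaleR_vec_eq N_scale by (simp add: norm_divide)
    ultimately have "N a \<le> N v / norm v" "N v / norm v \<le> N b" using a b by metis+
    then show ?thesis using False by (simp add: field_simps)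
  qed simp
  moreover have "a \<noteq> 0" "b \<noteq> 0" using a b by auto
  ultimately show ?thesis using that[of "N a" "N b"] N_pos by simp
qed

lemma matrix_N_bounded: obtains K where "0 < K" "\<And>v. N (A *v v) \<le> K * N v"
proof -
  obtain c C where c: "0 < c" "0 < C" "\<And>v. c * norm v \<le> N v" "\<And>v. N v \<le> C * norm v"
    using norm_equiv by blast
  obtain K where K: "0 < K" "\<And>v. norm (A *v v) \<le> norm v * K"
    using bounded_linear.pos_bounded[OF bounded_linear_matrix_vector_mult[of A]] by blast
  have "N (A *v v) \<le> (C * K / c) * N v" for v
  proof -
    have "N (A *v v) \<le> C * (norm v * K)"
      using c(4) K(2) c(2) by (meson mult_left_mono order_trans less_imp_le)
    also have "\<dots> = (C * K / c) * (c * norm v)" using c by simp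
    also have "\<dots> \<le> (C * K / c) * N v"
      by (rule mult_left_mono[OF c(3)]) (use c K in simp)
    finally show ?thesis .
  qed
  then show ?thesis using that[of "C * K / c"] c K by simp
qed

lemma N_bounded_convergent_subsequence:
  fixes u :: "nat \<Rightarrow> 'k ^ 'n"
  assumes "\<And>n. N (u n) \<le> B"
  obtains l r where "strict_mono r" "(\<lambda>n. N (u (r n) - l)) \<longlonglongrightarrow> 0"
proof -
  obtain c C where c: "0 < c" "0 < C" "\<And>v. c * norm v \<le> N v" "\<And>v. N v \<le> C * norm v"
    using norm_equiv by blast
  have "norm (u n) \<le> B / c" for n
    using c(3)[of "u n"] assms[of n] c(1) by (simp add: field_simps)
  then have "bounded (range u)" by (auto simp: bounded_iff)
  then obtain l r where r: "strict_mono r" "(u \<circ> r) \<longlonglongrightarrow> l"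
    using bounded_imp_convergent_subsequence[of u] by blast
  have "(\<lambda>n. C * norm (u (r n) - l)) \<longlonglongrightarrow> C * 0"
    using r(2) by (intro tendsto_mult_left) (simp add: o_def LIM_zero tendsto_norm_zero)
  then have "(\<lambda>n. N (u (r n) - l)) \<longlonglongrightarrow> 0"
    unfolding mult_zero_right by (rule Lim_null_comparison[rotated]) (simp add: c(4))
  with r(1) show ?thesis using that by blast
qed

subsection \<open>Orthogonal projections\<close>

text \<open>Gram-Schmidt, one vector at a time: \<open>b\<close> enters through its component
  \<open>b'\<close> orthogonal to \<open>B\<close>.\<close>

lemma ex_proj_span:
  assumes "finite B"
  shows "\<exists>w\<in>vec.span B. \<forall>u\<in>B. ip (v - w) u = 0"
  using assms
proof (induction B arbitrary: v rule: finite_induct)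
  case (insert b B)
  have orth: "ip z u = 0" if "\<forall>u\<in>B. ip z u = 0" "u \<in> vec.span B" for z u
    using that(2)
    by (induction u rule: vec.span_induct_alt) (use that(1) in \<open>auto simp: ip_add_right ip_scale_right\<close>)
  obtain b0 where b0: "b0 \<in> vec.span B" "\<forall>u\<in>B. ip (b - b0) u = 0" using insert.IH by blast
  obtain w0 where w0: "w0 \<in> vec.span B" "\<forall>u\<in>B. ip (v - w0) u = 0" using insert.IH by blast
  define b' where "b' = b - b0"
  \<comment> \<open>If \<open>b' = 0\<close> the quotient is 0 by convention, and the correction
    \<open>c *s b'\<close> vanishes anyway.\<close>
  define c where "c = ip (v - w0) b' / ip b' b'"
  define w where "w = w0 + c *s b'"
  have "b0 \<in> vec.span (insert b B)" "w0 \<in> vec.span (insert b B)" "b \<in> vec.span (insert b B)"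
    using b0 w0 vec.span_mono[of B "insert b B"] vec.span_base[of b] by auto
  then have w: "w \<in> vec.span (insert b B)"
    unfolding w_def b'_def by (intro vec.span_add vec.span_scale vec.span_diff)
  have vw: "v - w = (v - w0) - c *s b'" by (simp add: w_def)
  have 1: "\<forall>u\<in>B. ip (v - w) u = 0"
    unfolding vw using b0 w0 by (simp add: b'_def ip_diff_left ip_scale_left)
  have "ip (v - w) b' = 0"
    by (cases "b' = 0") (simp_all add: vw ip_diff_left ip_scale_left c_def ip_self)
  moreover have "b = b' + b0" by (simp add: b'_def)
  ultimately have "ip (v - w) b = 0" using orth[OF 1 b0(1)] by (simp add: ip_add_right)
  with 1 w show ?case by blast
qed auto

definition proj :: "('k ^ 'n) set \<Rightarrow> 'k ^ 'n \<Rightarrow> 'k ^ 'n" where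
  "proj Q v = (SOME w. w \<in> Q \<and> (\<forall>u\<in>Q. ip (v - w) u = 0))"

lemma
  assumes "vec.subspace Q"
  shows proj_in: "proj Q v \<in> Q" and proj_orth: "u \<in> Q \<Longrightarrow> ip (v - proj Q v) u = 0"
proof -
  obtain B where B: "B \<subseteq> Q" "vec.independent B" "Q \<subseteq> vec.span B"
    using vec.basis_exists by metis
  have span: "vec.span B = Q" using B assms by (simp add: vec.span_minimal subset_antisym)
  obtain w where w: "w \<in> vec.span B" "\<forall>u\<in>B. ip (v - w) u = 0"
    using ex_proj_span[OF vec.finiteI_independent[OF B(2)]] by blast
  have "ip (v - w) u = 0" if "u \<in> vec.span B" for u
    using that
    by (induction u rule: vec.span_induct_alt) (use w(2) in \<open>auto simp: ip_add_right ip_scale_right\<close>)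
  then have "\<exists>w. w \<in> Q \<and> (\<forall>u\<in>Q. ip (v - w) u = 0)" using w(1) span by blast
  then have "proj Q v \<in> Q \<and> (\<forall>u\<in>Q. ip (v - proj Q v) u = 0)"
    unfolding proj_def by (rule someI_ex)
  then show "proj Q v \<in> Q" "u \<in> Q \<Longrightarrow> ip (v - proj Q v) u = 0" by blast+
qed

lemma proj_pythagoras:
  assumes "vec.subspace Q" "w \<in> Q"
  shows "(N (v - w))\<^sup>2 = (N (v - proj Q v))\<^sup>2 + (N (proj Q v - w))\<^sup>2"
proof -
  have "ip (v - proj Q v) (proj Q v - w) = 0"
    using assms by (intro proj_orth vec.subspace_diff proj_in)
  from N_pythagoras[OF this] show ?thesis by simp
qed

lemma proj_closest:
  assumes "vec.subspace Q" "w \<in> Q"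
  shows "N (v - proj Q v) \<le> N (v - w)"
  by (rule power2_le_imp_le) (use proj_pythagoras[OF assms, of v] in simp_all)

lemma N_proj_le:
  assumes "vec.subspace Q"
  shows "N (proj Q v) \<le> N v"
proof (rule power2_le_imp_le)
  show "(N (proj Q v))\<^sup>2 \<le> (N v)\<^sup>2"
    using proj_pythagoras[OF assms vec.subspace_0[OF assms], of v] by simp
qed simp

subsection \<open>The distance between subspaces\<close>

text \<open>The inequality \<open>subspace_dist ip P Q \<le> \<epsilon>\<close> freed of suprema and
  infima. It is homogeneous in \<open>v\<close>, makes sense for zero subspaces too, and allows
  \<open>P\<close> to be smaller than \<open>Q\<close>.\<close>

definition near :: "real \<Rightarrow> ('k ^ 'n) set \<Rightarrow> ('k ^ 'n) set \<Rightarrow> bool" where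
  "near \<epsilon> P Q \<longleftrightarrow> (\<forall>v\<in>P. \<exists>w\<in>Q. N (v - w) \<le> \<epsilon> * N v)"

lemma nearI: "(\<And>v. v \<in> P \<Longrightarrow> \<exists>w\<in>Q. N (v - w) \<le> \<epsilon> * N v) \<Longrightarrow> near \<epsilon> P Q"
  by (simp add: near_def)

lemma near_proj:
  assumes "near \<epsilon> P Q" "vec.subspace Q" "v \<in> P"
  shows "N (v - proj Q v) \<le> \<epsilon> * N v"
  using assms proj_closest unfolding near_def by (meson order_trans)

lemma near_mono: "near \<epsilon> P Q \<Longrightarrow> \<epsilon> \<le> \<epsilon>' \<Longrightarrow> near \<epsilon>' P Q"
  unfolding near_def by (meson N_nonneg mult_right_mono order_trans)

lemma near_trans:
  assumes "near \<epsilon> P Q" "near \<epsilon>' Q R" "vec.subspace Q" "0 \<le> \<epsilon>'"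
  shows "near (\<epsilon> + \<epsilon>') P R"
proof (rule nearI)
  fix v assume v: "v \<in> P"
  \<comment> \<open>The projection is taken as the intermediate point because its norm is at most
    \<open>N v\<close>; for an arbitrary nearby point the errors would pick up a product
    term.\<close>
  let ?q = "proj Q v"
  obtain w where w: "w \<in> R" "N (?q - w) \<le> \<epsilon>' * N ?q"
    using assms(2) proj_in[OF assms(3)] unfolding near_def by blast
  have "N (v - w) \<le> N (v - ?q) + N (?q - w)" by (rule N_triangle_diff)
  also have "\<dots> \<le> \<epsilon> * N v + \<epsilon>' * N v"
    using near_proj[OF assms(1,3) v] w(2) mult_left_mono[OF N_proj_le[OF assms(3), of v] assms(4)]
    by linarith
  finally show "\<exists>w\<in>R. N (v - w) \<le> (\<epsilon> + \<epsilon>') * N v" using w(1) by (auto simp: distrib_right)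
qed

lemma near_1: "vec.subspace Q \<Longrightarrow> near 1 P Q"
  by (rule nearI) (auto intro: bexI[of _ 0] vec.subspace_0)

lemma near_0_imp_subset:
  assumes "vec.subspace Q" "\<And>\<epsilon>. \<epsilon> > 0 \<Longrightarrow> near \<epsilon> P Q"
  shows "P \<subseteq> Q"
proof
  fix v assume v: "v \<in> P"
  have "N (v - proj Q v) \<le> 0"
  proof (rule field_le_epsilon)
    fix e :: real assume "e > 0"
    \<comment> \<open>Adding 1 to the denominator covers \<open>v = 0\<close> without a case
      distinction.\<close>
    have "N (v - proj Q v) \<le> e / (N v + 1) * N v"
      using near_proj[OF assms(2)[of "e / (N v + 1)"] assms(1) v] \<open>e > 0\<close>
      by (simp add: add_nonneg_pos)
    also have "\<dots> = e * (N v / (N v + 1))" by simp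
    also have "\<dots> \<le> e * 1"
      using \<open>e > 0\<close> N_nonneg[of v] by (intro mult_left_mono) (auto simp: divide_le_eq_1 add_nonneg_pos)
    finally show "N (v - proj Q v) \<le> 0 + e" by simp
  qed
  then have "v = proj Q v" using N_nonneg[of "v - proj Q v"] by (metis N_eq_0 order_antisym right_minus_eq)
  then show "v \<in> Q" using proj_in[OF assms(1)] by metis
qed

text \<open>The Gram determinant is the squared area of the parallelogram: the height over the line
  of \<open>w\<close>, times \<open>N w\<close>.\<close>

lemma sin_angle_eq:
  assumes "w \<noteq> 0"
  shows "sin_angle ip v w = N (v - (ip v w / ip w w) *s w) / N v"
proof -
  let ?x = "N (v - (ip v w / ip w w) *s w)"
  have "ip v v * ip w w - ip v w * ip w v = of_real ((N v)\<^sup>2 * (N w)\<^sup>2 - (norm (ip v w))\<^sup>2)"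
    unfolding ip_self ip_conj[of w v] mult_conjugate_of_real by simp
  also have "\<dots> = of_real ((?x * N w)\<^sup>2)"
    unfolding N_sq_line[OF assms, symmetric] by (simp only: power_mult_distrib)
  finally have "wedge_norm ip v w = ?x * N w"
    unfolding wedge_norm_def by (simp del: of_real_power add: abs_mult)
  then show ?thesis using assms by (simp add: sin_angle_def)
qed

lemma sin_angle_nonneg: "0 \<le> sin_angle ip v w"
  by (simp add: sin_angle_def wedge_norm_def)

lemma sin_angle_le_1: "v \<noteq> 0 \<Longrightarrow> w \<noteq> 0 \<Longrightarrow> sin_angle ip v w \<le> 1"
proof -
  assume "v \<noteq> 0" "w \<noteq> 0"
  have "(N (v - (ip v w / ip w w) *s w))\<^sup>2 * (N w)\<^sup>2 \<le> (N v)\<^sup>2 * (N w)\<^sup>2"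
    unfolding N_sq_line[OF \<open>w \<noteq> 0\<close>] by simp
  then have "(N (v - (ip v w / ip w w) *s w))\<^sup>2 \<le> (N v)\<^sup>2"
    by (rule mult_right_le_imp_le) (use \<open>w \<noteq> 0\<close> in simp)
  then have "N (v - (ip v w / ip w w) *s w) \<le> N v" by (rule power2_le_imp_le) simp
  then show ?thesis using sin_angle_eq[OF \<open>w \<noteq> 0\<close>] N_pos[OF \<open>v \<noteq> 0\<close>] by simp
qed

lemma INF_sin_angle:
  assumes Q: "vec.subspace Q" "Q \<noteq> {0}" and v: "v \<noteq> 0"
  shows "(INF w\<in>Q - {0}. sin_angle ip v w) = N (v - proj Q v) / N v"
proof (rule antisym)
  have bdd: "bdd_below (sin_angle ip v ` (Q - {0}))"
    using sin_angle_nonneg by (intro bdd_belowI2[of _ 0]) auto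
  obtain w0 where w0: "w0 \<in> Q" "w0 \<noteq> 0" using Q vec.subspace_0[OF Q(1)] by blast
  have ne: "Q - {0} \<noteq> {}" using w0 by blast
  show "N (v - proj Q v) / N v \<le> (INF w\<in>Q - {0}. sin_angle ip v w)"
  proof (rule cINF_greatest[OF ne])
    fix w assume w: "w \<in> Q - {0}"
    have "N (v - proj Q v) \<le> N (v - (ip v w / ip w w) *s w)"
      using w by (intro proj_closest[OF Q(1)] vec.subspace_scale[OF Q(1)]) auto
    then show "N (v - proj Q v) / N v \<le> sin_angle ip v w"
      using w sin_angle_eq[of w v] N_pos[OF v] by (simp add: divide_right_mono)
  qed
  show "(INF w\<in>Q - {0}. sin_angle ip v w) \<le> N (v - proj Q v) / N v"
  proof (cases "proj Q v = 0")
    \<comment> \<open>Here \<open>v\<close> is orthogonal to \<open>Q\<close> and the projection is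
      not an admissible competitor; but the right-hand side is 1, so any nonzero \<open>w0\<close>
      will do.\<close>
    case True
    have "(INF w\<in>Q - {0}. sin_angle ip v w) \<le> sin_angle ip v w0"
      using w0 by (intro cINF_lower[OF bdd]) auto
    also have "\<dots> \<le> 1" using sin_angle_le_1 v w0 by blast
    finally show ?thesis using True v by simp
  next
    case False
    let ?w = "proj Q v"
    have "(INF w\<in>Q - {0}. sin_angle ip v w) \<le> sin_angle ip v ?w"
      using False proj_in[OF Q(1)] by (intro cINF_lower[OF bdd]) auto
    also have "sin_angle ip v ?w = N (v - ?w) / N v"
    proof -
      have "ip (v - ?w) ?w = 0" by (intro proj_orth Q proj_in)
      then have "ip v ?w = ip ?w ?w" by (simp add: ip_diff_left)
      then show ?thesis using False by (simp add: sin_angle_eq ip_self)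
    qed
    finally show ?thesis .
  qed
qed

lemma subspace_dist_le_iff:
  assumes P: "vec.subspace P" "P \<noteq> {0}" and Q: "vec.subspace Q" "Q \<noteq> {0}"
  shows "subspace_dist ip P Q \<le> \<epsilon> \<longleftrightarrow> near \<epsilon> P Q"
proof -
  have eq: "subspace_dist ip P Q = (SUP v\<in>P - {0}. N (v - proj Q v) / N v)"
    unfolding subspace_dist_def by (rule SUP_cong[OF refl]) (auto simp: INF_sin_angle[OF Q])
  have ne: "P - {0} \<noteq> {}" using P vec.subspace_0 by blast
  \<comment> \<open>A real supremum is meaningful only over a bounded set; the bound comes from
    comparing with the vector 0 of \<open>Q\<close>.\<close>
  have "N (v - proj Q v) / N v \<le> 1" if "v \<in> P - {0}" for v
    using that near_proj[OF near_1[OF Q(1), of P] Q(1), of v] N_pos[of v] by simp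
  then have bdd: "bdd_above ((\<lambda>v. N (v - proj Q v) / N v) ` (P - {0}))" by (intro bdd_aboveI2)
  have "subspace_dist ip P Q \<le> \<epsilon> \<longleftrightarrow> (\<forall>v\<in>P - {0}. N (v - proj Q v) / N v \<le> \<epsilon>)"
    unfolding eq by (rule cSUP_le_iff[OF ne bdd])
  also have "\<dots> \<longleftrightarrow> (\<forall>v\<in>P. N (v - proj Q v) \<le> \<epsilon> * N v)"
  proof -
    have "N (v - proj Q v) / N v \<le> \<epsilon> \<longleftrightarrow> N (v - proj Q v) \<le> \<epsilon> * N v" if "v \<noteq> 0" for v
      using N_pos[OF that] by (rule pos_divide_le_eq)
    moreover have "N (0 - proj Q 0) \<le> \<epsilon> * N 0"
      using near_proj[OF near_1[OF Q(1), of UNIV] Q(1), of 0] by simp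
    ultimately show ?thesis by auto
  qed
  also have "\<dots> \<longleftrightarrow> near \<epsilon> P Q"
    unfolding near_def using proj_in[OF Q(1)] proj_closest[OF Q(1)] by (meson order_trans)
  finally show ?thesis .
qed

lemma subspace_dist_nonneg:
  assumes P: "vec.subspace P" "P \<noteq> {0}" and Q: "vec.subspace Q" "Q \<noteq> {0}"
  shows "0 \<le> subspace_dist ip P Q"
proof -
  obtain v where v: "v \<in> P" "v \<noteq> 0" using P vec.subspace_0 by blast
  have "near (subspace_dist ip P Q) P Q" using subspace_dist_le_iff[OF assms] by blast
  from near_proj[OF this Q(1) v(1)] have "0 \<le> subspace_dist ip P Q * N v"
    using N_nonneg order_trans by blast
  then show ?thesis using N_pos[OF v(2)] by (simp add: zero_le_mult_iff)
qed

lemma grassmannian_subspace: "V \<in> grassmannian k \<Longrightarrow> vec.subspace V"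
  and grassmannian_nonzero: "V \<in> grassmannian k \<Longrightarrow> 1 \<le> k \<Longrightarrow> V \<noteq> {0}"
  unfolding grassmannian_def by auto

section \<open>Projections, dimensions and the symmetry of closeness\<close>

lemma dim_image_trivial_kernel:
  assumes V: "vec.subspace V" and lf: "Vector_Spaces.linear (*s) (*s) f"
    and inj: "\<And>v. v \<in> V \<Longrightarrow> f v = 0 \<Longrightarrow> v = 0"
  shows "vec.dim (f ` V) = vec.dim (V :: ('k ^ 'n) set)"
proof (rule vec.dim_image_eq[OF lf])
  show "inj_on f (vec.span V)"
  proof (rule inj_onI)
    fix u v assume "u \<in> vec.span V" "v \<in> vec.span V" "f u = f v"
    moreover have "vec.span V = V" using V by (simp add: vec.span_eq_iff)
    moreover have "f (u - v) = f u - f v" by (rule vec.linear_diff[OF lf])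
    ultimately show "u = v" using inj[of "u - v"] vec.subspace_diff[OF V] by simp
  qed
qed

lemma proj_unique:
  assumes "vec.subspace Q" "w \<in> Q" "\<And>u. u \<in> Q \<Longrightarrow> ip (v - w) u = 0"
  shows "proj Q v = w"
proof -
  have "proj Q v - w \<in> Q" using assms by (intro vec.subspace_diff proj_in)
  then have "ip (v - w) (proj Q v - w) - ip (v - proj Q v) (proj Q v - w) = 0"
    using assms(3) proj_orth[OF assms(1)] by simp
  then have "ip (proj Q v - w) (proj Q v - w) = 0"
    by (simp add: ip_diff_left algebra_simps)
  then show ?thesis by (simp add: ip_self)
qed

lemma linear_proj:
  assumes "vec.subspace Q"
  shows "Vector_Spaces.linear (*s) (*s) (proj Q)"
proof -
  have "proj Q (u + v) = proj Q u + proj Q v" for u v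
  proof (rule proj_unique[OF assms])
    show "proj Q u + proj Q v \<in> Q" using assms by (intro vec.subspace_add proj_in)
    fix z assume "z \<in> Q"
    then have "ip (u - proj Q u) z + ip (v - proj Q v) z = 0" using proj_orth[OF assms] by simp
    then show "ip (u + v - (proj Q u + proj Q v)) z = 0"
      by (simp add: ip_diff_left ip_add_left algebra_simps)
  qed
  moreover have "proj Q (c *s u) = c *s proj Q u" for c u
  proof (rule proj_unique[OF assms])
    show "c *s proj Q u \<in> Q" using assms by (intro vec.subspace_scale proj_in)
    fix z assume "z \<in> Q"
    then have "c * ip (u - proj Q u) z = 0" using proj_orth[OF assms] by simp
    then show "ip (c *s u - c *s proj Q u) z = 0"
      by (simp add: ip_diff_left ip_scale_left algebra_simps)
  qed
  ultimately show ?thesis by unfold_locales (auto simp: vec.scale_right_distrib vec.scale_left_distrib)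
qed

lemma proj_nonzero_if_near:
  assumes "near \<epsilon> P Q" "\<epsilon> < 1" "vec.subspace Q" "v \<in> P" "proj Q v = 0"
  shows "v = 0"
  using near_proj[OF assms(1,3,4)] assms(2,5) N_pos[of v] by (cases "v = 0") auto

text \<open>For \<open>\<epsilon> < 1\<close> no nonzero vector of \<open>P\<close> is orthogonal to
  \<open>Q\<close>, so the projection embeds \<open>P\<close> into \<open>Q\<close>.\<close>

lemma near_imp_dim_le:
  assumes "near \<epsilon> P Q" "\<epsilon> < 1" "vec.subspace P" "vec.subspace Q"
  shows "vec.dim P \<le> vec.dim Q"
proof -
  have "vec.dim (proj Q ` P) = vec.dim P"
    using dim_image_trivial_kernel[OF assms(3) linear_proj[OF assms(4)]]
      proj_nonzero_if_near[OF assms(1,2,4)] by blast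
  moreover have "proj Q ` P \<subseteq> Q" using proj_in[OF assms(4)] by blast
  ultimately show ?thesis using vec.dim_subset by metis
qed

text \<open>The projection \<open>P \<rightarrow> Q\<close> is bijective and its adjoint is the projection \<open>Q \<rightarrow> P\<close>, so both have
  the same smallest singular value.\<close>

lemma near_sym:
  assumes near: "near \<epsilon> P Q" and P: "vec.subspace P" and Q: "vec.subspace Q"
    and dim: "vec.dim P = vec.dim Q" and \<epsilon>: "0 \<le> \<epsilon>"
  shows "near \<epsilon> Q P"
proof (cases "\<epsilon> < 1")
  case False
  then show ?thesis using near_mono[OF near_1[OF P]] by simp
next
  case True
  have lin: "Vector_Spaces.linear (*s) (*s) (proj Q)" by (rule linear_proj[OF Q])
  have sub: "proj Q ` P \<subseteq> Q" using proj_in[OF Q] by blast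
  have "vec.dim (proj Q ` P) = vec.dim P"
    using dim_image_trivial_kernel[OF P lin] proj_nonzero_if_near[OF near True Q] by blast
  then have surj: "proj Q ` P = Q"
    using vec.subspace_dim_equal[OF vec.linear_subspace_image[OF lin P] Q sub] dim by simp
  show ?thesis
  proof (rule nearI)
    fix w assume "w \<in> Q"
    then obtain v where v: "v \<in> P" "w = proj Q v" using surj by blast
    let ?u = "proj P w"
    have u: "?u \<in> P" by (rule proj_in[OF P])
    have vw: "(N v)\<^sup>2 = (N (v - w))\<^sup>2 + (N w)\<^sup>2"
      using proj_pythagoras[OF Q vec.subspace_0[OF Q], of v] v by simp
    have "(N (v - w))\<^sup>2 \<le> (\<epsilon> * N v)\<^sup>2"
      using near_proj[OF near Q v(1)] v by (intro power_mono) auto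
    then have 1: "(1 - \<epsilon>\<^sup>2) * (N v)\<^sup>2 \<le> (N w)\<^sup>2"
      using vw by (simp add: power_mult_distrib algebra_simps)
    have "ip (v - w) w = 0" using proj_orth[OF Q] v \<open>w \<in> Q\<close> by blast
    then have vww: "ip w v = ip w w"
      by (metis ip_diff_left eq_iff_diff_eq_0 ip_conj)
    have "ip (w - ?u) v = 0" by (rule proj_orth[OF P v(1)])
    \<comment> \<open>Pairing the projection of \<open>w\<close> with its preimage \<open>v\<close>
      is the adjointness. Cauchy-Schwarz then bounds \<open>N ?u\<close> from below by means of the
      upper bound 1 on \<open>N v\<close>; squares are kept throughout to avoid roots.\<close>
    then have "ip ?u v = ip w w" using vww by (simp add: ip_diff_left)
    then have "(N w)\<^sup>2 \<le> N ?u * N v" using Cauchy_Schwarz[of ?u v] by (simp add: ip_self norm_power)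
    then have "((N w)\<^sup>2)\<^sup>2 \<le> (N ?u)\<^sup>2 * (N v)\<^sup>2"
      using power_mono[of "(N w)\<^sup>2" "N ?u * N v" 2] by (simp add: power_mult_distrib)
    then have "(1 - \<epsilon>\<^sup>2) * ((N w)\<^sup>2)\<^sup>2 \<le> (1 - \<epsilon>\<^sup>2) * ((N ?u)\<^sup>2 * (N v)\<^sup>2)"
      using True \<epsilon> by (intro mult_left_mono) (auto simp: power_le_one)
    also have "\<dots> = (N ?u)\<^sup>2 * ((1 - \<epsilon>\<^sup>2) * (N v)\<^sup>2)" by simp
    also have "\<dots> \<le> (N ?u)\<^sup>2 * (N w)\<^sup>2" using 1 by (intro mult_left_mono) auto
    finally have 2: "(1 - \<epsilon>\<^sup>2) * (N w)\<^sup>2 * (N w)\<^sup>2 \<le> (N ?u)\<^sup>2 * (N w)\<^sup>2"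
      by (simp add: power2_eq_square mult.assoc)
    have "(1 - \<epsilon>\<^sup>2) * (N w)\<^sup>2 \<le> (N ?u)\<^sup>2"
    proof (cases "w = 0")
      case False
      then show ?thesis using 2 N_pos[OF False] by simp
    qed simp
    moreover have "(N w)\<^sup>2 = (N (w - ?u))\<^sup>2 + (N ?u)\<^sup>2"
      using proj_pythagoras[OF P vec.subspace_0[OF P], of w] by simp
    ultimately have "(N (w - ?u))\<^sup>2 \<le> (\<epsilon> * N w)\<^sup>2"
      by (simp add: power_mult_distrib algebra_simps)
    then have "N (w - ?u) \<le> \<epsilon> * N w" by (rule power2_le_imp_le) (simp add: \<epsilon>)
    then show "\<exists>u\<in>P. N (w - u) \<le> \<epsilon> * N w" using u by blast
  qed
qed

subsection \<open>Orthonormal bases\<close>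

lemma dim_le_CARD: "vec.dim (S :: ('k ^ 'n) set) \<le> CARD('n)"
  using vec.dim_subset_UNIV[of S] unfolding vec.dimension_def card_cart_basis .

lemma orthonormal_independent:
  assumes "\<And>u. u \<in> B \<Longrightarrow> N u = 1" "\<And>u v. u \<in> B \<Longrightarrow> v \<in> B \<Longrightarrow> u \<noteq> v \<Longrightarrow> ip u v = 0"
  shows "vec.independent B"
proof
  assume "vec.dependent B"
  then obtain a where a: "a \<in> B" "a \<in> vec.span (B - {a})" unfolding vec.dependent_def by blast
  have "ip a u = 0" if "u \<in> vec.span (B - {a})" for u
    using that
    by (induction u rule: vec.span_induct_alt) (use assms(2) a in \<open>auto simp: ip_add_right ip_scale_right\<close>)
  then have "ip a a = 0" using a by blast
  then show False using assms(1)[OF a(1)] by (simp add: ip_self)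
qed

context
  fixes e
  assumes onb: "orthonormal_basis ip e"
begin

lemma onb_ip: "i \<in> {1..CARD('n)} \<Longrightarrow> j \<in> {1..CARD('n)} \<Longrightarrow> ip (e i) (e j) = (if i = j then 1 else 0)"
  using onb unfolding orthonormal_basis_def by blast

lemma onb_N: "i \<in> {1..CARD('n)} \<Longrightarrow> N (e i) = 1"
  using onb_ip[of i i] by (simp add: ip_norm_def)

lemma onb_inj: "inj_on e {1..CARD('n)}"
proof (rule inj_onI)
  fix i j assume "i \<in> {1..CARD('n)}" "j \<in> {1..CARD('n)}" "e i = e j"
  then show "i = j" using onb_ip[of i i] onb_ip[of i j] by (auto split: if_splits)
qed

lemma onb_dim:
  assumes "I \<subseteq> {1..CARD('n)}"
  shows "vec.dim (vec.span (e ` I)) = card I"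
proof -
  have "vec.independent (e ` I)"
  proof (rule orthonormal_independent)
    show "N u = 1" if "u \<in> e ` I" for u using that assms onb_N by blast
    fix u v assume uv: "u \<in> e ` I" "v \<in> e ` I" "u \<noteq> v"
    then obtain i j where "i \<in> I" "u = e i" "j \<in> I" "v = e j" by blast
    then show "ip u v = 0" using onb_ip[of i j] uv assms by (metis subsetD)
  qed
  then have "vec.dim (e ` I) = card (e ` I)" by (rule vec.dim_eq_card_independent)
  then show ?thesis using inj_on_subset[OF onb_inj assms] by (simp add: card_image)
qed

lemma onb_span: "vec.span (e ` {1..CARD('n)}) = UNIV"
proof -
  have "vec.dim (e ` {1..CARD('n)}) = vec.dimension TYPE('k) TYPE('n)"
    using onb_dim[of "{1..CARD('n)}"] by (simp add: vec.dimension_def card_cart_basis)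
  then show ?thesis using vec.dim_eq_full by blast
qed

lemma onb_coeff:
  assumes "I \<subseteq> {1..CARD('n)}" "j \<in> {1..CARD('n)}"
  shows "ip (\<Sum>i\<in>I. c i *s e i) (e j) = (if j \<in> I then c j else 0)"
proof -
  have "ip (\<Sum>i\<in>I. c i *s e i) (e j) = (\<Sum>i\<in>I. if i = j then c i else 0)"
    unfolding ip_sum_left ip_scale_left using assms onb_ip by (intro sum.cong) auto
  then show ?thesis using finite_subset[OF assms(1)] by simp
qed

lemma onb_N_sum:
  assumes "I \<subseteq> {1..CARD('n)}"
  shows "(N (\<Sum>i\<in>I. c i *s e i))\<^sup>2 = (\<Sum>i\<in>I. (norm (c i))\<^sup>2)"
proof -
  have "ip (\<Sum>i\<in>I. c i *s e i) (\<Sum>i\<in>I. c i *s e i) = (\<Sum>i\<in>I. conjugate (c i) * c i)"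
    unfolding ip_sum_right ip_scale_right
    using assms by (intro sum.cong refl) (subst onb_coeff; auto)
  also have "\<dots> = of_real (\<Sum>i\<in>I. (norm (c i))\<^sup>2)"
    unfolding of_real_sum by (intro sum.cong refl) (metis mult.commute mult_conjugate_of_real)
  finally show ?thesis unfolding ip_self by (simp only: of_real_eq_iff)
qed

lemma onb_span_coeff_0:
  assumes "I \<subseteq> {1..CARD('n)}" "v \<in> vec.span (e ` I)" "j \<in> {1..CARD('n)} - I"
  shows "ip v (e j) = 0"
  using assms(2)
proof (induction v rule: vec.span_induct_alt)
  case (step c x y)
  then obtain i where "i \<in> I" "x = e i" by blast
  then have "ip x (e j) = 0" using onb_ip[of i j] assms by auto
  then show ?case using step by (simp add: ip_add_left ip_scale_left)
qed simp

lemma onb_expand: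
  assumes "I \<subseteq> {1..CARD('n)}" "v \<in> vec.span (e ` I)"
  shows "v = (\<Sum>i\<in>I. ip v (e i) *s e i)"
proof -
  define z where "z = v - (\<Sum>i\<in>I. ip v (e i) *s e i)"
  have "z \<in> vec.span (e ` I)"
    unfolding z_def using assms
    by (intro vec.span_diff vec.span_sum vec.span_scale) (auto intro: vec.span_base)
  have 1: "ip z (e j) = 0" if "j \<in> {1..CARD('n)}" for j
    unfolding z_def ip_diff_left onb_coeff[OF assms(1) that]
    using onb_span_coeff_0[OF assms] that by auto
  have "ip z u = 0" if "u \<in> vec.span (e ` {1..CARD('n)})" for u
    using that
    by (induction u rule: vec.span_induct_alt) (use 1 in \<open>auto simp: ip_add_right ip_scale_right\<close>)
  then have "ip z z = 0" unfolding onb_span by blast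
  then have "z = 0" by (simp add: ip_self)
  then show ?thesis by (simp add: z_def)
qed

end

subsection \<open>Singular values\<close>

context
  fixes A s e f
  assumes svd: "singular_value_decomposition ip A s e f"
begin

lemma
  shows svd_onb: "orthonormal_basis ip e" "orthonormal_basis ip f"
    and svd_nonneg: "i \<in> {1..CARD('n)} \<Longrightarrow> 0 \<le> s i"
    and svd_image: "i \<in> {1..CARD('n)} \<Longrightarrow> A *v e i = of_real (s i) *s f i"
    and svd_mono: "i \<in> {1..CARD('n)} \<Longrightarrow> j \<in> {1..CARD('n)} \<Longrightarrow> i \<le> j \<Longrightarrow> s j \<le> s i"
  using svd unfolding singular_value_decomposition_def by blast+

lemma svd_apply:
  assumes "I \<subseteq> {1..CARD('n)}" "v \<in> vec.span (e ` I)"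
  shows "A *v v = (\<Sum>i\<in>I. (ip v (e i) * of_real (s i)) *s f i)"
proof -
  have "A *v v = A *v (\<Sum>i\<in>I. ip v (e i) *s e i)" using onb_expand[OF svd_onb(1) assms] by simp
  also have "\<dots> = (\<Sum>i\<in>I. ip v (e i) *s (A *v e i))"
    by (simp add: vec.sum vec.scale)
  also have "\<dots> = (\<Sum>i\<in>I. (ip v (e i) * of_real (s i)) *s f i)"
    using assms(1) svd_image by (intro sum.cong refl) (auto simp: vec.scale_scale)
  finally show ?thesis .
qed

lemma svd_N_apply:
  assumes "I \<subseteq> {1..CARD('n)}" "v \<in> vec.span (e ` I)"
  shows "(N (A *v v))\<^sup>2 = (\<Sum>i\<in>I. (norm (ip v (e i)))\<^sup>2 * (s i)\<^sup>2)"
  unfolding svd_apply[OF assms] onb_N_sum[OF svd_onb(2) assms(1)]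
  by (simp add: norm_mult power_mult_distrib)

lemma svd_N:
  assumes "I \<subseteq> {1..CARD('n)}" "v \<in> vec.span (e ` I)"
  shows "(N v)\<^sup>2 = (\<Sum>i\<in>I. (norm (ip v (e i)))\<^sup>2)"
  using onb_N_sum[OF svd_onb(1) assms(1), of "\<lambda>i. ip v (e i)"] onb_expand[OF svd_onb(1) assms]
  by simp

lemma svd_lower:
  assumes "k \<in> {1..CARD('n)}" "v \<in> vec.span (e ` {1..k})"
  shows "s k * N v \<le> N (A *v v)"
proof (rule power2_le_imp_le)
  have I: "{1..k} \<subseteq> {1..CARD('n)}" using assms by auto
  have "(s k * N v)\<^sup>2 = (\<Sum>i\<in>{1..k}. (norm (ip v (e i)))\<^sup>2 * (s k)\<^sup>2)"
    unfolding power_mult_distrib svd_N[OF I assms(2)] by (simp add: sum_distrib_left mult.commute)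
  also have "\<dots> \<le> (N (A *v v))\<^sup>2"
    unfolding svd_N_apply[OF I assms(2)] using assms(1) svd_nonneg svd_mono
    by (intro sum_mono mult_left_mono power_mono) auto
  finally show "(s k * N v)\<^sup>2 \<le> (N (A *v v))\<^sup>2" .
qed simp

lemma svd_upper:
  assumes "k \<in> {1..CARD('n)}" "v \<in> vec.span (e ` {k..CARD('n)})"
  shows "N (A *v v) \<le> s k * N v"
proof (rule power2_le_imp_le)
  have I: "{k..CARD('n)} \<subseteq> {1..CARD('n)}" using assms by auto
  have "(N (A *v v))\<^sup>2 \<le> (\<Sum>i\<in>{k..CARD('n)}. (norm (ip v (e i)))\<^sup>2 * (s k)\<^sup>2)"
    unfolding svd_N_apply[OF I assms(2)] using assms(1) svd_nonneg svd_mono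
    by (intro sum_mono mult_left_mono power_mono) auto
  also have "\<dots> = (s k * N v)\<^sup>2"
    unfolding power_mult_distrib svd_N[OF I assms(2)] by (simp add: sum_distrib_left mult.commute)
  finally show "(N (A *v v))\<^sup>2 \<le> (s k * N v)\<^sup>2" .
qed (use svd_nonneg assms in simp)

text \<open>One half of the Courant-Fischer principle. The span of \<open>e k\<close>, ...,
  \<open>e d\<close> has dimension d + 1 - k, so it meets \<open>W\<close> in a nonzero vector, and
  \<open>A\<close> stretches that vector by at most \<open>s k\<close>.\<close>

lemma svd_minmax:
  assumes k: "k \<in> {1..CARD('n)}" and W: "vec.subspace W" "k \<le> vec.dim W"
    and le: "\<And>v. v \<in> W \<Longrightarrow> t * N v \<le> N (A *v v)"
  shows "t \<le> s k"
proof -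
  let ?V = "vec.span (e ` {k..CARD('n)})"
  have V: "vec.subspace ?V" by simp
  have "{k..CARD('n)} \<subseteq> {1..CARD('n)}" using k by auto
  then have dV: "vec.dim ?V = CARD('n) + 1 - k"
    using onb_dim[OF svd_onb(1), of "{k..CARD('n)}"] by simp
  have "vec.dim {x + y |x y. x \<in> W \<and> y \<in> ?V} + vec.dim (W \<inter> ?V) = vec.dim W + vec.dim ?V"
    by (rule vec.dim_sums_Int[OF W(1) V])
  moreover have "vec.dim {x + y |x y. x \<in> W \<and> y \<in> ?V} \<le> CARD('n)"
    by (rule dim_le_CARD)
  ultimately have "vec.dim (W \<inter> ?V) \<noteq> 0"
    using dV W(2) k unfolding atLeastAtMost_iff by linarith
  then have "W \<inter> ?V \<noteq> {0}" by auto
  moreover have "0 \<in> W \<inter> ?V" using vec.subspace_0[OF W(1)] vec.subspace_0[OF V] by blast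
  ultimately obtain v where v: "v \<in> W" "v \<in> ?V" "v \<noteq> 0" by blast
  have "t * N v \<le> s k * N v" using le[OF v(1)] svd_upper[OF k v(2)] by linarith
  then show ?thesis using N_pos[OF v(3)] by simp
qed

end

text \<open>Each decomposition supplies the test subspace, the span of its first \<open>k\<close>
  vectors, for the other. This justifies the definite description in
  \<open>singular_value\<close>.\<close>

lemma svd_unique:
  assumes "singular_value_decomposition ip A s e f" "singular_value_decomposition ip A s' e' f'"
    and k: "k \<in> {1..CARD('n)}"
  shows "s k = s' k"
proof -
  have "s k \<le> s' k" if svd: "singular_value_decomposition ip A s e f"
    and svd': "singular_value_decomposition ip A s' e' f'" for s e f s' e' f'
  proof (rule svd_minmax[OF svd' k])
    have "{1..k} \<subseteq> {1..CARD('n)}" using k by auto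
    then show "k \<le> vec.dim (vec.span (e ` {1..k}))"
      using onb_dim[OF svd_onb(1)[OF svd], of "{1..k}"] by simp
  qed (use svd_lower[OF svd k] in auto)
  from this[OF assms(1,2)] this[OF assms(2,1)] show ?thesis by simp
qed

lemma singular_value_eq:
  assumes "singular_value_decomposition ip A s e f" "k \<in> {1..CARD('n)}"
  shows "singular_value ip k A = s k"
  unfolding singular_value_def using assms svd_unique by (intro the_equality) blast+

subsection \<open>Existence of singular value decompositions\<close>

text \<open>The quotient of \<open>N (A *v v)\<close> by \<open>N v\<close> is homogeneous of degree
  0, so its maximum is attained on the compact unit sphere of \<open>W\<close>.\<close>

lemma ex_N_maximizer:
  assumes W: "vec.subspace W" "W \<noteq> {0}"
  obtains e where "e \<in> W" "N e = 1" "\<And>v. v \<in> W \<Longrightarrow> N (A *v v) \<le> N (A *v e) * N v"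
proof -
  let ?S = "{v \<in> W. N v = 1}"
  have unit: "of_real (1 / N v) *s v \<in> ?S" if "v \<in> W" "v \<noteq> 0" for v
    using that vec.subspace_scale[OF W(1)] N_pos[OF that(2)] by (auto simp: N_scale norm_divide)
  obtain v0 where "v0 \<in> W" "v0 \<noteq> 0" using W vec.subspace_0 by blast
  then have ne: "?S \<noteq> {}" using unit by blast
  obtain c C where c: "0 < c" "0 < C" "\<And>v. c * norm v \<le> N v" "\<And>v. N v \<le> C * norm v"
    using norm_equiv by blast
  have "norm v \<le> 1 / c" if "v \<in> ?S" for v using c(3)[of v] that c(1) by (simp add: field_simps)
  then have "bounded ?S" unfolding bounded_iff by blast
  moreover have "closed {v. N v = 1}"
    by (intro closed_Collect_eq continuous_intros)
  then have "closed ?S" using closed_vec_subspace[OF W(1)] by (simp add: Collect_conj_eq closed_Int)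
  ultimately have comp: "compact ?S" by (simp add: compact_eq_bounded_closed)
  have cont: "continuous_on ?S (\<lambda>v. N (A *v v))"
    by (intro continuous_intros linear_continuous_on bounded_linear_matrix_vector_mult)
  obtain e where e: "e \<in> ?S" "\<And>v. v \<in> ?S \<Longrightarrow> N (A *v v) \<le> N (A *v e)"
    using continuous_attains_sup[OF comp ne cont] by blast
  have "N (A *v v) \<le> N (A *v e) * N v" if "v \<in> W" for v
  proof (cases "v = 0")
    case False
    have "N (A *v (of_real (1 / N v) *s v)) \<le> N (A *v e)" using e(2)[OF unit[OF that False]] .
    then have "N (A *v v) / N v \<le> N (A *v e)"
      using N_pos[OF False] by (simp add: vec.scale N_scale norm_divide)
    then show ?thesis using N_pos[OF False] by (simp add: field_simps)
  qed simp
  then show ?thesis using that e(1) by blast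
qed

text \<open>First variation of \<open>N (A v) / N v\<close> at its maximum.\<close>

lemma N_maximizer_orth:
  assumes W: "vec.subspace W" and e: "e \<in> W" "N e = 1"
    and max: "\<And>v. v \<in> W \<Longrightarrow> N (A *v v) \<le> N (A *v e) * N v"
    and v: "v \<in> W" "ip v e = 0"
  shows "ip (A *v e) (A *v v) = 0"
proof -
  define b where "b = ip (A *v e) (A *v v)"
  define c where "c = (N (A *v e))\<^sup>2 * (norm b)\<^sup>2 * (N v)\<^sup>2"
  \<comment> \<open>The perturbation of \<open>e\<close> is \<tau> b v. Including the factor
    \<open>b\<close> aligns the phase, so that the linear term is the real number 2 \<tau> |b|^2
    over either field.\<close>
  have ineq: "2 * \<tau> * (norm b)\<^sup>2 \<le> \<tau>\<^sup>2 * c" if "\<tau> > 0" for \<tau> :: real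
  proof -
    let ?t = "of_real \<tau> * b"
    have "e + ?t *s v \<in> W" by (intro vec.subspace_add vec.subspace_scale W e v)
    from power_mono[OF max[OF this], of 2]
    have le: "(N (A *v e + ?t *s (A *v v)))\<^sup>2 \<le> (N (A *v e))\<^sup>2 * (N (e + ?t *s v))\<^sup>2"
      by (simp add: power_mult_distrib vec.add vec.scale)
    have "ip e (?t *s v) = 0" using v(2) ip_eq_0_commute[of v e] by (simp add: ip_scale_right)
    from N_pythagoras[OF this] have 1: "(N (e + ?t *s v))\<^sup>2 = 1 + \<tau>\<^sup>2 * (norm b)\<^sup>2 * (N v)\<^sup>2"
      using e by (simp add: N_scale norm_mult power_mult_distrib)
    have bc: "ip (A *v v) (A *v e) = conjugate b" unfolding b_def by (rule ip_conj)
    have "ip (A *v e + ?t *s (A *v v)) (A *v e + ?t *s (A *v v))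
        = ip (A *v e) (A *v e) + of_real \<tau> * (b * conjugate b) + of_real \<tau> * (b * conjugate b)
          + (?t * conjugate ?t) * ip (A *v v) (A *v v)"
      by (simp add: ip_add_left ip_add_right ip_scale_left ip_scale_right bc b_def[symmetric]
          conjugate_mult algebra_simps)
    also have "\<dots> = of_real ((N (A *v e))\<^sup>2 + 2 * \<tau> * (norm b)\<^sup>2
        + (norm ?t)\<^sup>2 * (N (A *v v))\<^sup>2)"
      unfolding mult_conjugate_of_real ip_self by simp
    finally have 2: "(N (A *v e + ?t *s (A *v v)))\<^sup>2
        = (N (A *v e))\<^sup>2 + 2 * \<tau> * (norm b)\<^sup>2 + (norm ?t)\<^sup>2 * (N (A *v v))\<^sup>2"
      unfolding ip_self by (simp only: of_real_eq_iff)
    have "0 \<le> (norm ?t)\<^sup>2 * (N (A *v v))\<^sup>2" by simp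
    then have "(N (A *v e))\<^sup>2 + 2 * \<tau> * (norm b)\<^sup>2 \<le> (N (A *v e))\<^sup>2 * (1 + \<tau>\<^sup>2 * (norm b)\<^sup>2 * (N v)\<^sup>2)"
      using le unfolding 1 2 by linarith
    then show ?thesis unfolding c_def by (simp add: algebra_simps)
  qed
  have "(norm b)\<^sup>2 = 0"
  proof (rule ccontr)
    assume nz: "(norm b)\<^sup>2 \<noteq> 0"
    \<comment> \<open>With this value \<tau> c is at most |b|^2, whereas the inequality forces it to
      be at least 2 |b|^2. The 1 in the denominator covers \<open>c = 0\<close>.\<close>
    define \<tau> where "\<tau> = (norm b)\<^sup>2 / (c + 1)"
    have c0: "0 \<le> c" by (simp add: c_def)
    then have \<tau>: "\<tau> > 0" using nz by (simp add: \<tau>_def add_nonneg_pos)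
    have "\<tau> * (2 * (norm b)\<^sup>2) \<le> \<tau> * (\<tau> * c)"
      using ineq[OF \<tau>] by (simp add: power2_eq_square mult_ac)
    then have "2 * (norm b)\<^sup>2 \<le> \<tau> * c" using \<tau> by simp
    also have "\<dots> \<le> (norm b)\<^sup>2"
      unfolding \<tau>_def using c0 by (simp add: field_simps)
    finally show False using nz by simp
  qed
  then show ?thesis by (simp add: b_def)
qed

text \<open>Variational construction: \<open>e i\<close> maximises the stretching on the orthogonal
  complement of its predecessors. The first variation makes the images orthogonal, nesting of the
  complements makes the stretching factors decrease, and invertibility allows the images to be
  normalised.\<close>

lemma ex_svd:
  assumes A: "invertible A"
  shows "\<exists>s e f. singular_value_decomposition ip A s e f"
proof -
  define W where "W e i = {v. \<forall>j\<in>{1..<i}. ip v (e j) = 0}" for e :: "nat \<Rightarrow> 'k ^ 'n" and i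
  define P where "P e i \<longleftrightarrow> e i \<in> W e i \<and> N (e i) = 1 \<and>
      (\<forall>v\<in>W e i. N (A *v v) \<le> N (A *v e i) * N v)" for e i
  have W: "vec.subspace (W e i)" for e i
    unfolding W_def vec.subspace_def by (auto simp: ip_add_left ip_scale_left)
  have "\<exists>e. \<forall>i\<in>{1..k}. P e i" if "k \<le> CARD('n)" for k
    using that
  proof (induction k)
    case (Suc k)
    then obtain e where e: "\<forall>i\<in>{1..k}. P e i" by auto
    let ?V = "vec.span (e ` {1..k})"
    have "vec.dim ?V \<le> card (e ` {1..k})" by (rule vec.dim_le_card) auto
    also have "\<dots> \<le> k" using card_image_le[of "{1..k}" e] by simp
    finally have "vec.dim ?V < CARD('n)" using Suc.prems by simp
    then have "?V \<noteq> UNIV" using vec.dim_UNIV by (metis card_cart_basis nat_less_le)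
    then obtain v where v: "v \<notin> ?V" by blast
    have "v - proj ?V v \<in> W e (Suc k)"
      unfolding W_def
      by (intro CollectI ballI proj_orth vec.subspace_span vec.span_base imageI) simp
    moreover have "v - proj ?V v \<noteq> 0" using v proj_in[of ?V v] by auto
    ultimately have "W e (Suc k) \<noteq> {0}" by blast
    then obtain x where x: "x \<in> W e (Suc k)" "N x = 1"
        "\<And>v. v \<in> W e (Suc k) \<Longrightarrow> N (A *v v) \<le> N (A *v x) * N v"
      using ex_N_maximizer[OF W] by blast
    \<comment> \<open>The constraint set for index \<open>i\<close> refers only to vectors of
      smaller index, so appending a vector leaves the earlier conditions intact.\<close>
    have same: "W (e(Suc k := x)) i = W e i" if "i \<le> Suc k" for i
      unfolding W_def using that by auto
    have "P (e(Suc k := x)) i" if "i \<in> {1..Suc k}" for i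
    proof (cases "i = Suc k")
      case True
      then show ?thesis unfolding P_def using same[of i] x by simp
    next
      case False
      then have "P e i" using e that by auto
      then show ?thesis unfolding P_def using same[of i] False that by simp
    qed
    then show ?case by blast
  qed simp
  then obtain e where P: "\<And>i. i \<in> {1..CARD('n)} \<Longrightarrow> P e i" by blast
  have anti: "W e j \<subseteq> W e i" if "i \<le> j" for i j using that unfolding W_def by auto
  have orth: "ip (e j) (e i) = 0" if "i \<in> {1..CARD('n)}" "j \<in> {1..CARD('n)}" "i < j" for i j
  proof -
    have "e j \<in> W e j" using P[OF that(2)] by (simp add: P_def)
    moreover have "i \<in> {1..<j}" using that by simp
    ultimately show ?thesis unfolding W_def by blast
  qed
  have Aorth: "ip (A *v e i) (A *v e j) = 0"
    if "i \<in> {1..CARD('n)}" "j \<in> {1..CARD('n)}" "i < j" for i j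
  proof (rule N_maximizer_orth[OF W[of e i]])
    show "e j \<in> W e i" using P[OF that(2)] anti[of i j] that by (auto simp: P_def)
  qed (use P[OF that(1)] orth that in \<open>auto simp: P_def\<close>)
  define s where "s i = N (A *v e i)" for i
  define f where "f i = of_real (1 / s i) *s (A *v e i)" for i
  have inj: "v = 0" if "A *v v = 0" for v
    using A that by (metis invertible_def matrix_vector_mul_assoc matrix_vector_mul_lid matrix_vector_mult_0_right)
  have s: "s i > 0" if "i \<in> {1..CARD('n)}" for i
  proof -
    have "e i \<noteq> 0" using P[OF that] by (auto simp: P_def)
    then show ?thesis unfolding s_def using inj N_pos by blast
  qed
  have Af: "A *v e i = of_real (s i) *s f i" if "i \<in> {1..CARD('n)}" for i
    using s[OF that] by (simp add: f_def vec.scale_scale)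
  have onb_e: "orthonormal_basis ip e"
    unfolding orthonormal_basis_def
  proof (intro ballI)
    fix i j assume i: "i \<in> {1..CARD('n)}" and j: "j \<in> {1..CARD('n)}"
    have "ip (e i) (e i) = 1" using P[OF i] by (simp add: P_def ip_self)
    then show "ip (e i) (e j) = (if i = j then 1 else 0)"
      using orth[OF i j] orth[OF j i] ip_eq_0_commute[of "e i" "e j"] by (cases i j rule: linorder_cases) auto
  qed
  have onb_f: "orthonormal_basis ip f"
    unfolding orthonormal_basis_def
  proof (intro ballI)
    fix i j assume i: "i \<in> {1..CARD('n)}" and j: "j \<in> {1..CARD('n)}"
    have "N (f i) = 1" using s[OF i] by (simp add: f_def N_scale norm_divide s_def[symmetric])
    then have "ip (f i) (f i) = 1" by (simp add: ip_self)
    moreover have "ip (f i) (f j) = 0" if "i \<noteq> j"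
      using Aorth[OF i j] Aorth[OF j i] that ip_eq_0_commute[of "A *v e i" "A *v e j"]
      by (cases i j rule: linorder_cases) (auto simp: f_def ip_scale_left ip_scale_right)
    ultimately show "ip (f i) (f j) = (if i = j then 1 else 0)" by auto
  qed
  have "s j \<le> s i" if "i \<in> {1..CARD('n)}" "j \<in> {1..CARD('n)}" "i \<le> j" for i j
  proof -
    have "e j \<in> W e i" using P[OF that(2)] anti[OF that(3)] by (auto simp: P_def)
    then have "N (A *v e j) \<le> N (A *v e i) * N (e j)" using P[OF that(1)] by (auto simp: P_def)
    then show ?thesis using P[OF that(2)] by (simp add: P_def s_def)
  qed
  then have "singular_value_decomposition ip A s e f"
    unfolding singular_value_decomposition_def using onb_e onb_f Af s by (auto intro: less_imp_le)
  then show ?thesis by blast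
qed

subsection \<open>The span of the longest axes\<close>

context
  fixes A :: "'k ^ 'n ^ 'n"
  assumes A: "invertible A"
begin

text \<open>Whatever space the choice operator picks, it comes from some decomposition. The
  estimates below hold for every such choice and thus need no gap in order to be stated.\<close>

lemma longest_axes_span_svd:
  obtains s e f where "singular_value_decomposition ip A s e f" "longest_axes_span ip k A = vec.span (f ` {1..k})"
proof -
  have "\<exists>V s e f. singular_value_decomposition ip A s e f \<and> V = vec.span (f ` {1..k})"
    using ex_svd[OF A] by blast
  then have "\<exists>s e f. singular_value_decomposition ip A s e f \<and> longest_axes_span ip k A = vec.span (f ` {1..k})"
    unfolding longest_axes_span_def by (rule someI_ex)
  then show ?thesis using that by blast
qed

lemma longest_axes_span_grassmannian:
  assumes "k \<le> CARD('n)"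
  shows "longest_axes_span ip k A \<in> grassmannian k"
proof -
  obtain s e f where svd: "singular_value_decomposition ip A s e f" "longest_axes_span ip k A = vec.span (f ` {1..k})"
    using longest_axes_span_svd by blast
  have "vec.dim (vec.span (f ` {1..k})) = k"
    using onb_dim[OF svd_onb(2)[OF svd(1)], of "{1..k}"] assms by simp
  then show ?thesis unfolding grassmannian_def svd(2) by simp
qed

lemma svd_pos:
  assumes svd: "singular_value_decomposition ip A s e f" and i: "i \<in> {1..CARD('n)}"
  shows "0 < s i"
proof (rule ccontr)
  assume "\<not> 0 < s i"
  then have "s i = 0" using svd_nonneg[OF svd i] by simp
  then have "A *v e i = 0" using svd_image[OF svd i] by simp
  then have "e i = 0"
    using A by (metis invertible_def matrix_vector_mul_assoc matrix_vector_mul_lid matrix_vector_mult_0_right)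
  then show False using onb_N[OF svd_onb(1)[OF svd] i] by simp
qed

lemma singular_value_pos:
  assumes "k \<in> {1..CARD('n)}"
  shows "0 < singular_value ip k A"
  using ex_svd[OF A] singular_value_eq[OF _ assms] svd_pos[OF _ assms] by metis

lemma singular_value_minmax:
  assumes "k \<in> {1..CARD('n)}" "vec.subspace W" "k \<le> vec.dim W" "\<And>v. v \<in> W \<Longrightarrow> t * N v \<le> N (A *v v)"
  shows "t \<le> singular_value ip k A"
  using ex_svd[OF A] singular_value_eq[OF _ assms(1)] svd_minmax[OF _ assms] by metis

lemma singular_value_attained:
  assumes "k \<in> {1..CARD('n)}"
  obtains W where "W \<in> grassmannian k" "\<And>v. v \<in> W \<Longrightarrow> singular_value ip k A * N v \<le> N (A *v v)"
proof -
  obtain s e f where svd: "singular_value_decomposition ip A s e f" using ex_svd[OF A] by blast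
  have "{1..k} \<subseteq> {1..CARD('n)}" using assms by auto
  then have "vec.span (e ` {1..k}) \<in> grassmannian k"
    unfolding grassmannian_def using onb_dim[OF svd_onb(1)[OF svd], of "{1..k}"] by simp
  then show ?thesis
    using that svd_lower[OF svd assms] unfolding singular_value_eq[OF svd assms] by blast
qed

text \<open>Truncate the expansion of \<open>A *v v\<close> after the first \<open>k\<close> axes;
  each discarded term has a factor at most \<open>s (k + 1)\<close>.\<close>

lemma longest_axes_span_attracts:
  assumes "k + 1 \<le> CARD('n)"
  shows "\<exists>w\<in>longest_axes_span ip k A. N (A *v v - w) \<le> singular_value ip (k + 1) A * N v"
proof -
  obtain s e f where svd: "singular_value_decomposition ip A s e f" "longest_axes_span ip k A = vec.span (f ` {1..k})"
    using longest_axes_span_svd by blast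
  note svd1 = svd(1)
  have k1: "k + 1 \<in> {1..CARD('n)}" using assms by simp
  let ?c = "\<lambda>i. ip v (e i) * of_real (s i)"
  define w where "w = (\<Sum>i\<in>{1..k}. ?c i *s f i)"
  have w: "w \<in> longest_axes_span ip k A" unfolding svd(2) w_def
    by (intro vec.span_sum vec.span_scale) (auto intro: vec.span_base)
  have "v \<in> vec.span (e ` {1..CARD('n)})" using onb_span[OF svd_onb(1)[OF svd1]] by simp
  note v = order_refl this
  have un: "{1..CARD('n)} = {1..k} \<union> {k+1..CARD('n)}" using assms by auto
  have "A *v v = w + (\<Sum>i\<in>{k+1..CARD('n)}. ?c i *s f i)"
    unfolding svd_apply[OF svd1 v] w_def un by (rule sum.union_disjoint) auto
  then have "(N (A *v v - w))\<^sup>2 = (N (\<Sum>i\<in>{k+1..CARD('n)}. ?c i *s f i))\<^sup>2" by simp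
  also have "\<dots> = (\<Sum>i\<in>{k+1..CARD('n)}. (norm (ip v (e i)))\<^sup>2 * (s i)\<^sup>2)"
    by (subst onb_N_sum[OF svd_onb(2)[OF svd1]]) (auto simp: norm_mult power_mult_distrib)
  also have "\<dots> \<le> (\<Sum>i\<in>{k+1..CARD('n)}. (norm (ip v (e i)))\<^sup>2 * (s (k + 1))\<^sup>2)"
    using svd_nonneg[OF svd1] svd_mono[OF svd1 k1] by (intro sum_mono mult_left_mono power_mono) auto
  also have "\<dots> \<le> (\<Sum>i\<in>{1..CARD('n)}. (norm (ip v (e i)))\<^sup>2 * (s (k + 1))\<^sup>2)"
    by (rule sum_mono2) auto
  also have "\<dots> = (s (k + 1) * N v)\<^sup>2"
    unfolding power_mult_distrib svd_N[OF svd1 v] by (simp add: sum_distrib_left mult.commute)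
  finally have "N (A *v v - w) \<le> s (k + 1) * N v"
    by (rule power2_le_imp_le) (use svd_nonneg[OF svd1 k1] in simp)
  then show ?thesis using w singular_value_eq[OF svd1 k1] by metis
qed

text \<open>All singular values being positive, \<open>A *v u\<close> can lie in the span of
  \<open>f 1\<close>, ..., \<open>f k\<close> only if \<open>u\<close> lies in that of
  \<open>e 1\<close>, ..., \<open>e k\<close>, where \<open>svd_lower\<close> applies. This is the
  counterpart of \<open>longest_axes_span_attracts\<close>; dividing the two produces the singular
  value gap.\<close>

lemma longest_axes_span_expands:
  assumes k: "k \<in> {1..CARD('n)}" and u: "A *v u \<in> longest_axes_span ip k A"
  shows "singular_value ip k A * N u \<le> N (A *v u)"
proof -
  obtain s e f where svd: "singular_value_decomposition ip A s e f" "longest_axes_span ip k A = vec.span (f ` {1..k})"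
    using longest_axes_span_svd by blast
  note svd1 = svd(1)
  have sub: "{1..k} \<subseteq> {1..CARD('n)}" using k by auto
  have "u \<in> vec.span (e ` {1..CARD('n)})" using onb_span[OF svd_onb(1)[OF svd1]] by simp
  note v = order_refl this
  have 0: "ip u (e j) = 0" if j: "j \<in> {1..CARD('n)} - {1..k}" for j
  proof -
    have "ip (A *v u) (f j) = ip u (e j) * of_real (s j)"
      unfolding svd_apply[OF svd1 v] by (subst onb_coeff[OF svd_onb(2)[OF svd1]]) (use j in auto)
    moreover have "ip (A *v u) (f j) = 0"
      by (rule onb_span_coeff_0[OF svd_onb(2)[OF svd1] sub]) (use u svd(2) j in auto)
    ultimately show ?thesis using svd_pos[OF svd1, of j] j by auto
  qed
  have "u = (\<Sum>i\<in>{1..CARD('n)}. ip u (e i) *s e i)" by (rule onb_expand[OF svd_onb(1)[OF svd1] v])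
  also have "\<dots> = (\<Sum>i\<in>{1..k}. ip u (e i) *s e i)"
    using 0 sub by (intro sum.mono_neutral_right) auto
  also have "\<dots> \<in> vec.span (e ` {1..k})"
    by (intro vec.span_sum vec.span_scale) (auto intro: vec.span_base)
  finally have "u \<in> vec.span (e ` {1..k})" .
  from svd_lower[OF svd1 k this] show ?thesis unfolding singular_value_eq[OF svd1 k] .
qed

end

text \<open>Inversion exchanges the two bases and inverts the lengths, hence reverses their order;
  \<open>r\<close> is the order-reversing involution of the indices.\<close>

lemma singular_value_inverse:
  assumes A: "invertible A" and inv: "B ** A = mat 1" and i: "i \<in> {1..CARD('n)}"
  shows "singular_value ip (CARD('n) + 1 - i) B = 1 / singular_value ip i A"
proof -
  obtain s e f where svd: "singular_value_decomposition ip A s e f" using ex_svd[OF A] by blast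
  define r where "r j = CARD('n) + 1 - j" for j :: nat
  have r: "r j \<in> {1..CARD('n)}" "r (r j) = j" if "j \<in> {1..CARD('n)}" for j
    using that by (auto simp: r_def)
  have rinj: "r i = r j \<longleftrightarrow> i = j" if "i \<in> {1..CARD('n)}" "j \<in> {1..CARD('n)}" for i j
    using r that by metis
  have rmono: "r j \<le> r i" if "i \<le> j" for i j using that by (auto simp: r_def)
  have B: "B *v f j = of_real (1 / s j) *s e j" if j: "j \<in> {1..CARD('n)}" for j
  proof -
    have "B *v (A *v e j) = e j" using inv by (simp add: matrix_vector_mul_assoc)
    then have "of_real (s j) *s (B *v f j) = e j" using svd_image[OF svd j] by (simp add: vec.scale)
    then have "of_real (1 / s j) *s e j = (of_real (1 / s j) * of_real (s j)) *s (B *v f j)"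
      by (metis vec.scale_scale)
    then show ?thesis using svd_pos[OF A svd j] by simp
  qed
  have "singular_value_decomposition ip B (\<lambda>j. 1 / s (r j)) (\<lambda>j. f (r j)) (\<lambda>j. e (r j))"
    unfolding singular_value_decomposition_def
  proof (intro conjI ballI impI)
    show "orthonormal_basis ip (\<lambda>j. f (r j))" "orthonormal_basis ip (\<lambda>j. e (r j))"
      unfolding orthonormal_basis_def
      using onb_ip[OF svd_onb(2)[OF svd]] onb_ip[OF svd_onb(1)[OF svd]] r rinj by auto
  next
    fix i assume "i \<in> {1..CARD('n)}"
    then show "0 \<le> 1 / s (r i)" using svd_nonneg[OF svd r(1)] by simp
  next
    fix i assume "i \<in> {1..CARD('n)}"
    then show "B *v f (r i) = of_real (1 / s (r i)) *s e (r i)" using B r by blast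
  next
    fix i j assume ij: "i \<in> {1..CARD('n)}" "j \<in> {1..CARD('n)}" "i \<le> j"
    have "s (r i) \<le> s (r j)" using svd_mono[OF svd r(1)[OF ij(2)] r(1)[OF ij(1)] rmono[OF ij(3)]] .
    then show "1 / s (r j) \<le> 1 / s (r i)"
      using svd_pos[OF A svd r(1)[OF ij(1)]] by (intro divide_left_mono) auto
  qed
  from singular_value_eq[OF this r(1)[OF i]] have "singular_value ip (r i) B = 1 / s i"
    using r(2)[OF i] by simp
  then show ?thesis using singular_value_eq[OF svd i] by (simp add: r_def)
qed

subsection \<open>Perturbation of the longest axes\<close>

text \<open>The factor \<open>a\<close> makes the notion invariant under scaling, hence well defined on \<open>PGL\<close>.\<close>

definition conditioned :: "real \<Rightarrow> 'k ^ 'n ^ 'n \<Rightarrow> bool" where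
  "conditioned K M \<longleftrightarrow> 0 < K \<and> (\<exists>a>0. \<forall>v. N (M *v v) \<le> a * N v \<and> a * N v \<le> K * N (M *v v))"

lemma conditioned_scalar:
  assumes "conditioned K M" "c \<noteq> 0"
  shows "conditioned K (mat c ** M)"
proof -
  obtain a where a: "a > 0" "\<And>v. N (M *v v) \<le> a * N v \<and> a * N v \<le> K * N (M *v v)"
    using assms(1) unfolding conditioned_def by blast
  have "(mat c ** M) *v v = c *s (M *v v)" for v
    by (simp add: matrix_vector_mul_assoc[symmetric]) 
      (simp add: matrix_vector_mult_def mat_def vec_eq_iff if_distrib if_distribR cong: if_cong)
  then have "N ((mat c ** M) *v v) \<le> (norm c * a) * N v \<and>
      (norm c * a) * N v \<le> K * N ((mat c ** M) *v v)" for v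
    using a(2)[of v] assms(2) by (auto simp: N_scale mult.assoc mult.left_commute[of K])
  moreover have "norm c * a > 0" using a assms(2) by simp
  ultimately show ?thesis using assms(1) unfolding conditioned_def by blast
qed

lemma conditioned_mono: "conditioned K M \<Longrightarrow> K \<le> K' \<Longrightarrow> conditioned K' M"
  unfolding conditioned_def by (meson N_nonneg less_le_trans mult_right_mono order_trans)

lemma ex_conditioned:
  assumes "invertible M"
  shows "\<exists>K. conditioned K M"
proof -
  obtain B where B: "B ** M = mat 1" using assms unfolding invertible_def by blast
  obtain a where a: "0 < a" "\<And>v. N (M *v v) \<le> a * N v" using matrix_N_bounded by blast
  obtain b where b: "0 < b" "\<And>v. N (B *v v) \<le> b * N v" using matrix_N_bounded by blast
  have "a * N v \<le> (a * b) * N (M *v v)" for v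
  proof -
    have "B *v (M *v v) = v" using B by (simp add: matrix_vector_mul_assoc)
    then show ?thesis using b(2)[of "M *v v"] a(1) by (simp add: mult.assoc)
  qed
  then have "conditioned (a * b) M" unfolding conditioned_def using a b by auto
  then show ?thesis ..
qed

text \<open>The difference \<open>v - w\<close> is stretched by at most \<open>a\<close> and
  \<open>v\<close> by at least \<open>a / K\<close>, so the common scale \<open>a\<close>
  cancels.\<close>

lemma near_image:
  assumes "conditioned K M" "near \<epsilon> P Q" "0 \<le> \<epsilon>"
  shows "near (K * \<epsilon>) ((*v) M ` P) ((*v) M ` Q)"
proof (rule nearI)
  fix x assume "x \<in> (*v) M ` P"
  then obtain v where v: "v \<in> P" "x = M *v v" by blast
  obtain w where w: "w \<in> Q" "N (v - w) \<le> \<epsilon> * N v" using assms(2) v(1) unfolding near_def by blast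
  obtain a where a: "a > 0" "\<And>v. N (M *v v) \<le> a * N v" "\<And>v. a * N v \<le> K * N (M *v v)"
    using assms(1) unfolding conditioned_def by blast
  have "N (x - M *v w) = N (M *v (v - w))" by (simp add: v(2) vec.diff)
  also have "\<dots> \<le> a * N (v - w)" by (rule a)
  also have "\<dots> \<le> a * (\<epsilon> * N v)" using a(1) w(2) by simp
  also have "\<dots> = \<epsilon> * (a * N v)" by simp
  also have "\<dots> \<le> \<epsilon> * (K * N x)" unfolding v(2) by (rule mult_left_mono[OF a(3) assms(3)])
  finally show "\<exists>w\<in>(*v) M ` Q. N (x - w) \<le> K * \<epsilon> * N x" using w(1) by (auto simp: mult_ac)
qed

lemma matrix_image_grassmannian:
  fixes M :: "'k ^ 'n ^ 'n"
  assumes "invertible M" "V \<in> grassmannian k"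
  shows "(*v) M ` V \<in> grassmannian k"
proof -
  have "v = 0" if "M *v v = 0" for v
    using assms(1) that
    by (metis invertible_def matrix_vector_mul_assoc matrix_vector_mul_lid matrix_vector_mult_0_right)
  then have "vec.dim ((*v) M ` V) = vec.dim V"
    using dim_image_trivial_kernel[OF grassmannian_subspace[OF assms(2)] matrix_vector_mul_linear_gen] by blast
  moreover have "vec.subspace ((*v) M ` V)"
    by (rule vec.linear_subspace_image[OF matrix_vector_mul_linear_gen grassmannian_subspace[OF assms(2)]])
  ultimately show ?thesis using assms(2) unfolding grassmannian_def by simp
qed

text \<open>The test subspace for the product is the preimage under \<open>M\<close> of one that is
  optimal for \<open>A\<close>.\<close>

lemma singular_value_mult_right_ge:
  assumes A: "invertible A" and M: "invertible M" and k: "k \<in> {1..CARD('n)}"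
    and a: "0 < a" "\<And>v. a * N v \<le> K * N (M *v v)" and K: "0 < K"
  shows "a / K * singular_value ip k A \<le> singular_value ip k (A ** M)"
proof -
  obtain W where W: "W \<in> grassmannian k" "\<And>v. v \<in> W \<Longrightarrow> singular_value ip k A * N v \<le> N (A *v v)"
    using singular_value_attained[OF A k] by blast
  obtain B where B: "B ** M = mat 1" "M ** B = mat 1" using M unfolding invertible_def by blast
  have Binv: "invertible B" using B unfolding invertible_def by blast
  note BW = matrix_image_grassmannian[OF Binv W(1)]
  show ?thesis
  proof (rule singular_value_minmax[OF invertible_mult[OF A M] k grassmannian_subspace[OF BW]])
    show "k \<le> vec.dim ((*v) B ` W)" using BW by (simp add: grassmannian_def)
    fix v assume "v \<in> (*v) B ` W"
    then obtain w where w: "w \<in> W" "v = B *v w" by blast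
    then have Mv: "M *v v = w" using B by (simp add: matrix_vector_mul_assoc)
    have "a / K * singular_value ip k A * N v = singular_value ip k A * (a * N v) / K" by simp
    also have "\<dots> \<le> singular_value ip k A * (K * N (M *v v)) / K"
      using singular_value_pos[OF A k] K by (intro divide_right_mono mult_left_mono a) auto
    also have "\<dots> \<le> N (A *v w)" using W(2)[OF w(1)] K unfolding Mv by simp
    also have "A *v w = (A ** M) *v v" unfolding Mv[symmetric] by (simp add: matrix_vector_mul_assoc)
    finally show "a / K * singular_value ip k A * N v \<le> N ((A ** M) *v v)" .
  qed
qed

text \<open>Here the subspace that is optimal for \<open>A\<close> serves unchanged.\<close>

lemma singular_value_mult_left_ge:
  assumes A: "invertible A" and M: "invertible M" and k: "k \<in> {1..CARD('n)}"
    and a: "0 < a" "\<And>v. a * N v \<le> K * N (M *v v)" and K: "0 < K"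
  shows "a / K * singular_value ip k A \<le> singular_value ip k (M ** A)"
proof -
  obtain W where W: "W \<in> grassmannian k" "\<And>v. v \<in> W \<Longrightarrow> singular_value ip k A * N v \<le> N (A *v v)"
    using singular_value_attained[OF A k] by blast
  show ?thesis
  proof (rule singular_value_minmax[OF invertible_mult[OF M A] k grassmannian_subspace[OF W(1)]])
    show "k \<le> vec.dim W" using W(1) by (simp add: grassmannian_def)
    fix v assume v: "v \<in> W"
    have "a / K * singular_value ip k A * N v = a / K * (singular_value ip k A * N v)" by simp
    also have "\<dots> \<le> a / K * N (A *v v)" using a(1) K W(2)[OF v] by (intro mult_left_mono) auto
    also have "\<dots> \<le> N (M *v (A *v v))" using a(2)[of "A *v v"] K by (simp add: field_simps)
    finally show "a / K * singular_value ip k A * N v \<le> N ((M ** A) *v v)"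
      by (simp add: matrix_vector_mul_assoc)
  qed
qed

lemma invertible_surj:
  assumes "invertible (A :: 'k ^ 'n ^ 'n)"
  obtains u where "w = A *v u"
  using assms by (metis invertible_def matrix_vector_mul_assoc matrix_vector_mul_lid)

text \<open>The arithmetic shared by the next two estimates: \<open>s\<close> and \<open>t\<close>
  stand for the k-th and (k+1)-st singular values of \<open>A\<close>, and \<open>\<sigma>'\<close>
  for the k-th one of the product with \<open>M\<close>. The scale \<open>a\<close> disappears and
  the gap \<open>t / s\<close> remains.\<close>

lemma ratio_bound:
  assumes u: "\<sigma>' * N u \<le> N w" and a: "0 < a" "0 < K" "a / K * s \<le> \<sigma>'" and s: "0 < s" "0 \<le> t"
  shows "t * (a * N u) \<le> K * (t / s) * N w"
proof -
  have "a / K * s * N u \<le> \<sigma>' * N u" using a(3) by (rule mult_right_mono) simp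
  then have "a / K * s * N u \<le> N w" using u by linarith
  then have "(t * K / s) * (a / K * s * N u) \<le> (t * K / s) * N w"
    using s a by (intro mult_left_mono) auto
  then show ?thesis using s a by (simp add: field_simps)
qed

text \<open>Write \<open>w = A *v (M *v u)\<close>. Attraction puts it within the (k+1)-st singular
  value of \<open>A\<close> times \<open>N (M *v u)\<close> of the axes of \<open>A\<close>, while
  expansion by \<open>A ** M\<close> bounds \<open>N u\<close> in terms of
  \<open>N w\<close>.\<close>

lemma longest_axes_span_mult_right:
  assumes A: "invertible A" and M: "invertible M" "conditioned K M"
    and k: "1 \<le> k" "k + 1 \<le> CARD('n)"
  shows "near (K * (singular_value ip (k + 1) A / singular_value ip k A))
    (longest_axes_span ip k (A ** M)) (longest_axes_span ip k A)"
proof (rule nearI)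
  fix w assume w: "w \<in> longest_axes_span ip k (A ** M)"
  have kk: "k \<in> {1..CARD('n)}" "k + 1 \<in> {1..CARD('n)}" using k by auto
  note AM = invertible_mult[OF A M(1)]
  obtain u where u: "w = (A ** M) *v u" using invertible_surj[OF AM] by blast
  obtain a where a: "0 < K" "a > 0" "\<And>v. N (M *v v) \<le> a * N v" "\<And>v. a * N v \<le> K * N (M *v v)"
    using M(2) unfolding conditioned_def by blast
  have 1: "singular_value ip k (A ** M) * N u \<le> N w"
    using longest_axes_span_expands[OF AM kk(1)] w u by simp
  obtain w' where w': "w' \<in> longest_axes_span ip k A"
      "N (A *v (M *v u) - w') \<le> singular_value ip (k + 1) A * N (M *v u)"
    using longest_axes_span_attracts[OF A k(2)] by blast
  have "N (w - w') \<le> singular_value ip (k + 1) A * N (M *v u)"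
    using w'(2) unfolding u by (simp add: matrix_vector_mul_assoc)
  also have "\<dots> \<le> singular_value ip (k + 1) A * (a * N u)"
    using singular_value_pos[OF A kk(2)] by (intro mult_left_mono a) simp
  also have "\<dots> \<le> K * (singular_value ip (k + 1) A / singular_value ip k A) * N w"
    by (rule ratio_bound[OF 1 a(2,1) singular_value_mult_right_ge[OF A M(1) kk(1) a(2,4,1)]])
      (use singular_value_pos[OF A] kk in \<open>auto intro: less_imp_le\<close>)
  finally show "\<exists>w'\<in>longest_axes_span ip k A.
      N (w - w') \<le> K * (singular_value ip (k + 1) A / singular_value ip k A) * N w" using w'(1) by blast
qed

text \<open>The same comparison, with attraction applied to \<open>A *v u\<close> before
  \<open>M\<close> carries both the vector and its approximation along.\<close>

lemma longest_axes_span_mult_left: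
  assumes A: "invertible A" and M: "invertible M" "conditioned K M"
    and k: "1 \<le> k" "k + 1 \<le> CARD('n)"
  shows "near (K * (singular_value ip (k + 1) A / singular_value ip k A))
    (longest_axes_span ip k (M ** A)) ((*v) M ` longest_axes_span ip k A)"
proof (rule nearI)
  fix w assume w: "w \<in> longest_axes_span ip k (M ** A)"
  have kk: "k \<in> {1..CARD('n)}" "k + 1 \<in> {1..CARD('n)}" using k by auto
  note MA = invertible_mult[OF M(1) A]
  obtain u where u: "w = (M ** A) *v u" using invertible_surj[OF MA] by blast
  obtain a where a: "0 < K" "a > 0" "\<And>v. N (M *v v) \<le> a * N v" "\<And>v. a * N v \<le> K * N (M *v v)"
    using M(2) unfolding conditioned_def by blast
  have 1: "singular_value ip k (M ** A) * N u \<le> N w"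
    using longest_axes_span_expands[OF MA kk(1)] w u by simp
  obtain w' where w': "w' \<in> longest_axes_span ip k A"
      "N (A *v u - w') \<le> singular_value ip (k + 1) A * N u"
    using longest_axes_span_attracts[OF A k(2)] by blast
  have "N (w - M *v w') = N (M *v (A *v u - w'))"
    unfolding u by (simp add: matrix_vector_mul_assoc vec.diff)
  also have "\<dots> \<le> a * N (A *v u - w')" by (rule a)
  also have "\<dots> \<le> a * (singular_value ip (k + 1) A * N u)" using w'(2) a(2) by simp
  also have "\<dots> = singular_value ip (k + 1) A * (a * N u)" by simp
  also have "\<dots> \<le> K * (singular_value ip (k + 1) A / singular_value ip k A) * N w"
    by (rule ratio_bound[OF 1 a(2,1) singular_value_mult_left_ge[OF A M(1) kk(1) a(2,4,1)]])
      (use singular_value_pos[OF A] kk in \<open>auto intro: less_imp_le\<close>)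
  finally show "\<exists>w'\<in>(*v) M ` longest_axes_span ip k A.
      N (w - w') \<le> K * (singular_value ip (k + 1) A / singular_value ip k A) * N w" using w'(1) by blast
qed

subsection \<open>Limits in the Grassmannian\<close>

definition gr_limit :: "(nat \<Rightarrow> ('k ^ 'n) set) \<Rightarrow> ('k ^ 'n) set \<Rightarrow> bool" where
  "gr_limit U V \<longleftrightarrow> (\<forall>\<epsilon>>0. \<exists>M. \<forall>n\<ge>M. near \<epsilon> (U n) V)"

lemma gr_limitD: "gr_limit U V \<Longrightarrow> 0 < \<epsilon> \<Longrightarrow> \<exists>M. \<forall>n\<ge>M. near \<epsilon> (U n) V"
  unfolding gr_limit_def by blast

lemma gr_limit_iff_subspace_dist:
  assumes "1 \<le> k" "\<And>n. U n \<in> grassmannian k" "V \<in> grassmannian k"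
  shows "gr_limit U V \<longleftrightarrow> (\<lambda>n. subspace_dist ip (U n) V) \<longlonglongrightarrow> 0"
proof -
  have iff: "subspace_dist ip (U n) V \<le> \<epsilon> \<longleftrightarrow> near \<epsilon> (U n) V" for n \<epsilon>
    using assms by (intro subspace_dist_le_iff grassmannian_subspace grassmannian_nonzero)
  have pos: "0 \<le> subspace_dist ip (U n) V" for n
    using assms by (intro subspace_dist_nonneg grassmannian_subspace grassmannian_nonzero)
  show ?thesis
  proof
    assume "gr_limit U V"
    show "(\<lambda>n. subspace_dist ip (U n) V) \<longlonglongrightarrow> 0"
    proof (rule LIMSEQ_I)
      fix \<epsilon> :: real assume "0 < \<epsilon>"
      then obtain M where "\<forall>n\<ge>M. near (\<epsilon> / 2) (U n) V" using gr_limitD[OF \<open>gr_limit U V\<close>] half_gt_zero by blast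
      then have "subspace_dist ip (U n) V \<le> \<epsilon> / 2" if "n \<ge> M" for n using iff that by blast
      then have "\<forall>n\<ge>M. norm (subspace_dist ip (U n) V - 0) < \<epsilon>"
        using pos \<open>0 < \<epsilon>\<close> by (fastforce intro: le_less_trans[of _ "\<epsilon> / 2"])
      then show "\<exists>M. \<forall>n\<ge>M. norm (subspace_dist ip (U n) V - 0) < \<epsilon>" ..
    qed
  next
    assume lim: "(\<lambda>n. subspace_dist ip (U n) V) \<longlonglongrightarrow> 0"
    show "gr_limit U V" unfolding gr_limit_def
    proof (intro allI impI)
      fix \<epsilon> :: real assume "0 < \<epsilon>"
      then obtain M where "\<forall>n\<ge>M. norm (subspace_dist ip (U n) V - 0) < \<epsilon>"
        using LIMSEQ_D[OF lim] by blast
      then have "\<forall>n\<ge>M. near \<epsilon> (U n) V" using iff by fastforce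
      then show "\<exists>M. \<forall>n\<ge>M. near \<epsilon> (U n) V" ..
    qed
  qed
qed

lemma near_sym_gr:
  assumes "near \<epsilon> P Q" "P \<in> grassmannian k" "Q \<in> grassmannian k" "0 \<le> \<epsilon>"
  shows "near \<epsilon> Q P"
  using assms by (intro near_sym[OF assms(1)]) (auto simp: grassmannian_def)

lemma gr_limit_unique:
  assumes U: "\<And>n. U n \<in> grassmannian k" and V: "V \<in> grassmannian k" "V' \<in> grassmannian k"
    and lim: "gr_limit U V" "gr_limit U V'"
  shows "V = V'"
proof -
  have "V \<subseteq> V'"
  proof (rule near_0_imp_subset[OF grassmannian_subspace[OF V(2)]])
    fix \<epsilon> :: real assume \<epsilon>: "0 < \<epsilon>"
    obtain M M' where M: "\<forall>n\<ge>M. near (\<epsilon> / 2) (U n) V" "\<forall>n\<ge>M'. near (\<epsilon> / 2) (U n) V'"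
      using gr_limitD[OF lim(1)] gr_limitD[OF lim(2)] \<epsilon> half_gt_zero by meson
    define n where "n = max M M'"
    have "near (\<epsilon> / 2) V (U n)" using M(1) near_sym_gr[OF _ U V(1)] \<epsilon> by (simp add: n_def)
    moreover have "near (\<epsilon> / 2) (U n) V'" using M(2) by (simp add: n_def)
    ultimately show "near \<epsilon> V V'" using near_trans[OF _ _ grassmannian_subspace[OF U]] \<epsilon> by fastforce
  qed
  then show ?thesis
    using vec.subspace_dim_equal[of V V'] V unfolding grassmannian_def by simp
qed

text \<open>The limit consists of the vectors whose distance to \<open>U n\<close> tends to 0.
  Closeness of \<open>V\<close> to \<open>U n\<close> follows by passing to the limit; the converse
  must produce vectors of \<open>V\<close> and uses compactness. Closeness both ways with a constant
  below 1 fixes the dimension.\<close>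

lemma gr_complete:
  assumes U: "\<And>n. U n \<in> grassmannian k"
    and Cauchy: "\<And>\<epsilon>. 0 < \<epsilon> \<Longrightarrow> \<exists>M. \<forall>m\<ge>M. \<forall>n\<ge>M. near \<epsilon> (U m) (U n)"
  obtains V where "V \<in> grassmannian k" "gr_limit U V"
proof -
  note sub = grassmannian_subspace[OF U]
  define V where "V = {v. (\<lambda>n. N (v - proj (U n) v)) \<longlonglongrightarrow> 0}"
  have subV: "vec.subspace V"
    unfolding vec.subspace_def
  proof (intro conjI ballI allI)
    have "N (proj (U n) 0) = 0" for n using N_proj_le[OF sub, of n 0] N_nonneg[of "proj (U n) 0"] by simp
    then show "0 \<in> V" unfolding V_def by simp
  next
    fix u v assume "u \<in> V" "v \<in> V"
    then have "(\<lambda>n. N (u - proj (U n) u) + N (v - proj (U n) v)) \<longlonglongrightarrow> 0"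
      unfolding V_def using tendsto_add_zero by blast
    moreover have "N (u + v - proj (U n) (u + v)) \<le> N (u - proj (U n) u) + N (v - proj (U n) v)" for n
    proof -
      have "N (u + v - proj (U n) (u + v)) \<le> N (u + v - (proj (U n) u + proj (U n) v))"
        by (intro proj_closest vec.subspace_add proj_in sub)
      also have "\<dots> \<le> N (u - proj (U n) u) + N (v - proj (U n) v)"
        using N_triangle[of "u - proj (U n) u" "v - proj (U n) v"] by (simp add: algebra_simps)
      finally show ?thesis .
    qed
    ultimately have "(\<lambda>n. N (u + v - proj (U n) (u + v))) \<longlonglongrightarrow> 0"
      using Lim_null_comparison[OF always_eventually] by (metis (no_types, lifting) real_norm_def abs_of_nonneg N_nonneg)
    then show "u + v \<in> V" unfolding V_def by simp
  next
    fix c :: 'k and v assume "v \<in> V"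
    then have "(\<lambda>n. norm c * N (v - proj (U n) v)) \<longlonglongrightarrow> 0"
      unfolding V_def by (intro tendsto_mult_right_zero) simp
    moreover have "N (c *s v - proj (U n) (c *s v)) \<le> norm c * N (v - proj (U n) v)" for n
    proof -
      have "N (c *s v - proj (U n) (c *s v)) \<le> N (c *s v - c *s proj (U n) v)"
        by (intro proj_closest vec.subspace_scale proj_in sub)
      also have "\<dots> = norm c * N (v - proj (U n) v)"
        unfolding vec.scale_right_diff_distrib[symmetric] N_scale ..
      finally show ?thesis .
    qed
    ultimately have "(\<lambda>n. N (c *s v - proj (U n) (c *s v))) \<longlonglongrightarrow> 0"
      using Lim_null_comparison[OF always_eventually] by (metis (no_types, lifting) real_norm_def abs_of_nonneg N_nonneg)
    then show "c *s v \<in> V" unfolding V_def by simp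
  qed
  have VU: "\<exists>M. \<forall>n\<ge>M. near \<epsilon> V (U n)" if \<epsilon>: "0 < \<epsilon>" for \<epsilon>
  proof -
    obtain M where M: "\<forall>m\<ge>M. \<forall>n\<ge>M. near \<epsilon> (U m) (U n)" using Cauchy[OF \<epsilon>] by blast
    have "near \<epsilon> V (U n)" if n: "n \<ge> M" for n
    proof (rule nearI)
      fix v assume "v \<in> V"
      then have lim: "(\<lambda>m. N (v - proj (U m) v) + \<epsilon> * N v) \<longlonglongrightarrow> 0 + \<epsilon> * N v"
        unfolding V_def by (intro tendsto_intros) simp
      \<comment> \<open>The first summand tends to 0 with \<open>m\<close>, so the bound holds in
        the limit without it.\<close>
      have "N (v - proj (U n) v) \<le> N (v - proj (U m) v) + \<epsilon> * N v" if m: "m \<ge> M" for m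
      proof -
        let ?p = "proj (U m) v"
        have "N (v - proj (U n) v) \<le> N (v - proj (U n) ?p)" by (intro proj_closest proj_in sub)
        also have "\<dots> \<le> N (v - ?p) + N (?p - proj (U n) ?p)" by (rule N_triangle_diff)
        also have "N (?p - proj (U n) ?p) \<le> \<epsilon> * N ?p"
          using M m n by (intro near_proj[of _ "U m"] sub proj_in) auto
        also have "\<dots> \<le> \<epsilon> * N v" using \<epsilon> N_proj_le[OF sub] by simp
        finally show ?thesis by simp
      qed
      then have "N (v - proj (U n) v) \<le> \<epsilon> * N v"
        using LIMSEQ_le_const[OF lim] by auto
      then show "\<exists>w\<in>U n. N (v - w) \<le> \<epsilon> * N v" using proj_in[OF sub] by blast
    qed
    then show ?thesis by blast
  qed
  have UV: "gr_limit U V"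
    unfolding gr_limit_def
  proof (intro allI impI)
    fix \<epsilon> :: real assume \<epsilon>: "0 < \<epsilon>"
    obtain M where M: "\<forall>m\<ge>M. \<forall>n\<ge>M. near \<epsilon> (U m) (U n)" using Cauchy[OF \<epsilon>] by blast
    have "near \<epsilon> (U n) V" if n: "n \<ge> M" for n
    proof (rule nearI)
      fix u assume u: "u \<in> U n"
      define p where "p m = proj (U m) u" for m
      have Np: "N (p m) \<le> N u" for m unfolding p_def by (rule N_proj_le[OF sub])
      \<comment> \<open>The projections of \<open>u\<close> to later spaces are bounded by
        \<open>N u\<close>. An accumulation point \<open>l\<close> lies in \<open>V\<close> by the
        Cauchy condition and inherits the distance bound from \<open>u\<close>.\<close>
      obtain r l where r: "strict_mono r" "(\<lambda>m. N (p (r m) - l)) \<longlonglongrightarrow> 0"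
        using N_bounded_convergent_subsequence[of p, OF Np] by blast
      have rm: "m \<le> r m" for m using strict_mono_imp_increasing[OF r(1)] .
      have "l \<in> V"
        unfolding V_def mem_Collect_eq
      proof (rule LIMSEQ_I)
        fix \<eta> :: real assume "0 < \<eta>"
        \<comment> \<open>The relative error is scaled down by the size of \<open>u\<close>; the 1
          guards against \<open>u = 0\<close>, and the 2 makes the final inequality strict.\<close>
        define \<eta>' where "\<eta>' = \<eta> / (2 * (N u + 1))"
        have \<eta>': "0 < \<eta>'" "\<eta>' * N u < \<eta>"
        proof -
          have u1: "0 < N u + 1" using N_nonneg[of u] by linarith
          then show "0 < \<eta>'" unfolding \<eta>'_def using \<open>0 < \<eta>\<close> by simp
          have "\<eta>' * N u \<le> \<eta>' * (N u + 1)" using \<open>0 < \<eta>'\<close> by simp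
          also have "\<dots> = \<eta> / 2" unfolding \<eta>'_def using u1
            by (metis nonzero_mult_divide_mult_cancel_right times_divide_eq_left less_irrefl)
          finally show "\<eta>' * N u < \<eta>" using \<open>0 < \<eta>\<close> by simp
        qed
        obtain M' where M': "\<forall>m\<ge>M'. \<forall>n\<ge>M'. near \<eta>' (U m) (U n)" using Cauchy[OF \<eta>'(1)] by blast
        have "N (l - proj (U j) l) < \<eta>" if j: "j \<ge> M'" for j
        proof -
          have lim: "(\<lambda>m. N (p (r m) - l) + \<eta>' * N u) \<longlonglongrightarrow> 0 + \<eta>' * N u"
            by (intro tendsto_intros r(2))
          have "N (l - proj (U j) l) \<le> N (p (r m) - l) + \<eta>' * N u" if m: "m \<ge> M'" for m
          proof -
            let ?q = "p (r m)"
            have q: "?q \<in> U (r m)" unfolding p_def by (rule proj_in[OF sub])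
            have "N (l - proj (U j) l) \<le> N (l - proj (U j) ?q)" by (intro proj_closest proj_in sub)
            also have "\<dots> \<le> N (l - ?q) + N (?q - proj (U j) ?q)" by (rule N_triangle_diff)
            also have "N (?q - proj (U j) ?q) \<le> \<eta>' * N ?q"
              using M' m j rm[of m] by (intro near_proj[of _ "U (r m)"] sub q) auto
            also have "\<dots> \<le> \<eta>' * N u" using \<eta>' Np by simp
            finally show ?thesis by (simp add: N_minus_commute[of l])
          qed
          then have "N (l - proj (U j) l) \<le> \<eta>' * N u" using LIMSEQ_le_const[OF lim] by auto
          then show ?thesis using \<eta>' by linarith
        qed
        then show "\<exists>M. \<forall>j\<ge>M. norm (N (l - proj (U j) l) - 0) < \<eta>" by auto
      qed
      moreover have "N (u - l) \<le> \<epsilon> * N u"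
      proof -
        have lim: "(\<lambda>m. \<epsilon> * N u + N (p (r m) - l)) \<longlonglongrightarrow> \<epsilon> * N u + 0"
          by (intro tendsto_intros r(2))
        have "N (u - l) \<le> \<epsilon> * N u + N (p (r m) - l)" if m: "m \<ge> M" for m
        proof -
          have "N (u - p (r m)) \<le> \<epsilon> * N u"
            unfolding p_def using M m n rm[of m] by (intro near_proj[of _ "U n"] sub u) auto
          then show ?thesis using N_triangle_diff[of u l "p (r m)"] by simp
        qed
        then show ?thesis using LIMSEQ_le_const[OF lim] by auto
      qed
      ultimately show "\<exists>w\<in>V. N (u - w) \<le> \<epsilon> * N u" by blast
    qed
    then show "\<exists>M. \<forall>n\<ge>M. near \<epsilon> (U n) V" by blast
  qed
  have "V \<in> grassmannian k"
  proof -
    obtain M M' where M: "\<forall>n\<ge>M. near (1 / 2) (U n) V" "\<forall>n\<ge>M'. near (1 / 2) V (U n)"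
      using gr_limitD[OF UV, of "1 / 2"] VU[of "1 / 2"] by auto
    define n where "n = max M M'"
    have "near (1 / 2) (U n) V" "near (1 / 2) V (U n)" using M by (simp_all add: n_def)
    then have "vec.dim V = vec.dim (U n)"
      using near_imp_dim_le[of "1 / 2"] sub[of n] subV by (simp add: order_antisym)
    then show ?thesis using U[of n] subV unfolding grassmannian_def by simp
  qed
  then show ?thesis using UV that by blast
qed

subsection \<open>Transversality\<close>

text \<open>Addition is an injective real linear map on the product of the three subspaces, and an
  injective linear map on a closed finite-dimensional subspace is bounded below.\<close>

lemma direct_sum_bound:
  assumes P: "vec.subspace P" and Q: "vec.subspace Q" and Z: "vec.subspace Z"
    and PQ: "P \<inter> Q = {0}" and PQZ: "subspace_sum P Q \<inter> Z = {0}"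
  obtains c where "0 < c" "\<And>v u z. v \<in> P \<Longrightarrow> u \<in> Q \<Longrightarrow> z \<in> Z \<Longrightarrow> c * (N v + N u + N z) \<le> N (v + u + z)"
proof -
  define f :: "('k ^ 'n) \<times> ('k ^ 'n) \<times> ('k ^ 'n) \<Rightarrow> 'k ^ 'n" where
    "f = (\<lambda>(v, u, z). v + u + z)"
  have lin: "linear f" by (rule linearI) (auto simp: f_def scaleR_add_right)
  have real: "subspace P" "subspace Q" "subspace Z" by (intro real_subspace_if_vec_subspace P Q Z)+
  have inj: "x = 0" if mem: "x \<in> P \<times> Q \<times> Z" and f0: "f x = 0" for x
  proof -
    obtain v u z where x: "x = (v, u, z)" "v \<in> P" "u \<in> Q" "z \<in> Z"
      using mem by blast
    have sum: "v + u + z = 0" using f0 x by (simp add: f_def)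
    have "v + u \<in> subspace_sum P Q" using x unfolding subspace_sum_def by blast
    moreover have "v + u = - z" using sum by (simp add: eq_neg_iff_add_eq_0)
    ultimately have "- z \<in> subspace_sum P Q \<inter> Z" using vec.subspace_neg[OF Z x(4)] by auto
    then have z: "z = 0" using PQZ by auto
    then have "v = - u" using sum by (simp add: eq_neg_iff_add_eq_0)
    then have "v \<in> P \<inter> Q" using x vec.subspace_neg[OF Q] by auto
    then show ?thesis using PQ z sum x(1) by (auto simp: zero_prod_def)
  qed
  obtain e where e: "e > 0" "\<And>x. x \<in> P \<times> Q \<times> Z \<Longrightarrow> e * norm x \<le> norm (f x)"
  proof -
    have sub: "subspace (P \<times> Q \<times> Z)" by (intro subspace_Times real)
    have "\<exists>e>0. \<forall>x\<in>P \<times> Q \<times> Z. e * norm x \<le> norm (f x)"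
      using inj lin by (intro injective_imp_isometric[OF closed_subspace[OF sub] sub])
        (auto simp: linear_conv_bounded_linear)
    then show thesis using that by blast
  qed
  obtain c C where c: "0 < c" "0 < C" "\<And>v. c * norm v \<le> N v" "\<And>v. N v \<le> C * norm v"
    using norm_equiv by blast
  \<comment> \<open>The 3 counts the components, each bounded by the product norm; \<open>c\<close>
    and \<open>C\<close> convert between \<open>N\<close> and the standard norm.\<close>
  have "e * c / (3 * C) * (N v + N u + N z) \<le> N (v + u + z)" if "v \<in> P" "u \<in> Q" "z \<in> Z" for v u z
  proof -
    let ?x = "(v, u, z)"
    have "norm v \<le> norm ?x" "norm u \<le> norm ?x" "norm z \<le> norm ?x"
      using norm_fst_le[of v "(u, z)"] norm_snd_le[of "(u, z)" v] norm_fst_le[of u z] norm_snd_le[of z u]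
      by auto
    then have "C * norm v + C * norm u + C * norm z \<le> 3 * C * norm ?x"
      using c(2) by (simp add: distrib_left[symmetric])
    then have "N v + N u + N z \<le> 3 * C * norm ?x" using c(4)[of v] c(4)[of u] c(4)[of z] by linarith
    then have "e * c / (3 * C) * (N v + N u + N z) \<le> e * c / (3 * C) * (3 * C * norm ?x)"
      using e c by (intro mult_left_mono) auto
    also have "\<dots> = c * (e * norm ?x)" using c by simp
    also have "\<dots> \<le> c * norm (v + u + z)"
      using e(2)[of ?x] that c(1) by (simp add: f_def)
    also have "\<dots> \<le> N (v + u + z)" by (rule c(3))
    finally show ?thesis .
  qed
  moreover have "0 < e * c / (3 * C)" using e c by simp
  ultimately show ?thesis using that by blast
qed

text \<open>Replacing the three vectors by neighbours in \<open>P\<close>, \<open>Q\<close>,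
  \<open>Z\<close> costs \<open>\<epsilon> * S\<close> in the sum and another
  \<open>c * \<epsilon> * S\<close> in the lower bound, where \<open>S\<close> is the sum of the
  norms. The threshold on \<epsilon> is the one for which the total loss is at most
  \<open>c / 2 * S\<close>.\<close>

lemma transversality_stable:
  assumes c: "0 < c" "\<And>v u z. v \<in> P \<Longrightarrow> u \<in> Q \<Longrightarrow> z \<in> Z \<Longrightarrow> c * (N v + N u + N z) \<le> N (v + u + z)"
    and near: "near \<epsilon> P' P" "near \<epsilon> Q' Q" "near \<epsilon> Z' Z" and \<epsilon>: "0 \<le> \<epsilon>" "\<epsilon> \<le> c / (2 * (c + 1))"
    and v: "v \<in> P'" "u \<in> Q'" "z \<in> Z'"
  shows "c / 2 * N (v + u) \<le> N (v + u + z)"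
proof -
  obtain v0 u0 z0 where v0: "v0 \<in> P" "N (v - v0) \<le> \<epsilon> * N v" and u0: "u0 \<in> Q" "N (u - u0) \<le> \<epsilon> * N u"
    and z0: "z0 \<in> Z" "N (z - z0) \<le> \<epsilon> * N z"
    using near v unfolding near_def by meson
  define S where "S = N v + N u + N z"
  have S: "0 \<le> S" by (simp add: S_def)
  have "N v \<le> N (v - v0) + N v0" "N u \<le> N (u - u0) + N u0" "N z \<le> N (z - z0) + N z0"
    using N_triangle[of "v - v0" v0] N_triangle[of "u - u0" u0] N_triangle[of "z - z0" z0] by simp_all
  then have "S - \<epsilon> * S \<le> N v0 + N u0 + N z0"
    using v0(2) u0(2) z0(2) unfolding S_def by (simp add: distrib_left)
  then have "c * (S - \<epsilon> * S) \<le> c * (N v0 + N u0 + N z0)" using c(1) by simp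
  also have "\<dots> \<le> N (v0 + u0 + z0)" by (rule c(2)[OF v0(1) u0(1) z0(1)])
  also have "\<dots> \<le> N (v + u + z) + \<epsilon> * S"
  proof -
    have "v0 + u0 + z0 = (v + u + z) + ((v0 - v) + (u0 - u) + (z0 - z))" by simp
    then have "N (v0 + u0 + z0) \<le> N (v + u + z) + N ((v0 - v) + (u0 - u) + (z0 - z))"
      using N_triangle by metis
    also have "N ((v0 - v) + (u0 - u) + (z0 - z)) \<le> N (v0 - v) + N (u0 - u) + N (z0 - z)"
      using N_triangle[of "(v0 - v) + (u0 - u)" "z0 - z"] N_triangle[of "v0 - v" "u0 - u"] by linarith
    also have "\<dots> \<le> \<epsilon> * S"
      using v0(2) u0(2) z0(2) unfolding S_def
      by (simp add: distrib_left N_minus_commute[of v0] N_minus_commute[of u0] N_minus_commute[of z0])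
    finally show ?thesis by simp
  qed
  finally have 1: "c * S - \<epsilon> * (c + 1) * S \<le> N (v + u + z)" by (simp add: algebra_simps)
  have "\<epsilon> * (c + 1) \<le> c / (2 * (c + 1)) * (c + 1)" using \<epsilon> c(1) by (intro mult_right_mono) auto
  also have "\<dots> = c / 2" using c(1) by (simp add: field_simps)
  finally have "\<epsilon> * (c + 1) * S \<le> c / 2 * S" using S by (rule mult_right_mono)
  then have "c / 2 * S \<le> N (v + u + z)" using 1 by (simp add: field_simps)
  moreover have "c / 2 * N (v + u) \<le> c / 2 * S"
    using c(1) N_triangle[of v u] N_nonneg[of z] unfolding S_def by (intro mult_left_mono) linarith+
  ultimately show ?thesis by linarith
qed

text \<open>For \<open>w = A *v v\<close>, the vector \<open>v = B *v w\<close> is attracted to the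
  long axes of the inverse \<open>B\<close>, with an error \<open>N w\<close> divided by the r-th
  singular value of \<open>A\<close>. Being transverse to them, \<open>v\<close> cannot be longer
  than \<open>1 / c\<close> times this error. So \<open>A\<close> expands \<open>W\<close>, while
  the part of \<open>A *v v\<close> off its own axes is bounded by the (r+1)-st singular value times
  \<open>N v\<close>.\<close>

lemma transverse_image_near_attractor:
  assumes A: "invertible A" and B: "B ** A = mat 1" "invertible B" and r: "1 \<le> r" "r + 1 \<le> CARD('n)"
    and c: "0 < c"
    and trans: "\<And>v z. v \<in> W \<Longrightarrow> z \<in> longest_axes_span ip (CARD('n) - r) B \<Longrightarrow> c * N v \<le> N (v + z)"
  shows "near (singular_value ip (r + 1) A / singular_value ip r A / c) ((*v) A ` W)
    (longest_axes_span ip r A)"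
proof (rule nearI)
  fix w assume "w \<in> (*v) A ` W"
  then obtain v where v: "v \<in> W" "w = A *v v" by blast
  have rr: "r \<in> {1..CARD('n)}" "r + 1 \<in> {1..CARD('n)}" using r by auto
  let ?Z = "longest_axes_span ip (CARD('n) - r) B"
  \<comment> \<open>Matches the index d - r + 1 from attraction under \<open>B\<close> with the
    index d + 1 - r in \<open>singular_value_inverse\<close>, where it turns into the r-th singular
    value of \<open>A\<close>.\<close>
  have eq: "CARD('n) - r + 1 = CARD('n) + 1 - r" using r by simp
  obtain z where z: "z \<in> ?Z" "N (B *v w - z) \<le> singular_value ip (CARD('n) - r + 1) B * N w"
    using longest_axes_span_attracts[OF B(2), of "CARD('n) - r" w] r by fastforce
  have Bw: "B *v w = v" using B(1) by (simp add: v(2) matrix_vector_mul_assoc)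
  have "?Z \<in> grassmannian (CARD('n) - r)" by (rule longest_axes_span_grassmannian[OF B(2)]) simp
  then have "- z \<in> ?Z" using z(1) vec.subspace_neg grassmannian_subspace by blast
  from trans[OF v(1) this] have "c * N v \<le> N (v - z)" by simp
  also have "\<dots> \<le> N w / singular_value ip r A"
    using z(2) unfolding Bw eq singular_value_inverse[OF A B(1) rr(1)] by simp
  finally have "N v \<le> N w / singular_value ip r A / c"
    by (subst pos_le_divide_eq[OF c]) (simp add: mult.commute)
  then have "singular_value ip (r + 1) A * N v
      \<le> singular_value ip (r + 1) A * (N w / singular_value ip r A / c)"
    using singular_value_pos[OF A rr(2)] by (intro mult_left_mono) auto
  moreover obtain w' where "w' \<in> longest_axes_span ip r A"
      "N (A *v v - w') \<le> singular_value ip (r + 1) A * N v"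
    using longest_axes_span_attracts[OF A r(2)] by blast
  ultimately show "\<exists>w'\<in>longest_axes_span ip r A.
      N (w - w') \<le> singular_value ip (r + 1) A / singular_value ip r A / c * N w"
    unfolding v(2) by (intro bexI[of _ w']) auto
qed

end

section \<open>Word metrics\<close>

locale word_metric_group = group G for G :: "('g, 'b) monoid_scheme" (structure) +
  fixes S :: "'g set"
  assumes finite_S: "finite S" and sym_gen: "symmetric_generating_set G S"
begin

abbreviation "len \<equiv> word_length G S"
abbreviation "D \<equiv> word_dist G S"
abbreviation "gprod \<equiv> gromov_product G S \<one>"
abbreviation "word \<equiv> \<lambda>ws. foldr (\<otimes>) ws \<one>"

section \<open>Word length, word distance and the Gromov product\<close>

lemma S_carrier: "s \<in> S \<Longrightarrow> s \<in> carrier G"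
  and S_inv: "s \<in> S \<Longrightarrow> inv s \<in> S"
  and S_generate: "generate G S = carrier G"
  using sym_gen unfolding symmetric_generating_set_def by auto

lemma word_closed: "set ws \<subseteq> S \<Longrightarrow> word ws \<in> carrier G"
  by (induction ws) (auto simp: S_carrier)

lemma word_append: "set us \<subseteq> S \<Longrightarrow> set vs \<subseteq> S \<Longrightarrow> word (us @ vs) = word us \<otimes> word vs"
  by (induction us) (auto simp: S_carrier word_closed m_assoc)

lemma word_inv: "set ws \<subseteq> S \<Longrightarrow> word (rev (map (\<lambda>s. inv s) ws)) = inv (word ws)"
proof (induction ws)
  case (Cons s ws)
  then have "word (rev (map (\<lambda>s. inv s) ws) @ [inv s]) = word (rev (map (\<lambda>s. inv s) ws)) \<otimes> word [inv s]"
    by (intro word_append) (auto simp: S_inv)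
  then show ?case using Cons by (simp add: S_carrier word_closed inv_mult_group)
qed simp

lemma ex_word:
  assumes "g \<in> carrier G"
  shows "\<exists>ws. set ws \<subseteq> S \<and> word ws = g"
proof -
  have "g \<in> generate G S" using assms S_generate by simp
  then show ?thesis
  proof (induction g rule: generate.induct)
    case one
    show ?case by (rule exI[of _ "[]"]) simp
  next
    case (incl h)
    then show ?case by (intro exI[of _ "[h]"]) (simp add: S_carrier)
  next
    case (inv h)
    then show ?case by (intro exI[of _ "[inv h]"]) (simp add: S_carrier S_inv)
  next
    case (eng h1 h2)
    then obtain us vs where "set us \<subseteq> S" "word us = h1" "set vs \<subseteq> S" "word vs = h2" by blast
    then show ?case using word_append[of us vs] by (intro exI[of _ "us @ vs"]) simp
  qed
qed

lemma len_attained: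
  assumes "g \<in> carrier G"
  obtains ws where "set ws \<subseteq> S" "length ws = len g" "word ws = g"
proof -
  have "\<exists>n. \<exists>ws. set ws \<subseteq> S \<and> length ws = n \<and> word ws = g" using ex_word[OF assms] by blast
  from LeastI_ex[OF this] show ?thesis using that unfolding word_length_def by blast
qed

lemma len_word_le: "set ws \<subseteq> S \<Longrightarrow> len (word ws) \<le> length ws"
  unfolding word_length_def by (rule Least_le) blast

lemma len_one [simp]: "len \<one> = 0"
  using len_word_le[of "[]"] by simp

lemma len_mult_le:
  assumes "g \<in> carrier G" "h \<in> carrier G"
  shows "len (g \<otimes> h) \<le> len g + len h"
proof -
  obtain us where us: "set us \<subseteq> S" "length us = len g" "word us = g" using len_attained[OF assms(1)] by blast
  obtain vs where vs: "set vs \<subseteq> S" "length vs = len h" "word vs = h" using len_attained[OF assms(2)] by blast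
  have "len (word (us @ vs)) \<le> length (us @ vs)" using us vs by (intro len_word_le) auto
  then show ?thesis using us vs by (simp add: word_append del: foldr_append)
qed

lemma len_inv_le:
  assumes "g \<in> carrier G"
  shows "len (inv g) \<le> len g"
proof -
  obtain ws where ws: "set ws \<subseteq> S" "length ws = len g" "word ws = g" using len_attained[OF assms] by blast
  have "len (word (rev (map (\<lambda>s. inv s) ws))) \<le> length ws"
    using len_word_le[of "rev (map (\<lambda>s. inv s) ws)"] ws S_inv by auto
  then show ?thesis unfolding word_inv[OF ws(1)] ws .
qed

lemma len_inv: "g \<in> carrier G \<Longrightarrow> len (inv g) = len g"
  using len_inv_le[of g] len_inv_le[of "inv g"] by simp

lemma inv_mult_cancel:
  assumes "g \<in> carrier G" "h \<in> carrier G"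
  shows "inv g \<otimes> (g \<otimes> h) = h" "g \<otimes> (inv g \<otimes> h) = h"
  using assms by (simp_all add: m_assoc[symmetric])

lemma D_one: "g \<in> carrier G \<Longrightarrow> D \<one> g = len g"
  by (simp add: word_dist_def)

lemma D_self: "g \<in> carrier G \<Longrightarrow> D g g = 0"
  by (simp add: word_dist_def)

lemma D_commute: "g \<in> carrier G \<Longrightarrow> h \<in> carrier G \<Longrightarrow> D g h = D h g"
  using len_inv[of "inv g \<otimes> h"] by (simp add: word_dist_def inv_mult_group)

lemma D_translate:
  "k \<in> carrier G \<Longrightarrow> g \<in> carrier G \<Longrightarrow> h \<in> carrier G \<Longrightarrow> D (k \<otimes> g) (k \<otimes> h) = D g h"
  by (simp add: word_dist_def inv_mult_group m_assoc inv_mult_cancel)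

lemma D_triangle:
  assumes "g \<in> carrier G" "h \<in> carrier G" "k \<in> carrier G"
  shows "D g k \<le> D g h + D h k"
proof -
  have "inv g \<otimes> k = (inv g \<otimes> h) \<otimes> (inv h \<otimes> k)"
    using assms by (simp add: m_assoc inv_mult_cancel)
  then show ?thesis using len_mult_le[of "inv g \<otimes> h" "inv h \<otimes> k"] assms by (simp add: word_dist_def)
qed

lemma gprod_eq:
  "g \<in> carrier G \<Longrightarrow> h \<in> carrier G \<Longrightarrow> gprod g h = (real (len g) + real (len h) - real (D g h)) / 2"
  by (simp add: gromov_product_def D_one)

lemma gprod_commute: "g \<in> carrier G \<Longrightarrow> h \<in> carrier G \<Longrightarrow> gprod g h = gprod h g"
  by (simp add: gprod_eq D_commute)

lemma gprod_self: "g \<in> carrier G \<Longrightarrow> gprod g g = len g"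
  by (simp add: gprod_eq D_self)

lemma len_le_D:
  assumes "g \<in> carrier G" "h \<in> carrier G"
  shows "len h \<le> len g + D g h"
  using D_triangle[of \<one> g h] assms by (simp add: D_one)

lemma gprod_le_len:
  assumes "g \<in> carrier G" "h \<in> carrier G"
  shows "gprod g h \<le> len g" "gprod g h \<le> len h"
  using len_le_D[OF assms] len_le_D[OF assms(2,1)] assms by (simp_all add: gprod_eq D_commute)

lemma gprod_nonneg:
  assumes "g \<in> carrier G" "h \<in> carrier G"
  shows "0 \<le> gprod g h"
  using D_triangle[of g \<one> h] assms D_commute[of g \<one>] by (simp add: gprod_eq D_one)

text \<open>The right-hand side is the Gromov product based at \<open>k\<close>. Translating by
  \<open>inv k\<close> thus expresses every change of base point through products based at
  \<one>.\<close>

lemma gprod_translate: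
  assumes "k \<in> carrier G" "g \<in> carrier G" "h \<in> carrier G"
  shows "gprod (inv k \<otimes> g) (inv k \<otimes> h) = (real (D k g) + real (D k h) - real (D g h)) / 2"
  using assms by (simp add: gprod_eq D_translate) (simp add: word_dist_def)

text \<open>The vertices are the prefixes of a shortest word. Counting letters bounds the distances
  from above, and a strict inequality anywhere would shorten the whole word.\<close>

lemma ex_geodesic:
  assumes "g \<in> carrier G"
  obtains u where "\<And>i. u i \<in> carrier G" "u 0 = \<one>" "u (len g) = g"
    "\<And>i j. i \<le> j \<Longrightarrow> j \<le> len g \<Longrightarrow> D (u i) (u j) = j - i"
    "\<And>i. i < len g \<Longrightarrow> \<exists>s\<in>S. u (Suc i) = u i \<otimes> s"
proof -
  obtain ws where ws: "set ws \<subseteq> S" "length ws = len g" "word ws = g" using len_attained[OF assms] by blast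
  define u where "u i = word (take i ws)" for i
  have take: "set (take i ws) \<subseteq> S" for i using ws(1) set_take_subset by fastforce
  have u: "u i \<in> carrier G" for i unfolding u_def by (rule word_closed[OF take])
  have "D (u i) (u j) \<le> j - i" if "i \<le> j" for i j
  proof -
    let ?v = "drop i (take j ws)"
    have v: "set ?v \<subseteq> S" using take[of j] set_drop_subset by fastforce
    have "take j ws = take i ws @ ?v" using that append_take_drop_id[of i "take j ws"] by (simp add: min_def)
    then have "u j = u i \<otimes> word ?v" unfolding u_def using word_append[OF take v] by metis
    then have "inv (u i) \<otimes> u j = word ?v" using u word_closed[OF v] by (simp add: inv_solve_left')
    then have "D (u i) (u j) = len (word ?v)" by (simp add: word_dist_def)
    also have "\<dots> \<le> j - i" using len_word_le[OF v] by simp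
    finally show ?thesis .
  qed
  note le = this
  have u0: "u 0 = \<one>" and ug: "u (len g) = g" using ws by (simp_all add: u_def)
  have "D (u i) (u j) = j - i" if ij: "i \<le> j" "j \<le> len g" for i j
  proof -
    have "len g \<le> D (u 0) (u i) + D (u i) (u (len g))"
      using D_triangle[OF u u u, of 0 "len g" i] D_one[OF assms] by (simp add: u0 ug)
    also have "\<dots> \<le> i + (D (u i) (u j) + D (u j) (u (len g)))"
      using D_triangle[OF u u u, of i "len g" j] le[of 0 i] by simp
    also have "\<dots> \<le> i + D (u i) (u j) + (len g - j)" using le[of j "len g"] ij by simp
    finally show ?thesis using le[OF ij(1)] ij by simp
  qed
  moreover have "\<exists>s\<in>S. u (Suc i) = u i \<otimes> s" if "i < len g" for i
  proof -
    have i: "i < length ws" using that ws by simp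
    then have s: "ws ! i \<in> S" using ws(1) by auto
    have "u (Suc i) = word (take i ws @ [ws ! i])" unfolding u_def take_Suc_conv_app_nth[OF i] ..
    also have "\<dots> = u i \<otimes> ws ! i" using word_append[OF take, of "[ws ! i]" i] s by (simp add: u_def S_carrier)
    finally show ?thesis using s by blast
  qed
  ultimately show ?thesis using that u u0 ug by blast
qed

lemma finite_ball: "finite {g \<in> carrier G. len g \<le> n}"
proof (rule finite_subset)
  show "{g \<in> carrier G. len g \<le> n} \<subseteq> word ` {ws. set ws \<subseteq> S \<and> length ws \<le> n}"
  proof
    fix g assume "g \<in> {g \<in> carrier G. len g \<le> n}"
    then obtain ws where "set ws \<subseteq> S" "length ws = len g" "word ws = g" "len g \<le> n"
      using len_attained by blast
    then show "g \<in> word ` {ws. set ws \<subseteq> S \<and> length ws \<le> n}" by (intro image_eqI[of _ _ ws]) auto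
  qed
  show "finite (word ` {ws. set ws \<subseteq> S \<and> length ws \<le> n})"
    using finite_lists_length_le[OF finite_S] by simp
qed

subsection \<open>Geodesic rays and the boundary\<close>

lemma ray_carrier: "a \<in> geodesic_rays G S \<Longrightarrow> a n \<in> carrier G"
  and ray_D: "a \<in> geodesic_rays G S \<Longrightarrow> m \<le> n \<Longrightarrow> D (a m) (a n) = n - m"
  unfolding geodesic_rays_def by auto

lemma ray_len_bounds:
  assumes "a \<in> geodesic_rays G S"
  shows "len (a n) \<le> n + len (a 0)" "n \<le> len (a n) + len (a 0)"
proof -
  have "D (a 0) (a n) = n" using ray_D[OF assms, of 0 n] by simp
  moreover have "D (a 0) (a n) \<le> D (a 0) \<one> + D \<one> (a n)"
    using D_triangle ray_carrier[OF assms] by blast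
  ultimately show "len (a n) \<le> n + len (a 0)" "n \<le> len (a n) + len (a 0)"
    using len_le_D[of "a 0" "a n"] ray_carrier[OF assms] D_commute[of "a 0" \<one>] D_one
    by simp_all
qed

text \<open>The points \<open>a m\<close> and \<open>b n\<close> are at distance at most
  \<open>C\<close> plus the difference of \<open>m\<close> and \<open>n\<close>. The other error
  terms account for rays that do not start at \<one>.\<close>

lemma ray_gprod_ge:
  assumes a: "a \<in> geodesic_rays G S" and b: "b \<in> geodesic_rays G S" and C: "\<And>n. D (a n) (b n) \<le> C"
  shows "real (min m n) - (len (a 0) + len (b 0) + C) \<le> gprod (a m) (b n)"
proof -
  note car = ray_carrier[OF a] ray_carrier[OF b]
  have "D (a m) (b n) \<le> C + (max m n - min m n)"
  proof (cases "m \<le> n")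
    case True
    then show ?thesis
      using D_triangle[OF car(1) car(2) car(2), of m n m] C[of m] ray_D[OF b True] by simp
  next
    case False
    then show ?thesis
      using D_triangle[OF car(1) car(1) car(2), of m n n] C[of n] ray_D[OF a, of n m]
        D_commute[OF car(1) car(1), of m n] by simp
  qed
  then have "real (D (a m) (b n)) \<le> C + (real (max m n) - real (min m n))" by linarith
  moreover have "real (max m n) + real (min m n) = real m + real n" by linarith
  moreover have "real m \<le> len (a m) + len (a 0)" "real n \<le> len (b n) + len (b 0)"
    using ray_len_bounds(2)[OF a, of m] ray_len_bounds(2)[OF b, of n] by linarith+
  ultimately show ?thesis using gprod_eq[OF car(1) car(2), of m n] by simp
qed

lemma ray_gprod_self_ge:
  assumes "a \<in> geodesic_rays G S"
  shows "real (min m n) - 2 * real (len (a 0)) \<le> gprod (a m) (a n)"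
  using ray_gprod_ge[OF assms assms, of 0 m n] D_self ray_carrier[OF assms] by simp

lemma equiv_asymptotic: "equiv (geodesic_rays G S) (asymptotic G S)"
proof (rule equivI)
  show "asymptotic G S \<subseteq> geodesic_rays G S \<times> geodesic_rays G S" unfolding asymptotic_def by blast
  show "refl_on (geodesic_rays G S) (asymptotic G S)"
    unfolding refl_on_def asymptotic_def using D_self ray_carrier by fastforce
  show "sym (asymptotic G S)"
  proof (rule symI)
    fix a b assume ab: "(a, b) \<in> asymptotic G S"
    then have "D (b n) (a n) = D (a n) (b n)" for n
      unfolding asymptotic_def using D_commute[OF ray_carrier ray_carrier] by blast
    then show "(b, a) \<in> asymptotic G S" using ab unfolding asymptotic_def by simp
  qed
  show "trans (asymptotic G S)"
  proof (rule transI)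
    fix a b c assume "(a, b) \<in> asymptotic G S" "(b, c) \<in> asymptotic G S"
    then obtain C C' where rays: "a \<in> geodesic_rays G S" "b \<in> geodesic_rays G S" "c \<in> geodesic_rays G S"
      and C: "\<And>n. D (a n) (b n) \<le> C" "\<And>n. D (b n) (c n) \<le> C'"
      unfolding asymptotic_def by blast
    have "D (a n) (c n) \<le> C + C'" for n
      using D_triangle[of "a n" "b n" "c n"] C[of n] rays by (simp add: ray_carrier)
    then show "(a, c) \<in> asymptotic G S" unfolding asymptotic_def using rays by blast
  qed
qed

lemma boundary_nonempty: "x \<in> gromov_boundary G S \<Longrightarrow> \<exists>a. a \<in> x"
  unfolding gromov_boundary_def using in_quotient_imp_non_empty[OF equiv_asymptotic] by blast

lemma boundary_ray: "x \<in> gromov_boundary G S \<Longrightarrow> a \<in> x \<Longrightarrow> a \<in> geodesic_rays G S"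
  unfolding gromov_boundary_def using in_quotient_imp_subset[OF equiv_asymptotic] by blast

lemma boundary_eq_iff:
  assumes "x \<in> gromov_boundary G S" "y \<in> gromov_boundary G S" "a \<in> x" "b \<in> y"
  shows "x = y \<longleftrightarrow> (a, b) \<in> asymptotic G S"
  using quotient_eq_iff[OF equiv_asymptotic] assms unfolding gromov_boundary_def by blast

lemma ray_class:
  assumes "a \<in> geodesic_rays G S"
  shows "asymptotic G S `` {a} \<in> gromov_boundary G S" "a \<in> asymptotic G S `` {a}"
  using assms equiv_class_self[OF equiv_asymptotic] by (simp_all add: gromov_boundary_def quotientI)

lemma boundary_gprod_ge:
  assumes "x \<in> gromov_boundary G S" "a \<in> x" "b \<in> x"
  obtains C where "\<And>m n. real (min m n) - C \<le> gprod (a m) (b n)"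
proof -
  have "(a, b) \<in> asymptotic G S" using boundary_eq_iff[OF assms(1,1,2,3)] by simp
  then obtain C where C: "\<And>n. D (a n) (b n) \<le> C" unfolding asymptotic_def by blast
  have "real (min m n) - real (len (a 0) + len (b 0) + C) \<le> gprod (a m) (b n)" for m n
    using ray_gprod_ge[OF boundary_ray[OF assms(1,2)] boundary_ray[OF assms(1,3)] C] by simp
  then show ?thesis using that by blast
qed

text \<open>Arzela--Ascoli: balls are finite, so geodesic segments from \<open>\<one>\<close> subconverge to a ray.\<close>

lemma geodesics_subconverge:
  assumes g: "\<And>n. g n \<in> carrier G" and lim: "\<And>B. \<exists>M. \<forall>n\<ge>M. B \<le> len (g n)"
  obtains r \<alpha> where "strict_mono (r :: nat \<Rightarrow> nat)" "\<alpha> \<in> geodesic_rays G S"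
    "\<And>j n. j \<le> n \<Longrightarrow> real j \<le> gprod (g (r n)) (\<alpha> j)" "\<And>j. len (\<alpha> j) = j"
proof -
  have "\<exists>u. (\<forall>i. u i \<in> carrier G) \<and> u 0 = \<one> \<and> u (len (g n)) = g n \<and>
      (\<forall>i j. i \<le> j \<longrightarrow> j \<le> len (g n) \<longrightarrow> D (u i) (u j) = j - i)" for n
    using ex_geodesic[OF g[of n]] by metis
  then obtain u where u: "\<And>n i. u n i \<in> carrier G" "\<And>n. u n 0 = \<one>" "\<And>n. u n (len (g n)) = g n"
      "\<And>n i j. i \<le> j \<Longrightarrow> j \<le> len (g n) \<Longrightarrow> D (u n i) (u n j) = j - i"
    by metis
  \<comment> \<open>Nested infinite index sets: on the j-th one, all the chosen geodesics agree at
    their j-th vertex. A ball has finitely many elements, so the pigeonhole principle provides the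
    next set.\<close>
  define P where "P j A \<longleftrightarrow> infinite A \<and> (\<forall>n\<in>A. j \<le> len (g n)) \<and> (\<exists>c. \<forall>n\<in>A. u n j = c)" for j A
  have "\<exists>A. \<forall>j. P j (A j) \<and> A (Suc j) \<subseteq> A j"
  proof (rule dependent_nat_choice)
    have "P 0 UNIV" unfolding P_def using u(2) by auto
    then show "\<exists>A. P 0 A" ..
  next
    fix A j assume "P j A"
    then have inf: "infinite A" unfolding P_def by blast
    obtain M where M: "\<forall>n\<ge>M. Suc j \<le> len (g n)" using lim by blast
    define A' where "A' = {n \<in> A. Suc j \<le> len (g n)}"
    have "A - {..<M} \<subseteq> A'" unfolding A'_def using M by auto
    then have inf': "infinite A'" using inf finite_subset Diff_infinite_finite finite_lessThan by metis
    have "(\<lambda>n. u n (Suc j)) ` A' \<subseteq> {h \<in> carrier G. len h \<le> Suc j}"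
    proof
      fix h assume "h \<in> (\<lambda>n. u n (Suc j)) ` A'"
      then obtain n where n: "n \<in> A'" "h = u n (Suc j)" by blast
      then have "D (u n 0) h = Suc j" using u(4)[of 0 "Suc j" n] by (simp add: A'_def)
      then show "h \<in> {h \<in> carrier G. len h \<le> Suc j}" using u(1,2) n by (simp add: D_one)
    qed
    then have "finite ((\<lambda>n. u n (Suc j)) ` A')" using finite_ball finite_subset by blast
    from pigeonhole_infinite[OF inf' this] obtain n0 where
      "n0 \<in> A'" "infinite {n \<in> A'. u n (Suc j) = u n0 (Suc j)}" by auto
    then have "P (Suc j) {n \<in> A'. u n (Suc j) = u n0 (Suc j)}" unfolding P_def A'_def by auto
    moreover have "{n \<in> A'. u n (Suc j) = u n0 (Suc j)} \<subseteq> A" unfolding A'_def by blast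
    ultimately show "\<exists>B. P (Suc j) B \<and> B \<subseteq> A" by blast
  qed
  then obtain A where A: "\<And>j. P j (A j)" "\<And>j. A (Suc j) \<subseteq> A j" by blast
  have Amono: "A n \<subseteq> A j" if "j \<le> n" for j n using lift_Suc_antimono_le[of A, OF A(2) that] .
  obtain \<alpha> where \<alpha>: "\<And>j n. n \<in> A j \<Longrightarrow> u n j = \<alpha> j" using A(1) unfolding P_def by metis
  \<comment> \<open>Diagonal choice: from position \<open>j\<close> on, the sequence stays in the
    j-th index set.\<close>
  have "\<exists>r. \<forall>n. r n \<in> A n \<and> (r n :: nat) < r (Suc n)"
  proof (rule dependent_nat_choice)
    show "\<exists>m. m \<in> A 0" using A(1)[of 0] unfolding P_def by (metis ex_in_conv finite.emptyI)
    fix m n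
    have "infinite (A (Suc n))" using A(1) unfolding P_def by blast
    then show "\<exists>m'. m' \<in> A (Suc n) \<and> m < m'" using infinite_nat_iff_unbounded by blast
  qed
  then obtain r where r: "\<And>n. r n \<in> A n" "\<And>n. r n < r (Suc n)" by blast
  have rA: "r n \<in> A j" if "j \<le> n" for j n using r(1) Amono[OF that] by blast
  have ru: "u (r n) j = \<alpha> j" "j \<le> len (g (r n))" if "j \<le> n" for j n
    using \<alpha>[OF rA[OF that]] A(1)[of j] rA[OF that] unfolding P_def by blast+
  have car: "\<alpha> j \<in> carrier G" for j using ru(1)[of j j] u(1)[of "r j" j] by simp
  have D: "D (\<alpha> i) (\<alpha> j) = j - i" if "i \<le> j" for i j
    using u(4)[of i j "r j"] ru[of j j] ru(1)[of i j] that by simp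
  have len: "len (\<alpha> j) = j" for j
    using D[of 0 j] ru(1)[of 0 0] u(2) D_one[OF car] by simp
  \<comment> \<open>For these indices \<alpha> \<open>j\<close> is a vertex of the geodesic from
    \<one> to \<open>g (r n)\<close>, so the product is its length \<open>j\<close>.\<close>
  have "real j \<le> gprod (g (r n)) (\<alpha> j)" if "j \<le> n" for j n
  proof -
    have "D (\<alpha> j) (g (r n)) = len (g (r n)) - j"
      using u(3)[of "r n"] u(4)[of j "len (g (r n))" "r n"] ru[OF that] by simp
    then show ?thesis
      using gprod_eq[OF car[of j] g[of "r n"]] gprod_commute[OF car[of j] g[of "r n"]] len ru(2)[OF that]
      by simp
  qed
  moreover have "\<alpha> \<in> geodesic_rays G S" unfolding geodesic_rays_def using car D by simp
  moreover have "strict_mono r" using r(2) by (simp add: strict_mono_Suc_iff)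
  ultimately show ?thesis using that len by blast
qed

end

section \<open>Hyperbolic groups\<close>

text \<open>The inequality is recorded for the base point \<one> alone, since other base points are
  reached by translation.\<close>

locale hyperbolic_word_group = word_metric_group +
  fixes \<delta> :: real
  assumes hyp: "g \<in> carrier G \<Longrightarrow> h \<in> carrier G \<Longrightarrow> k \<in> carrier G \<Longrightarrow>
    min (gprod g h) (gprod h k) - \<delta> \<le> gprod g k"
    and \<delta>_nonneg: "0 \<le> \<delta>"
begin

section \<open>Boundary points, neighbourhoods and triangles in a hyperbolic group\<close>

lemma hyp_le:
  assumes "g \<in> carrier G" "h \<in> carrier G" "k \<in> carrier G" "t \<le> gprod g h" "t \<le> gprod h k"
  shows "t - \<delta> \<le> gprod g k"
  using hyp[OF assms(1-3)] assms(4,5) by linarith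

text \<open>If the products were unbounded, going from \<open>a j\<close> out to \<open>a m\<close>,
  over to \<open>b m\<close> and back to \<open>b j\<close> would give a product of at least
  \<open>j\<close> minus a constant at every \<open>j\<close>. The rays would then stay at bounded
  distance and define the same point.\<close>

lemma gprod_bounded_if_distinct:
  assumes w: "w \<in> gromov_boundary G S" "a \<in> w" and y: "y \<in> gromov_boundary G S" "b \<in> y" and "w \<noteq> y"
  obtains B where "\<And>m. gprod (a m) (b m) \<le> B"
proof (rule ccontr)
  assume "\<not> thesis"
  then have unb: "\<exists>m. B < gprod (a m) (b m)" for B using that by (meson not_le)
  note a = boundary_ray[OF w] and b = boundary_ray[OF y]
  note car = ray_carrier[OF a] ray_carrier[OF b]
  define C where "C = 4 * real (len (a 0)) + 4 * real (len (b 0))"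
  have "real (D (a j) (b j)) \<le> 4 * C + 4 * \<delta>" for j
  proof -
    obtain m where m: "real j + len (a 0) < gprod (a m) (b m)" using unb by blast
    then have "real j + len (a 0) < len (a m)" using gprod_le_len(1)[OF car(1)[of m] car(2)[of m]] by linarith
    then have jm: "j \<le> m" using ray_len_bounds(1)[OF a, of m] by linarith
    have "real j - C \<le> gprod (a j) (a m)" "real j - C \<le> gprod (b m) (b j)"
      using ray_gprod_self_ge[OF a, of j m] ray_gprod_self_ge[OF b, of m j] jm unfolding C_def
      by (auto simp: min_def split: if_splits)
    moreover have "real j - C \<le> gprod (a m) (b m)" using m unfolding C_def by linarith
    ultimately have "real j - C - \<delta> - \<delta> \<le> gprod (a j) (b j)"
      using hyp_le[OF car(1) car(1) car(2), of "real j - C" j m m]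
        hyp_le[OF car(1) car(2) car(2), of "real j - C - \<delta>" j m j] \<delta>_nonneg by linarith
    moreover have "real (len (a j)) \<le> j + C" "real (len (b j)) \<le> j + C"
      using ray_len_bounds(1)[OF a, of j] ray_len_bounds(1)[OF b, of j] unfolding C_def by linarith+
    moreover have "real (D (a j) (b j)) = real (len (a j)) + real (len (b j)) - 2 * gprod (a j) (b j)"
      by (simp add: gprod_eq car field_simps)
    ultimately show ?thesis by linarith
  qed
  then have "D (a j) (b j) \<le> nat \<lceil>4 * C + 4 * \<delta>\<rceil>" for j by (meson le_nat_iff of_nat_le_iff real_nat_ceiling_ge order_trans)
  then have "(a, b) \<in> asymptotic G S" unfolding asymptotic_def using a b by blast
  then show False using boundary_eq_iff[OF w(1) y(1) w(2) y(2)] \<open>w \<noteq> y\<close> by blast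
qed

text \<open>Membership in a neighbourhood is witnessed by some pair of rays. Exchanging each for a
  given one costs \<delta>, since products between rays of the same class tend to infinity. The loss
  is uniform; only the starting index depends on the rays.\<close>

lemma boundary_nbhd_gprod:
  assumes x: "x \<in> gromov_boundary G S" "c \<in> x" and y: "y \<in> boundary_nbhd G S x R" "b \<in> y"
  obtains M where "\<And>m n. M \<le> m \<Longrightarrow> M \<le> n \<Longrightarrow> R - 2 * \<delta> \<le> gprod (c m) (b n)"
proof -
  have y': "y \<in> gromov_boundary G S" using y(1) unfolding boundary_nbhd_def by blast
  obtain a b' M0 where a: "a \<in> x" "b' \<in> y" "\<And>m n. M0 \<le> m \<Longrightarrow> M0 \<le> n \<Longrightarrow> R \<le> gprod (a m) (b' n)"
    using y(1) unfolding boundary_nbhd_def by blast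
  obtain C1 where C1: "\<And>m n. real (min m n) - C1 \<le> gprod (c m) (a n)"
    using boundary_gprod_ge[OF x a(1)] by blast
  obtain C2 where C2: "\<And>m n. real (min m n) - C2 \<le> gprod (b' m) (b n)"
    using boundary_gprod_ge[OF y' a(2) y(2)] by blast
  define M where "M = max M0 (nat \<lceil>\<bar>R\<bar> + \<bar>C1\<bar> + \<bar>C2\<bar>\<rceil>)"
  have M: "M0 \<le> M" "\<bar>R\<bar> + \<bar>C1\<bar> + \<bar>C2\<bar> \<le> real M" unfolding M_def by linarith+
  note car = ray_carrier[OF boundary_ray[OF x]] ray_carrier[OF boundary_ray[OF x(1) a(1)]]
    ray_carrier[OF boundary_ray[OF y' a(2)]] ray_carrier[OF boundary_ray[OF y' y(2)]]
  have "R - 2 * \<delta> \<le> gprod (c m) (b n)" if "M \<le> m" "M \<le> n" for m n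
  proof -
    have "real M \<le> real (min m M)" "real M \<le> real (min M n)" using that by linarith+
    then have 1: "R \<le> gprod (c m) (a M)" "R \<le> gprod (b' M) (b n)"
      using C1[of m M] C2[of M n] M(2) by linarith+
    have 2: "R - \<delta> \<le> gprod (c m) (b' M)"
      by (rule hyp_le[OF car(1) car(2) car(3) 1(1)]) (use a(3) M in blast)
    have "R - \<delta> - \<delta> \<le> gprod (c m) (b n)"
      by (rule hyp_le[OF car(1) car(3) car(4) 2]) (use 1 \<delta>_nonneg in linarith)
    then show ?thesis by simp
  qed
  then show ?thesis using that by blast
qed

text \<open>Fixing representatives costs 2 \<delta>, and the hyperbolic inequality through the
  middle point costs one more.\<close>

lemma boundary_nbhd_trans:
  assumes y: "y \<in> gromov_boundary G S" and z: "z \<in> boundary_nbhd G S y (R + 3 * \<delta>)"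
    and u: "u \<in> boundary_nbhd G S z (R + 3 * \<delta>)"
  shows "u \<in> boundary_nbhd G S y R"
proof -
  have z': "z \<in> gromov_boundary G S" and u': "u \<in> gromov_boundary G S"
    using z u unfolding boundary_nbhd_def by blast+
  obtain a b c where a: "a \<in> y" "b \<in> z" "c \<in> u" using boundary_nonempty y z' u' by metis
  obtain M1 where M1: "\<And>m n. M1 \<le> m \<Longrightarrow> M1 \<le> n \<Longrightarrow> R + 3 * \<delta> - 2 * \<delta> \<le> gprod (a m) (b n)"
    using boundary_nbhd_gprod[OF y a(1) z a(2)] by blast
  obtain M2 where M2: "\<And>m n. M2 \<le> m \<Longrightarrow> M2 \<le> n \<Longrightarrow> R + 3 * \<delta> - 2 * \<delta> \<le> gprod (b m) (c n)"
    using boundary_nbhd_gprod[OF z' a(2) u a(3)] by blast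
  let ?M = "max M1 M2"
  have "R \<le> gprod (a m) (c n)" if "?M \<le> m" "?M \<le> n" for m n
    using hyp_le[of "a m" "b ?M" "c n" "R + \<delta>"] M1[of m ?M] M2[of ?M n] that
      ray_carrier[OF boundary_ray] y z' u' a by simp
  then show ?thesis unfolding boundary_nbhd_def using a u' by blast
qed

lemma boundary_nbhd_self:
  assumes "x \<in> gromov_boundary G S"
  shows "x \<in> boundary_nbhd G S x R"
proof -
  obtain a where a: "a \<in> x" using boundary_nonempty[OF assms] by blast
  obtain C where C: "\<And>m n. real (min m n) - C \<le> gprod (a m) (a n)"
    using boundary_gprod_ge[OF assms a a] by blast
  let ?M = "nat \<lceil>R + C\<rceil>"
  have "R \<le> gprod (a m) (a n)" if "?M \<le> m" "?M \<le> n" for m n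
    using C[of m n] that by linarith
  then show ?thesis unfolding boundary_nbhd_def using a assms by blast
qed

text \<open>The basic neighbourhoods need not be open. Their interior is formed as the set of points
  having a whole neighbourhood inside, and \<open>boundary_nbhd_trans\<close> shows that this set is
  open.\<close>

lemma open_in_boundary_nbhd:
  assumes "x \<in> gromov_boundary G S"
  obtains V where "openin (boundary_topology G S) V" "x \<in> V" "V \<subseteq> boundary_nbhd G S x R"
proof -
  define V where "V = {y \<in> gromov_boundary G S. \<exists>R'. boundary_nbhd G S y R' \<subseteq> boundary_nbhd G S x R}"
  have "\<exists>R''. boundary_nbhd G S y R'' \<subseteq> V" if yV: "y \<in> V" for y
  proof -
    obtain R' where R': "y \<in> gromov_boundary G S" "boundary_nbhd G S y R' \<subseteq> boundary_nbhd G S x R"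
      using yV unfolding V_def by blast
    have "boundary_nbhd G S y (R' + 3 * \<delta>) \<subseteq> V"
    proof
      fix z assume z: "z \<in> boundary_nbhd G S y (R' + 3 * \<delta>)"
      then have "boundary_nbhd G S z (R' + 3 * \<delta>) \<subseteq> boundary_nbhd G S x R"
        using boundary_nbhd_trans[OF R'(1) z] R'(2) by blast
      then show "z \<in> V" using z unfolding V_def boundary_nbhd_def by blast
    qed
    then show ?thesis by blast
  qed
  then have "openin (boundary_topology G S) V" unfolding openin_boundary_topology V_def by blast
  moreover have "x \<in> V" unfolding V_def using assms by blast
  moreover have "V \<subseteq> boundary_nbhd G S x R" unfolding V_def using boundary_nbhd_self by blast
  ultimately show ?thesis using that by blast
qed

text \<open>The element \<open>\<gamma>\<close> is a coarse centre of the triangle with vertices \<open>\<one>\<close>, \<open>w\<close>, \<open>y\<close>: it lies on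
  a geodesic from \<open>\<one>\<close> to \<open>a M\<close> at distance about \<open>(w|y)\<close> from \<open>\<one>\<close>.\<close>

lemma coarse_centre:
  assumes x: "x \<in> gromov_boundary G S" "c \<in> x"
    and w: "w \<in> boundary_nbhd G S x R" "a \<in> w" and y: "y \<in> boundary_nbhd G S x R" "b \<in> y" and "w \<noteq> y"
  obtains \<gamma> M where "\<gamma> \<in> carrier G"
    "\<And>m. M \<le> m \<Longrightarrow> K \<le> gprod (inv \<gamma> \<otimes> a m) (inv \<gamma> \<otimes> a M)"
    "\<And>m. M \<le> m \<Longrightarrow> K \<le> gprod (inv \<gamma> \<otimes> b m) (inv \<gamma> \<otimes> b M)"
    "gprod (inv \<gamma> \<otimes> a M) (inv \<gamma> \<otimes> b M) \<le> 1 + \<delta>"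
    "gprod (inv \<gamma> \<otimes> a M) (inv \<gamma>) \<le> \<delta>" "gprod (inv \<gamma> \<otimes> b M) (inv \<gamma>) \<le> \<delta>"
    "\<exists>N. \<forall>m\<ge>N. R - 4 * \<delta> - 1 \<le> gprod \<gamma> (c m)"
proof -
  have w': "w \<in> gromov_boundary G S" and y': "y \<in> gromov_boundary G S"
    using w y unfolding boundary_nbhd_def by blast+
  note ra = boundary_ray[OF w' w(2)] and rb = boundary_ray[OF y' y(2)]
  note ca = ray_carrier[OF ra] and cb = ray_carrier[OF rb] and cc = ray_carrier[OF boundary_ray[OF x]]
  obtain B where B: "\<And>m. gprod (a m) (b m) \<le> B"
    using gprod_bounded_if_distinct[OF w' w(2) y' y(2) \<open>w \<noteq> y\<close>] by blast
  obtain M1 where M1: "\<And>m n. M1 \<le> m \<Longrightarrow> M1 \<le> n \<Longrightarrow> R - 2 * \<delta> \<le> gprod (c m) (a n)"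
    using boundary_nbhd_gprod[OF x w] by blast
  obtain M2 where M2: "\<And>m n. M2 \<le> m \<Longrightarrow> M2 \<le> n \<Longrightarrow> R - 2 * \<delta> \<le> gprod (c m) (b n)"
    using boundary_nbhd_gprod[OF x y] by blast
  \<comment> \<open>So large that, after the loss of at most \<open>B\<close> in changing the base
    point below, the products along each ray still exceed \<open>K\<close>.\<close>
  define M where
    "M = max (max M1 M2) (nat \<lceil>\<bar>K\<bar> + \<bar>B\<bar> + 2 * real (len (a 0)) + 2 * real (len (b 0))\<rceil>)"
  have M: "M1 \<le> M" "M2 \<le> M" "\<bar>K\<bar> + \<bar>B\<bar> + 2 * real (len (a 0)) + 2 * real (len (b 0)) \<le> real M"
    unfolding M_def by linarith+
  define g h where "g = a M" and "h = b M"
  have g: "g \<in> carrier G" and h: "h \<in> carrier G" unfolding g_def h_def by (rule ca cb)+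
  \<comment> \<open>Geodesics have integer times, so the product is rounded down; this is the source
    of the 1 in the bounds.\<close>
  define T where "T = nat \<lfloor>gprod g h\<rfloor>"
  have T: "real T \<le> gprod g h" "gprod g h \<le> real T + 1" "real T \<le> len g"
    using gprod_nonneg[OF g h] gprod_le_len(1)[OF g h] unfolding T_def by linarith+
  obtain u where u: "\<And>i. u i \<in> carrier G" "u 0 = \<one>" "u (len g) = g"
    "\<And>i j. i \<le> j \<Longrightarrow> j \<le> len g \<Longrightarrow> D (u i) (u j) = j - i" using ex_geodesic[OF g] by metis
  define \<gamma> where "\<gamma> = u T"
  have \<gamma>: "\<gamma> \<in> carrier G" unfolding \<gamma>_def by (rule u)
  have "D (u 0) \<gamma> = T" "D \<gamma> g = len g - T"
    using u(4)[of 0 T] u(4)[of T "len g"] T(3) u(3) unfolding \<gamma>_def by simp_all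
  then have len\<gamma>: "len \<gamma> = T" and D\<gamma>g: "real (D \<gamma> g) = real (len g) - real T"
    using T(3) D_one[OF \<gamma>] u(2) by simp_all
  have TB: "real T \<le> B" using T(1) B[of M] unfolding g_def h_def by linarith
  have \<gamma>g: "gprod \<gamma> g = T" using gprod_eq[OF \<gamma> g] len\<gamma> D\<gamma>g by simp
  \<comment> \<open>On the geodesic to \<open>g\<close> the product is exactly \<open>T\<close>;
    hyperbolicity carries it over to \<open>h\<close> with loss \<delta>, so \<gamma> is also nearly
    on a geodesic to \<open>h\<close>.\<close>
  then have \<gamma>h: "real T - \<delta> \<le> gprod \<gamma> h" using hyp_le[OF \<gamma> g h, of "real T"] T(1) by simp
  \<comment> \<open>Moving the base point from \<one> to \<gamma> lowers a Gromov product by at most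
    the distance \<open>T\<close> between them.\<close>
  have base: "gprod p q - real T \<le> gprod (inv \<gamma> \<otimes> p) (inv \<gamma> \<otimes> q)"
    if "p \<in> carrier G" "q \<in> carrier G" for p q
    using gprod_translate[OF \<gamma> that] gprod_eq[OF that] len_le_D[OF \<gamma> that(1)] len_le_D[OF \<gamma> that(2)] len\<gamma>
    by simp
  have 1: "K \<le> gprod (inv \<gamma> \<otimes> a m) (inv \<gamma> \<otimes> a M)" if "M \<le> m" for m
  proof -
    have "min m M = M" using that by simp
    then show ?thesis using base[OF ca[of m] ca[of M]] ray_gprod_self_ge[OF ra, of m M] M(3) TB by simp
  qed
  have 2: "K \<le> gprod (inv \<gamma> \<otimes> b m) (inv \<gamma> \<otimes> b M)" if "M \<le> m" for m
  proof -
    have "min m M = M" using that by simp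
    then show ?thesis using base[OF cb[of m] cb[of M]] ray_gprod_self_ge[OF rb, of m M] M(3) TB by simp
  qed
  have \<gamma>h': "real (D \<gamma> h) \<le> real (len h) - real T + 2 * \<delta>"
    using \<gamma>h gprod_eq[OF \<gamma> h] len\<gamma> by simp
  have 3: "gprod (inv \<gamma> \<otimes> g) (inv \<gamma> \<otimes> h) \<le> 1 + \<delta>"
    using gprod_translate[OF \<gamma> g h] gprod_eq[OF g h] \<gamma>h' D\<gamma>g T(2) by simp
  have one: "gprod (inv \<gamma> \<otimes> p) (inv \<gamma>) = (real (D \<gamma> p) + real T - real (len p)) / 2"
    if "p \<in> carrier G" for p
    using gprod_translate[OF \<gamma> that one_closed] \<gamma> that len\<gamma> D_one D_commute[of _ \<one>] by simp
  have 4: "gprod (inv \<gamma> \<otimes> g) (inv \<gamma>) \<le> \<delta>" using one[OF g] D\<gamma>g \<delta>_nonneg by simp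
  have 5: "gprod (inv \<gamma> \<otimes> h) (inv \<gamma>) \<le> \<delta>" using one[OF h] \<gamma>h' by simp
  \<comment> \<open>The losses: 2 \<delta> from the choice of rays, \<delta> for passing through
    \<open>c m\<close> from \<open>g\<close> to \<open>h\<close>, 1 from rounding, and \<delta> for
    returning from \<open>g\<close> to \<open>c m\<close>.\<close>
  have 6: "R - 4 * \<delta> - 1 \<le> gprod \<gamma> (c m)" if m: "M \<le> m" for m
  proof -
    have cg: "R - 2 * \<delta> \<le> gprod (c m) g" and ch: "R - 2 * \<delta> \<le> gprod (c m) h"
      using M1[of m M] M2[of m M] M m unfolding g_def h_def by auto
    have "R - 2 * \<delta> - \<delta> \<le> gprod g h"
      using hyp_le[OF g cc[of m] h, of "R - 2 * \<delta>"] cg ch gprod_commute[OF g cc[of m]] by simp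
    then have "R - 3 * \<delta> - 1 \<le> gprod \<gamma> g" using T(2) \<gamma>g by linarith
    then have "R - 3 * \<delta> - 1 - \<delta> \<le> gprod \<gamma> (c m)"
      using hyp_le[OF \<gamma> g cc[of m], of "R - 3 * \<delta> - 1"] cg gprod_commute[OF g cc[of m]] \<delta>_nonneg by simp
    then show ?thesis by simp
  qed
  show ?thesis
    using that[OF \<gamma> 1 2 3[unfolded g_def h_def] 4[unfolded g_def] 5[unfolded h_def]] 6 by blast
qed

text \<open>Asymptotic limit rays would have products growing like \<open>n\<close>, and two
  applications of hyperbolicity would pass this growth on to \<open>g n\<close> and
  \<open>h n\<close>. It separates the limit points of the recentred triangle.\<close>

lemma not_asymptotic_if_gprod_bounded:
  assumes \<alpha>: "\<alpha> \<in> geodesic_rays G S" and \<beta>: "\<beta> \<in> geodesic_rays G S"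
    and g: "\<And>n. g n \<in> carrier G" "\<And>n. real n \<le> gprod (g n) (\<alpha> n)"
    and h: "\<And>n. h n \<in> carrier G" "\<And>n. real n \<le> gprod (h n) (\<beta> n)"
    and B: "\<And>n. gprod (g n) (h n) \<le> B"
  shows "(\<alpha>, \<beta>) \<notin> asymptotic G S"
proof
  assume "(\<alpha>, \<beta>) \<in> asymptotic G S"
  then obtain C where C: "\<And>n. D (\<alpha> n) (\<beta> n) \<le> C" unfolding asymptotic_def by blast
  define C' where "C' = real (len (\<alpha> 0) + len (\<beta> 0) + C)"
  have C': "0 \<le> C'" unfolding C'_def by simp
  note car = ray_carrier[OF \<alpha>] ray_carrier[OF \<beta>]
  have "real n - C' - 2 * \<delta> \<le> B" for n
  proof -
    have 1: "real n - C' \<le> gprod (\<alpha> n) (\<beta> n)"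
      using ray_gprod_ge[OF \<alpha> \<beta> C, of n n] unfolding C'_def by simp
    have "real n - C' - \<delta> \<le> gprod (g n) (\<beta> n)"
      by (rule hyp_le[OF g(1) car(1) car(2) _ 1]) (use g(2)[of n] C' in linarith)
    then have "real n - C' - \<delta> - \<delta> \<le> gprod (g n) (h n)"
      by (rule hyp_le[OF g(1) car(2) h(1)])
        (use h(2)[of n] C' \<delta>_nonneg gprod_commute[OF h(1) car(2), of n n] in linarith)
    then show ?thesis using B[of n] by linarith
  qed
  from this[of "nat \<lceil>B + C' + 2 * \<delta> + 1\<rceil>"] show False by linarith
qed

end

section \<open>Representations into the projective linear group\<close>

text \<open>Distinct exponents make this a subsum of the geometric series. It is applied to either
  side of the point of a geodesic nearest to \<one>.\<close>

lemma geometric_sum_inj_le: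
  fixes q :: real
  assumes "finite I" "inj_on f I" "0 < q" "q < 1"
  shows "(\<Sum>i\<in>I. q ^ f i) \<le> 1 / (1 - q)"
proof -
  have "(\<Sum>i\<in>I. q ^ f i) = (\<Sum>j\<in>f ` I. q ^ j)"
    using sum.reindex[OF assms(2), of "\<lambda>j. q ^ j"] by simp
  also have "\<dots> \<le> (\<Sum>j. q ^ j)"
    using assms by (intro sum_le_suminf summable_geometric) auto
  also have "\<dots> = 1 / (1 - q)" using assms by (intro suminf_geometric) simp
  finally show ?thesis .
qed

lemma ex_exp_decay_le:
  fixes C \<mu> \<epsilon> :: real
  assumes "0 < \<mu>" "0 < \<epsilon>"
  shows "\<exists>T. \<forall>t\<ge>T. C * exp (- \<mu> * t) \<le> \<epsilon>"
proof -
  \<comment> \<open>The added 1 keeps the logarithm well behaved when \<open>C = 0\<close>.\<close>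
  define T where "T = ln (\<bar>C\<bar> / \<epsilon> + 1) / \<mu>"
  have "C * exp (- \<mu> * t) \<le> \<epsilon>" if "T \<le> t" for t
  proof -
    have pos: "0 < \<bar>C\<bar> / \<epsilon> + 1" using assms(2) by (simp add: add_nonneg_pos)
    have "\<bar>C\<bar> / \<epsilon> + 1 = exp (\<mu> * T)" using pos assms(1) by (simp add: T_def)
    also have "\<dots> \<le> exp (\<mu> * t)" using that assms(1) by simp
    finally have "\<bar>C\<bar> \<le> \<epsilon> * exp (\<mu> * t)" using assms(2) by (simp add: field_simps)
    then have "C \<le> \<epsilon> * exp (\<mu> * t)" by linarith
    then show ?thesis by (simp add: exp_minus field_simps)
  qed
  then show ?thesis by blast
qed

lemma mat_mult_mat: "mat a ** mat b = (mat (a * b) :: 'k::field ^ 'n::finite ^ 'n)"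
  by (simp add: mat_mult_left) (simp add: mat_def vec_eq_iff)

lemma invertible_mat: "c \<noteq> 0 \<Longrightarrow> invertible (mat c :: 'k::field ^ 'n::finite ^ 'n)"
  unfolding invertible_def by (intro exI[of _ "mat (inverse c)"]) (simp add: mat_mult_mat)

locale projective_representation =
  word_metric_group G S + inner_product_form ip
  for G :: "('g, 'b) monoid_scheme" (structure)
    and S :: "'g set"
    and ip :: "('k::real_or_complex, 'n::finite) form" +
  fixes \<rho> :: "'g \<Rightarrow> ('k ^ 'n ^ 'n) set"
  assumes hom: "\<rho> \<in> hom G PGL"
begin

section \<open>Matrices representing group elements\<close>

lemma rep_coset:
  assumes "g \<in> carrier G"
  obtains A where "invertible A" "\<rho> g = {mat c ** A | c. c \<noteq> 0}"
proof -
  have "\<rho> g \<in> carrier PGL" using hom assms by (rule hom_in_carrier)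
  then obtain A where A: "A \<in> carrier GL" "\<rho> g = scalar_matrices #>\<^bsub>GL\<^esub> A"
    unfolding PGL_def FactGroup_def RCOSETS_def by auto
  have "\<rho> g = {mat c ** A | c. c \<noteq> 0}"
    unfolding A(2) r_coset_def scalar_matrices_def GL_def by auto
  then show ?thesis using that A(1) by (simp add: GL_def)
qed

lemma ex_rep: "g \<in> carrier G \<Longrightarrow> \<exists>A. A \<in> \<rho> g"
  using rep_coset[of g] by (metis (mono_tags, lifting) mem_Collect_eq zero_neq_one)

lemma rep_invertible: "g \<in> carrier G \<Longrightarrow> A \<in> \<rho> g \<Longrightarrow> invertible A"
  by (erule rep_coset) (auto intro: invertible_mult invertible_mat)

lemma rep_scalar_iff:
  assumes "g \<in> carrier G" "A \<in> \<rho> g"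
  shows "B \<in> \<rho> g \<longleftrightarrow> (\<exists>c. c \<noteq> 0 \<and> B = mat c ** A)"
proof -
  obtain A0 where A0: "\<rho> g = {mat c ** A0 | c. c \<noteq> 0}" using rep_coset[OF assms(1)] by blast
  then obtain a where a: "a \<noteq> 0" "A = mat a ** A0" using assms(2) by blast
  show ?thesis
  proof
    assume "B \<in> \<rho> g"
    then obtain b where b: "b \<noteq> 0" "B = mat b ** A0" using A0 by blast
    have "B = mat (b / a) ** A" using a b by (simp add: matrix_mul_assoc mat_mult_mat)
    then show "\<exists>c. c \<noteq> 0 \<and> B = mat c ** A" using a b by (intro exI[of _ "b / a"]) simp
  next
    assume "\<exists>c. c \<noteq> 0 \<and> B = mat c ** A"
    then obtain c where c: "c \<noteq> 0" "B = mat c ** A" by blast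
    have "B = mat (c * a) ** A0" "c * a \<noteq> 0" using a c by (simp_all add: matrix_mul_assoc mat_mult_mat)
    then show "B \<in> \<rho> g" unfolding A0 by blast
  qed
qed

lemma rep_mult:
  assumes "g \<in> carrier G" "h \<in> carrier G" "A \<in> \<rho> g" "B \<in> \<rho> h"
  shows "A ** B \<in> \<rho> (g \<otimes> h)"
proof -
  have "\<rho> (g \<otimes> h) = \<rho> g <#>\<^bsub>GL\<^esub> \<rho> h"
    using hom_mult[OF hom assms(1,2)] by (simp add: PGL_def FactGroup_def)
  then show ?thesis using assms(3,4) unfolding set_mult_def GL_def by auto
qed

text \<open>The class of \<one> is idempotent: \<open>A ** A\<close> and \<open>A\<close> differ by
  a scalar, and cancelling \<open>A\<close> leaves that scalar.\<close>

lemma rep_one: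
  assumes "A \<in> \<rho> \<one>"
  shows "\<exists>c. c \<noteq> 0 \<and> A = mat c"
proof -
  have "A ** A \<in> \<rho> \<one>" using rep_mult[OF one_closed one_closed assms assms] by simp
  then obtain c where c: "c \<noteq> 0" "A ** A = mat c ** A" using rep_scalar_iff[OF one_closed assms] by blast
  obtain B where "A ** B = mat 1" using rep_invertible[OF one_closed assms] unfolding invertible_def by blast
  then have "A = mat c"
    using arg_cong[OF c(2), of "\<lambda>M. M ** B"] by (simp add: matrix_mul_assoc[symmetric])
  then show ?thesis using c by blast
qed

text \<open>A representative of \<open>inv g\<close> inverts \<open>A\<close> only up to a scalar,
  which is absorbed by rescaling within the coset.\<close>

lemma rep_inverse:
  assumes g: "g \<in> carrier G" "A \<in> \<rho> g"
  obtains B where "B \<in> \<rho> (inv g)" "A ** B = mat 1" "B ** A = mat 1"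
proof -
  have ig: "inv g \<in> carrier G" using g by simp
  obtain C where C: "C \<in> \<rho> (inv g)" using ex_rep[OF ig] by blast
  have "A ** C \<in> \<rho> \<one>" using rep_mult[OF g(1) ig g(2) C] g by simp
  then obtain c where c: "c \<noteq> 0" "A ** C = mat c" using rep_one by blast
  define B where "B = mat (1 / c) ** C"
  have B: "B \<in> \<rho> (inv g)" unfolding B_def rep_scalar_iff[OF ig C] using c(1) by (intro exI[of _ "1 / c"]) simp
  have "A ** mat (1 / c) = mat (1 / c) ** A" by (simp add: mat_mult_left mat_mult_right)
  then have "A ** B = mat (1 / c) ** (A ** C)" unfolding B_def by (simp add: matrix_mul_assoc)
  then have AB: "A ** B = mat 1" using c by (simp add: mat_mult_mat)
  then show ?thesis using that B matrix_left_right_inverse[of A B] by simp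
qed

lemma rep_conditioned:
  assumes "g \<in> carrier G"
  shows "\<exists>K. \<forall>M\<in>\<rho> g. conditioned K M"
proof -
  obtain A where A: "A \<in> \<rho> g" using ex_rep[OF assms] by blast
  obtain K where K: "conditioned K A" using ex_conditioned[OF rep_invertible[OF assms A]] by blast
  have "conditioned K M" if "M \<in> \<rho> g" for M
    using that conditioned_scalar[OF K] unfolding rep_scalar_iff[OF assms A] by blast
  then show ?thesis by blast
qed

text \<open>The identity is included so that a step may also replace one representative of a group
  element by another.\<close>

lemma generators_conditioned: "\<exists>K>0. \<forall>s\<in>insert \<one> S. \<forall>M\<in>\<rho> s. conditioned K M"
proof -
  have "\<forall>s\<in>insert \<one> S. \<exists>K. \<forall>M\<in>\<rho> s. conditioned K M" using rep_conditioned S_carrier by blast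
  then obtain K where K: "\<forall>s\<in>insert \<one> S. \<forall>M\<in>\<rho> s. conditioned (K s) M" by (rule bchoice[THEN exE])
  define K' where "K' = Max (K ` insert \<one> S)"
  have "K s \<le> K'" if "s \<in> insert \<one> S" for s unfolding K'_def using finite_S that by (intro Max_ge) auto
  then have "\<forall>s\<in>insert \<one> S. \<forall>M\<in>\<rho> s. conditioned K' M" using K conditioned_mono by blast
  moreover obtain M where "M \<in> \<rho> \<one>" using ex_rep[OF one_closed] by blast
  ultimately show ?thesis unfolding conditioned_def by blast
qed

text \<open>The gap of \<rho>(g) at d - r is the gap of \<rho>(g) inverse at r, and word length is
  invariant under inversion. It provides the boundary map in dimension d - r.\<close>

lemma anosov_dual:
  assumes "anosov G S ip \<rho> r" and r: "r \<in> {1..CARD('n) - 1}"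
  shows "anosov G S ip \<rho> (CARD('n) - r)"
proof -
  obtain c \<mu> where c: "c > 0" "\<mu> > 0" "\<And>g A. g \<in> carrier G \<Longrightarrow> A \<in> \<rho> g \<Longrightarrow>
      singular_value ip (r + 1) A / singular_value ip r A \<le> c * exp (- \<mu> * real (len g))"
    using assms(1) unfolding anosov_def by blast
  have "singular_value ip (CARD('n) - r + 1) A / singular_value ip (CARD('n) - r) A
      \<le> c * exp (- \<mu> * real (len g))" if g: "g \<in> carrier G" "A \<in> \<rho> g" for g A
  proof -
    obtain B where B: "B \<in> \<rho> (inv g)" "A ** B = mat 1" "B ** A = mat 1" using rep_inverse[OF g] by blast
    note invB = rep_invertible[OF inv_closed[OF g(1)] B(1)]
    have rr: "r \<in> {1..CARD('n)}" "r + 1 \<in> {1..CARD('n)}" using r by auto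
    have eq: "CARD('n) + 1 - r = CARD('n) - r + 1" "CARD('n) + 1 - (r + 1) = CARD('n) - r" using r by auto
    have "singular_value ip (CARD('n) - r + 1) A = 1 / singular_value ip r B"
      "singular_value ip (CARD('n) - r) A = 1 / singular_value ip (r + 1) B"
      using singular_value_inverse[OF invB B(2) rr(1)] singular_value_inverse[OF invB B(2) rr(2)]
      unfolding eq by simp_all
    then show ?thesis using c(3)[OF inv_closed[OF g(1)] B(1)] len_inv[OF g(1)] by simp
  qed
  then show ?thesis unfolding anosov_def using c(1,2) by blast
qed

section \<open>Axes along sequences in the group, for one Anosov index\<close>

context
  fixes k :: nat
  assumes anosov: "anosov G S ip \<rho> k" and k: "1 \<le> k" "k + 1 \<le> CARD('n)"
begin

lemma rep_axes_grassmannian: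
  "g \<in> carrier G \<Longrightarrow> A \<in> \<rho> g \<Longrightarrow> longest_axes_span ip k A \<in> grassmannian k"
  using longest_axes_span_grassmannian[OF rep_invertible] k by simp

lemma ratio_small:
  assumes "0 < \<epsilon>"
  shows "\<exists>T. \<forall>g\<in>carrier G. \<forall>A\<in>\<rho> g. T \<le> real (len g) \<longrightarrow>
    singular_value ip (k + 1) A / singular_value ip k A \<le> \<epsilon>"
proof -
  obtain c \<mu> where c: "c > 0" "\<mu> > 0" "\<And>g A. g \<in> carrier G \<Longrightarrow> A \<in> \<rho> g \<Longrightarrow>
      singular_value ip (k + 1) A / singular_value ip k A \<le> c * exp (- \<mu> * real (len g))"
    using anosov unfolding anosov_def by blast
  obtain T where "\<forall>t\<ge>T. c * exp (- \<mu> * t) \<le> \<epsilon>" using ex_exp_decay_le[OF c(2) assms] by blast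
  then show ?thesis using c(3) by (meson order_trans)
qed

text \<open>Two representatives differ by a right factor representing a generator or \<one>.
  Finitely many such factors share one conditioning constant, so the perturbation estimate inherits
  the exponential decay of the gap.\<close>

lemma axes_step:
  obtains C \<mu> where "0 < C" "0 < \<mu>"
    "\<And>g s A B. g \<in> carrier G \<Longrightarrow> s \<in> insert \<one> S \<Longrightarrow> A \<in> \<rho> g \<Longrightarrow> B \<in> \<rho> (g \<otimes> s) \<Longrightarrow>
      near (C * exp (- \<mu> * real (len g))) (longest_axes_span ip k A) (longest_axes_span ip k B)"
proof -
  obtain c \<mu> where c: "c > 0" "\<mu> > 0" "\<And>g A. g \<in> carrier G \<Longrightarrow> A \<in> \<rho> g \<Longrightarrow>
      singular_value ip (k + 1) A / singular_value ip k A \<le> c * exp (- \<mu> * real (len g))"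
    using anosov unfolding anosov_def by blast
  obtain K where K: "K > 0" "\<And>s M. s \<in> insert \<one> S \<Longrightarrow> M \<in> \<rho> s \<Longrightarrow> conditioned K M"
    using generators_conditioned by blast
  have "near (K * c * exp (- \<mu> * real (len g))) (longest_axes_span ip k A) (longest_axes_span ip k B)"
    if g: "g \<in> carrier G" and s: "s \<in> insert \<one> S" and A: "A \<in> \<rho> g" and B: "B \<in> \<rho> (g \<otimes> s)" for g s A B
  proof -
    have sc: "s \<in> carrier G" using s S_carrier by auto
    have gs: "g \<otimes> s \<in> carrier G" using g sc by simp
    obtain A' where A': "A' \<in> \<rho> (inv g)" "A ** A' = mat 1" "A' ** A = mat 1" using rep_inverse[OF g A] by blast
    define M where "M = A' ** B"
    have "M \<in> \<rho> (inv g \<otimes> (g \<otimes> s))" unfolding M_def using g by (intro rep_mult gs A' B) simp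
    then have M: "M \<in> \<rho> s" using inv_mult_cancel[OF g sc] by simp
    have BM: "B = A ** M" unfolding M_def by (simp add: matrix_mul_assoc A')
    have "near (K * (singular_value ip (k + 1) A / singular_value ip k A))
        (longest_axes_span ip k B) (longest_axes_span ip k A)"
      unfolding BM by (rule longest_axes_span_mult_right[OF rep_invertible[OF g A]
          rep_invertible[OF sc M] K(2)[OF s M] k])
    moreover have "K * (singular_value ip (k + 1) A / singular_value ip k A) \<le> K * c * exp (- \<mu> * real (len g))"
      using c(3)[OF g A] K(1) by (simp only: mult.assoc mult_left_mono less_imp_le)
    ultimately have "near (K * c * exp (- \<mu> * real (len g))) (longest_axes_span ip k B) (longest_axes_span ip k A)"
      by (rule near_mono)
    then show ?thesis
      by (rule near_sym_gr[OF _ rep_axes_grassmannian[OF gs B] rep_axes_grassmannian[OF g A]])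
        (use c K in simp)
  qed
  then show ?thesis using that[of "K * c" \<mu>] c K by simp
qed

text \<open>Along a geodesic \<open>u\<close> from \<open>g\<close> to \<open>h\<close> one has \<open>|u j| \<ge> (g|h) + |j - j\<^sub>0|\<close> with
  \<open>j\<^sub>0 = |g| - (g|h)\<close>, so the distances between consecutive \<open>U\<^sub>k\<close> add up to \<open>O(e\<^bsup>-\<mu>(g|h)\<^esup>)\<close>.\<close>

lemma axes_exp_close:
  obtains C \<mu> where "0 < C" "0 < \<mu>"
    "\<And>g h A B. g \<in> carrier G \<Longrightarrow> h \<in> carrier G \<Longrightarrow> A \<in> \<rho> g \<Longrightarrow> B \<in> \<rho> h \<Longrightarrow>
      near (C * exp (- \<mu> * gprod g h)) (longest_axes_span ip k A) (longest_axes_span ip k B)"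
proof -
  obtain C \<mu> where C: "0 < C" "0 < \<mu>"
    "\<And>g s A B. g \<in> carrier G \<Longrightarrow> s \<in> insert \<one> S \<Longrightarrow> A \<in> \<rho> g \<Longrightarrow> B \<in> \<rho> (g \<otimes> s) \<Longrightarrow>
      near (C * exp (- \<mu> * real (len g))) (longest_axes_span ip k A) (longest_axes_span ip k B)"
    using axes_step by blast
  define q where "q = exp (- \<mu>)"
  have q: "0 < q" "q < 1" using C(2) by (simp_all add: q_def)
  have main: "near (C * (2 / (1 - q)) * exp (- \<mu> * gprod g h))
      (longest_axes_span ip k A) (longest_axes_span ip k B)"
    if g: "g \<in> carrier G" and h: "h \<in> carrier G" and A: "A \<in> \<rho> g" and B: "B \<in> \<rho> h" for g h A B
  proof -
    define n where "n = D g h"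
    have "inv g \<otimes> h \<in> carrier G" using g h by simp
    then obtain v where v: "\<And>i. v i \<in> carrier G" "v 0 = \<one>" "v n = inv g \<otimes> h"
      "\<And>i j. i \<le> j \<Longrightarrow> j \<le> n \<Longrightarrow> D (v i) (v j) = j - i"
      "\<And>i. i < n \<Longrightarrow> \<exists>s\<in>S. v (Suc i) = v i \<otimes> s"
      using ex_geodesic unfolding n_def word_dist_def by metis
    define u where "u i = g \<otimes> v i" for i
    have u: "u i \<in> carrier G" for i unfolding u_def using g v(1) by simp
    have u0: "u 0 = g" and un: "u n = h" using g h v(2,3) by (simp_all add: u_def inv_mult_cancel)
    have uD: "D (u i) (u j) = j - i" if "i \<le> j" "j \<le> n" for i j
      unfolding u_def using v(4)[OF that] D_translate[OF g v(1) v(1)] by simp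
    have us: "\<exists>s\<in>S. u (Suc i) = u i \<otimes> s" if "i < n" for i
      using v(5)[OF that] g v(1) S_carrier unfolding u_def by (metis m_assoc)
    obtain E' where E': "\<And>i. E' i \<in> \<rho> (u i)" using ex_rep[OF u] by metis
    \<comment> \<open>The path must start at the prescribed representative \<open>A\<close>, not
      just at some representative of \<open>g\<close>.\<close>
    define E where "E = E'(0 := A)"
    have E: "E i \<in> \<rho> (u i)" "E 0 = A" for i using E' A u0 by (simp_all add: E_def)
    have path: "near (\<Sum>j<i. C * exp (- \<mu> * real (len (u j)))) (longest_axes_span ip k A)
        (longest_axes_span ip k (E i))" if "i \<le> n" for i
      using that
    proof (induction i)
      case 0
      have "\<exists>w\<in>longest_axes_span ip k A. N (v - w) \<le> 0 * N v" if "v \<in> longest_axes_span ip k A" for v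
        using that by (intro bexI[of _ v]) simp
      then show ?case unfolding E(2) by (intro nearI) simp
    next
      case (Suc i)
      obtain s where s: "s \<in> S" "u (Suc i) = u i \<otimes> s" using us[of i] Suc.prems by auto
      have "near (C * exp (- \<mu> * real (len (u i)))) (longest_axes_span ip k (E i)) (longest_axes_span ip k (E (Suc i)))"
        using E(1)[of "Suc i"] s by (intro C(3)[OF u _ E(1), of s]) auto
      then have "near ((\<Sum>j<i. C * exp (- \<mu> * real (len (u j)))) + C * exp (- \<mu> * real (len (u i))))
          (longest_axes_span ip k A) (longest_axes_span ip k (E (Suc i)))"
        using Suc C(1) by (intro near_trans[OF _ _ grassmannian_subspace[OF rep_axes_grassmannian[OF u E(1)]]]) auto
      then show ?case by simp
    qed
    \<comment> \<open>A last step by \<one> exchanges the representative \<open>E n\<close> of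
      \<open>h\<close> for the prescribed \<open>B\<close>.\<close>
    have "near (C * exp (- \<mu> * real (len (u n)))) (longest_axes_span ip k (E n)) (longest_axes_span ip k B)"
      using B un h by (intro C(3)[OF u _ E(1), of \<one>]) auto
    then have "near ((\<Sum>j<n. C * exp (- \<mu> * real (len (u j)))) + C * exp (- \<mu> * real (len (u n))))
        (longest_axes_span ip k A) (longest_axes_span ip k B)"
      using path[of n] C(1) by (intro near_trans[OF _ _ grassmannian_subspace[OF rep_axes_grassmannian[OF u E(1)]]]) auto
    moreover have "(\<Sum>j<n. C * exp (- \<mu> * real (len (u j)))) + C * exp (- \<mu> * real (len (u n)))
        = C * (\<Sum>j\<le>n. exp (- \<mu> * real (len (u j))))"
      by (simp add: lessThan_Suc_atMost[symmetric] sum_distrib_left distrib_left)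
    ultimately have near: "near (C * (\<Sum>j\<le>n. exp (- \<mu> * real (len (u j)))))
        (longest_axes_span ip k A) (longest_axes_span ip k B)" by simp
    define P where "P = gprod g h"
    \<comment> \<open>The turning time, rounded down: up to \<open>t\<close> the length is bounded
      below by comparison with \<open>g\<close>, afterwards by comparison with
      \<open>h\<close>.\<close>
    define t where "t = nat \<lfloor>real (len g) - P\<rfloor>"
    have P: "2 * P = real (len g) + real (len h) - real n" unfolding P_def n_def by (simp add: gprod_eq g h)
    have t: "real t \<le> real (len g) - P" "real (len g) - P \<le> real t + 1"
      using gprod_le_len(1)[OF g h] unfolding t_def P_def by linarith+
    have expq: "exp (- \<mu> * (P + real i)) = exp (- \<mu> * P) * q ^ i" for i
      by (simp add: q_def exp_of_nat_mult[symmetric] exp_add[symmetric] algebra_simps)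
    have 1: "exp (- \<mu> * real (len (u j))) \<le> exp (- \<mu> * P) * q ^ (t - j)" if j: "j \<le> n" "j \<le> t" for j
    proof -
      have "len g \<le> len (u j) + j"
        using len_le_D[OF u g, of j] uD[of 0 j] j D_commute[OF g u, of j] unfolding u0 by simp
      then have "P + real (t - j) \<le> real (len (u j))" using t(1) j by linarith
      then show ?thesis unfolding expq[symmetric] using C(2) by simp
    qed
    \<comment> \<open>Rounding costs one unit on this side, hence \<open>Suc t\<close>; the
      exponents still start at 0 because \<open>t < j\<close>.\<close>
    have 2: "exp (- \<mu> * real (len (u j))) \<le> exp (- \<mu> * P) * q ^ (j - Suc t)" if j: "j \<le> n" "t < j" for j
    proof -
      have "len h \<le> len (u j) + (n - j)"
        using len_le_D[OF u h, of j] uD[of j n] j unfolding un by simp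
      then have "P + real (j - Suc t) \<le> real (len (u j))" using t(2) j P by linarith
      then show ?thesis unfolding expq[symmetric] using C(2) by simp
    qed
    have split: "{..n} = {j. j \<le> n \<and> j \<le> t} \<union> {j. j \<le> n \<and> t < j}" by auto
    have fin: "finite {j. j \<le> n \<and> j \<le> t}" "finite {j. j \<le> n \<and> t < j}" by simp_all
    have "(\<Sum>j\<le>n. exp (- \<mu> * real (len (u j))))
        = (\<Sum>j | j \<le> n \<and> j \<le> t. exp (- \<mu> * real (len (u j)))) + (\<Sum>j | j \<le> n \<and> t < j. exp (- \<mu> * real (len (u j))))"
      unfolding split by (rule sum.union_disjoint) auto
    also have "\<dots> \<le> (\<Sum>j | j \<le> n \<and> j \<le> t. exp (- \<mu> * P) * q ^ (t - j))
        + (\<Sum>j | j \<le> n \<and> t < j. exp (- \<mu> * P) * q ^ (j - Suc t))"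
      using 1 2 by (intro add_mono sum_mono) auto
    also have "\<dots> = exp (- \<mu> * P) * ((\<Sum>j | j \<le> n \<and> j \<le> t. q ^ (t - j)) + (\<Sum>j | j \<le> n \<and> t < j. q ^ (j - Suc t)))"
      by (simp only: sum_distrib_left distrib_left)
    also have "\<dots> \<le> exp (- \<mu> * P) * (1 / (1 - q) + 1 / (1 - q))"
      using q fin by (intro mult_left_mono add_mono geometric_sum_inj_le) (auto simp: inj_on_def)
    also have "\<dots> = 2 / (1 - q) * exp (- \<mu> * P)" by (simp add: mult.commute)
    finally have "C * (\<Sum>j\<le>n. exp (- \<mu> * real (len (u j)))) \<le> C * (2 / (1 - q) * exp (- \<mu> * P))"
      using C(1) by (intro mult_left_mono) auto
    with near show ?thesis unfolding P_def mult.assoc by (rule near_mono)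
  qed
  show ?thesis by (rule that[OF _ C(2) main]) (use C(1) q in simp)
qed

lemma axes_close:
  assumes "0 < \<epsilon>"
  shows "\<exists>T. \<forall>g\<in>carrier G. \<forall>h\<in>carrier G. \<forall>A\<in>\<rho> g. \<forall>B\<in>\<rho> h. T \<le> gprod g h \<longrightarrow>
    near \<epsilon> (longest_axes_span ip k A) (longest_axes_span ip k B)"
proof -
  obtain C \<mu> where C: "0 < C" "0 < \<mu>"
    "\<And>g h A B. g \<in> carrier G \<Longrightarrow> h \<in> carrier G \<Longrightarrow> A \<in> \<rho> g \<Longrightarrow> B \<in> \<rho> h \<Longrightarrow>
      near (C * exp (- \<mu> * gprod g h)) (longest_axes_span ip k A) (longest_axes_span ip k B)"
    using axes_exp_close by blast
  obtain T where "\<forall>t\<ge>T. C * exp (- \<mu> * t) \<le> \<epsilon>" using ex_exp_decay_le[OF C(2) assms] by blast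
  then show ?thesis using near_mono[OF C(3)] by blast
qed

subsection \<open>The boundary map\<close>

text \<open>Gromov products along rays of one class tend to infinity, so \<open>axes_close\<close>
  makes the axes Cauchy, with a limit independent of ray and representatives. This gives the
  definite description in \<open>boundary_map\<close> its value.\<close>

lemma
  assumes x: "x \<in> gromov_boundary G S"
  shows boundary_map_grassmannian: "boundary_map ip \<rho> k x \<in> grassmannian k"
    and boundary_map_gr_limit: "a \<in> x \<Longrightarrow> (\<And>n. A n \<in> \<rho> (a n)) \<Longrightarrow>
      gr_limit (\<lambda>n. longest_axes_span ip k (A n)) (boundary_map ip \<rho> k x)"
proof -
  let ?U = "longest_axes_span ip k"
  obtain a where a: "a \<in> x" using boundary_nonempty[OF x] by blast
  have car: "b n \<in> carrier G" if "b \<in> x" for b n using ray_carrier[OF boundary_ray[OF x that]] .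
  obtain A where A: "\<And>n. A n \<in> \<rho> (a n)" using ex_rep[OF car[OF a]] by metis
  have close: "\<exists>M. \<forall>m\<ge>M. \<forall>n\<ge>M. near \<epsilon> (?U (B m)) (?U (A n))"
    if \<epsilon>: "0 < \<epsilon>" and b: "b \<in> x" and B: "\<And>n. B n \<in> \<rho> (b n)" for \<epsilon> b B
  proof -
    obtain T where T: "\<forall>g\<in>carrier G. \<forall>h\<in>carrier G. \<forall>A\<in>\<rho> g. \<forall>B\<in>\<rho> h. T \<le> gprod g h \<longrightarrow> near \<epsilon> (?U A) (?U B)"
      using axes_close[OF \<epsilon>] by blast
    obtain C where C: "\<And>m n. real (min m n) - C \<le> gprod (b m) (a n)"
      using boundary_gprod_ge[OF x b a] by blast
    have "near \<epsilon> (?U (B m)) (?U (A n))" if "nat \<lceil>T + C\<rceil> \<le> m" "nat \<lceil>T + C\<rceil> \<le> n" for m n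
    proof -
      have "T \<le> gprod (b m) (a n)" using C[of m n] that by linarith
      then show ?thesis using T car[OF a] car[OF b] A B by blast
    qed
    then show ?thesis by blast
  qed
  have grA: "?U (A n) \<in> grassmannian k" for n by (rule rep_axes_grassmannian[OF car[OF a] A])
  obtain V where V: "V \<in> grassmannian k" "gr_limit (\<lambda>n. ?U (A n)) V"
    using gr_complete[of "\<lambda>n. ?U (A n)", OF grA close[OF _ a A]] by blast
  have lim: "gr_limit (\<lambda>n. ?U (B n)) V" if b: "b \<in> x" and B: "\<And>n. B n \<in> \<rho> (b n)" for b B
    unfolding gr_limit_def
  proof (intro allI impI)
    fix \<epsilon> :: real assume \<epsilon>: "0 < \<epsilon>"
    obtain M1 where M1: "\<And>m n. M1 \<le> m \<Longrightarrow> M1 \<le> n \<Longrightarrow> near (\<epsilon> / 2) (?U (B m)) (?U (A n))"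
      using close[OF half_gt_zero[OF \<epsilon>] b B] by blast
    obtain M2 where M2: "\<And>n. M2 \<le> n \<Longrightarrow> near (\<epsilon> / 2) (?U (A n)) V"
      using gr_limitD[OF V(2) half_gt_zero[OF \<epsilon>]] by blast
    have "near (\<epsilon> / 2 + \<epsilon> / 2) (?U (B n)) V" if "max M1 M2 \<le> n" for n
      using M1[of n n] M2[of n] that \<epsilon> by (intro near_trans[OF _ _ grassmannian_subspace[OF grA]]) auto
    then show "\<exists>M. \<forall>n\<ge>M. near \<epsilon> (?U (B n)) V" by (intro exI[of _ "max M1 M2"]) simp
  qed
  have iff: "gr_limit (\<lambda>n. ?U (B n)) W \<longleftrightarrow> (\<lambda>n. subspace_dist ip (?U (B n)) W) \<longlonglongrightarrow> 0"
    if "W \<in> grassmannian k" "b \<in> x" "\<And>n. B n \<in> \<rho> (b n)" for W b B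
    by (rule gr_limit_iff_subspace_dist[OF k(1)]) (use that rep_axes_grassmannian car in blast)+
  have eq: "boundary_map ip \<rho> k x = V"
    unfolding boundary_map_def
  proof (rule the_equality)
    show "V \<in> grassmannian k \<and> (\<forall>a\<in>x. \<forall>A. (\<forall>n. A n \<in> \<rho> (a n)) \<longrightarrow>
        (\<lambda>n. subspace_dist ip (?U (A n)) V) \<longlonglongrightarrow> 0)"
      using V(1) lim iff[OF V(1)] by blast
    fix W assume W: "W \<in> grassmannian k \<and> (\<forall>a\<in>x. \<forall>A. (\<forall>n. A n \<in> \<rho> (a n)) \<longrightarrow>
        (\<lambda>n. subspace_dist ip (?U (A n)) W) \<longlonglongrightarrow> 0)"
    then have "gr_limit (\<lambda>n. ?U (A n)) W" using iff[of W a A] a A by blast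
    then show "W = V" using gr_limit_unique[of "\<lambda>n. ?U (A n)", OF grA _ V(1) _ V(2)] W by blast
  qed
  show "boundary_map ip \<rho> k x \<in> grassmannian k" unfolding eq by (rule V)
  show "gr_limit (\<lambda>n. ?U (A n)) (boundary_map ip \<rho> k x)" if "a \<in> x" "\<And>n. A n \<in> \<rho> (a n)"
    for a A unfolding eq by (rule lim[OF that])
qed

text \<open>Extends the defining limit from points on a ray to all group elements approaching
  \<open>x\<close>; the threshold is uniform in \<open>g\<close>. It is meant for the coarse
  centres, which lie on no fixed ray.\<close>

lemma axes_near_boundary_map:
  assumes x: "x \<in> gromov_boundary G S" "c \<in> x" and \<epsilon>: "0 < \<epsilon>"
  shows "\<exists>T. \<forall>g\<in>carrier G. \<forall>A\<in>\<rho> g. (\<exists>M. \<forall>m\<ge>M. T \<le> gprod g (c m)) \<longrightarrow>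
    near \<epsilon> (longest_axes_span ip k A) (boundary_map ip \<rho> k x)"
proof -
  let ?U = "longest_axes_span ip k"
  have car: "c n \<in> carrier G" for n using ray_carrier[OF boundary_ray[OF x]] .
  obtain E where E: "\<And>n. E n \<in> \<rho> (c n)" using ex_rep[OF car] by metis
  obtain T where T: "\<And>g h A B. g \<in> carrier G \<Longrightarrow> h \<in> carrier G \<Longrightarrow> A \<in> \<rho> g \<Longrightarrow> B \<in> \<rho> h \<Longrightarrow>
      T \<le> gprod g h \<Longrightarrow> near (\<epsilon> / 2) (?U A) (?U B)"
    using axes_close[OF half_gt_zero[OF \<epsilon>]] by blast
  obtain M2 where M2: "\<And>n. M2 \<le> n \<Longrightarrow> near (\<epsilon> / 2) (?U (E n)) (boundary_map ip \<rho> k x)"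
    using gr_limitD[OF boundary_map_gr_limit[OF x E] half_gt_zero[OF \<epsilon>]] by blast
  have "near \<epsilon> (?U A) (boundary_map ip \<rho> k x)"
    if g: "g \<in> carrier G" "A \<in> \<rho> g" and M: "\<forall>m\<ge>M. T \<le> gprod g (c m)" for g A M
  proof -
    define m where "m = max M M2"
    have "near (\<epsilon> / 2) (?U A) (?U (E m))" using M by (intro T[OF g(1) car g(2) E]) (simp add: m_def)
    then have "near (\<epsilon> / 2 + \<epsilon> / 2) (?U A) (boundary_map ip \<rho> k x)"
      using M2[of m] \<epsilon> by (intro near_trans[OF _ _ grassmannian_subspace[OF rep_axes_grassmannian[OF car E]]])
        (auto simp: m_def)
    then show ?thesis by simp
  qed
  then show ?thesis by blast
qed

text \<open>Here a bound at a single index \<open>i\<close> suffices, \<alpha> \<open>i\<close>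
  serving as intermediate point. Subconvergence to a limit ray provides information in exactly this
  form.\<close>

lemma axes_near_boundary_map_ray:
  assumes \<alpha>: "\<alpha> \<in> geodesic_rays G S" and \<epsilon>: "0 < \<epsilon>"
  shows "\<exists>T. \<forall>g\<in>carrier G. \<forall>A\<in>\<rho> g. \<forall>i. T \<le> real i \<and> real i \<le> gprod g (\<alpha> i) \<longrightarrow>
    near \<epsilon> (longest_axes_span ip k A) (boundary_map ip \<rho> k (asymptotic G S `` {\<alpha>}))"
proof -
  let ?U = "longest_axes_span ip k"
  let ?\<xi> = "boundary_map ip \<rho> k (asymptotic G S `` {\<alpha>})"
  have car: "\<alpha> n \<in> carrier G" for n using ray_carrier[OF \<alpha>] .
  obtain E where E: "\<And>n. E n \<in> \<rho> (\<alpha> n)" using ex_rep[OF car] by metis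
  obtain T where T: "\<And>g h A B. g \<in> carrier G \<Longrightarrow> h \<in> carrier G \<Longrightarrow> A \<in> \<rho> g \<Longrightarrow> B \<in> \<rho> h \<Longrightarrow>
      T \<le> gprod g h \<Longrightarrow> near (\<epsilon> / 2) (?U A) (?U B)"
    using axes_close[OF half_gt_zero[OF \<epsilon>]] by blast
  obtain M2 where M2: "\<And>n. M2 \<le> n \<Longrightarrow> near (\<epsilon> / 2) (?U (E n)) ?\<xi>"
    using gr_limitD[OF boundary_map_gr_limit[OF ray_class[OF \<alpha>] E] half_gt_zero[OF \<epsilon>]] by blast
  have "near \<epsilon> (?U A) ?\<xi>"
    if g: "g \<in> carrier G" "A \<in> \<rho> g" and i: "max T (real M2) \<le> real i" "real i \<le> gprod g (\<alpha> i)" for g A i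
  proof -
    have "near (\<epsilon> / 2) (?U A) (?U (E i))" using i by (intro T[OF g(1) car g(2) E]) simp
    then have "near (\<epsilon> / 2 + \<epsilon> / 2) (?U A) ?\<xi>"
      using M2[of i] i \<epsilon> by (intro near_trans[OF _ _ grassmannian_subspace[OF rep_axes_grassmannian[OF car E]]]) auto
    then show ?thesis by simp
  qed
  then show ?thesis by blast
qed

text \<open>A form of equivariance: \<open>\<rho>(\<gamma>)\<^sup>-\<^sup>1 \<xi>(w)\<close> is the limit of the axes along the translated ray, and
  the threshold \<open>T\<close> does not depend on \<open>\<gamma>\<close>.\<close>

lemma translated_boundary_map_near_axes:
  assumes \<epsilon>: "0 < \<epsilon>"
  obtains T where "\<And>w a \<gamma> C h H M. w \<in> gromov_boundary G S \<Longrightarrow> a \<in> w \<Longrightarrow> \<gamma> \<in> carrier G \<Longrightarrow> C \<in> \<rho> \<gamma> \<Longrightarrow>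
    h \<in> carrier G \<Longrightarrow> H \<in> \<rho> h \<Longrightarrow> \<forall>m\<ge>M. T \<le> gprod (\<gamma> \<otimes> a m) h \<Longrightarrow>
    near \<epsilon> ((*v) C ` boundary_map ip \<rho> k w) (longest_axes_span ip k H)"
proof -
  let ?U = "longest_axes_span ip k"
  have \<epsilon>3: "0 < \<epsilon> / 3" using \<epsilon> by simp
  obtain T where T: "\<And>g h A B. g \<in> carrier G \<Longrightarrow> h \<in> carrier G \<Longrightarrow> A \<in> \<rho> g \<Longrightarrow> B \<in> \<rho> h \<Longrightarrow>
      T \<le> gprod g h \<Longrightarrow> near (\<epsilon> / 3) (?U A) (?U B)"
    using axes_close[OF \<epsilon>3] by blast
  have main: "near \<epsilon> ((*v) C ` boundary_map ip \<rho> k w) (?U H)"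
    if w: "w \<in> gromov_boundary G S" "a \<in> w" and \<gamma>: "\<gamma> \<in> carrier G" "C \<in> \<rho> \<gamma>"
      and h: "h \<in> carrier G" "H \<in> \<rho> h" and M: "\<forall>m\<ge>M. T \<le> gprod (\<gamma> \<otimes> a m) h" for w a \<gamma> C h H M
  proof -
    let ?\<xi> = "boundary_map ip \<rho> k w"
    note ray = boundary_ray[OF w]
    have car: "a n \<in> carrier G" for n using ray_carrier[OF ray] .
    have car': "\<gamma> \<otimes> a n \<in> carrier G" for n using car \<gamma> by simp
    obtain A where A: "\<And>n. A n \<in> \<rho> (a n)" using ex_rep[OF car] by metis
    have CA: "C ** A n \<in> \<rho> (\<gamma> \<otimes> a n)" for n by (rule rep_mult[OF \<gamma>(1) car \<gamma>(2) A])
    note invC = rep_invertible[OF \<gamma>]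
    obtain K where K: "conditioned K C" using ex_conditioned[OF invC] by blast
    then have K0: "0 < K" unfolding conditioned_def by blast
    \<comment> \<open>The precision depends on the conditioning of \<open>C\<close> and hence on
      \<gamma>. It only affects how far out \<open>m\<close> is chosen, not the threshold
      \<open>T\<close>.\<close>
    define \<epsilon>' where "\<epsilon>' = \<epsilon> / 3 / K"
    have \<epsilon>': "0 < \<epsilon>'" "K * \<epsilon>' = \<epsilon> / 3" unfolding \<epsilon>'_def using \<epsilon> K0 by simp_all
    obtain M1 where M1: "\<And>n. M1 \<le> n \<Longrightarrow> near \<epsilon>' (?U (A n)) ?\<xi>"
      using gr_limitD[OF boundary_map_gr_limit[OF w A] \<epsilon>'(1)] by blast
    obtain T' where T': "\<And>g A. g \<in> carrier G \<Longrightarrow> A \<in> \<rho> g \<Longrightarrow> T' \<le> real (len g) \<Longrightarrow>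
        singular_value ip (k + 1) A / singular_value ip k A \<le> \<epsilon>'"
      using ratio_small[OF \<epsilon>'(1)] by blast
    \<comment> \<open>Far enough for the tail condition, for the axes to be near their limit, and
      for the gap of \<open>A m\<close> to outweigh the conditioning of \<open>C\<close>.\<close>
    define m where "m = max (max M M1) (nat \<lceil>T' + len (a 0)\<rceil>)"
    have gr: "?\<xi> \<in> grassmannian k" "?U (A m) \<in> grassmannian k" "?U (C ** A m) \<in> grassmannian k"
      by (rule boundary_map_grassmannian[OF w(1)] rep_axes_grassmannian[OF car A] rep_axes_grassmannian[OF car' CA])+
    note grC = matrix_image_grassmannian[OF invC gr(2)]
    have "near \<epsilon>' ?\<xi> (?U (A m))"
      using near_sym_gr[OF M1[of m] gr(2,1)] \<epsilon>'(1) by (simp add: m_def)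
    from near_image[OF K this] have 1: "near (\<epsilon> / 3) ((*v) C ` ?\<xi>) ((*v) C ` ?U (A m))"
      using \<epsilon>' by simp
    have "real m \<le> real (len (a m)) + real (len (a 0))" using ray_len_bounds(2)[OF ray, of m] by linarith
    moreover have "T' + real (len (a 0)) \<le> real m" unfolding m_def by linarith
    ultimately have "T' \<le> real (len (a m))" by linarith
    then have "K * (singular_value ip (k + 1) (A m) / singular_value ip k (A m)) \<le> K * \<epsilon>'"
      using T'[OF car A] K0 by (intro mult_left_mono) auto
    then have "near (\<epsilon> / 3) (?U (C ** A m)) ((*v) C ` ?U (A m))"
      using near_mono[OF longest_axes_span_mult_left[OF rep_invertible[OF car A] invC K k]] \<epsilon>'(2) by simp
    then have 2: "near (\<epsilon> / 3) ((*v) C ` ?U (A m)) (?U (C ** A m))"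
      using near_sym_gr[OF _ gr(3) grC] \<epsilon> by simp
    have 3: "near (\<epsilon> / 3) (?U (C ** A m)) (?U H)"
      using M by (intro T[OF car' h(1) CA h(2)]) (simp add: m_def)
    have "near (\<epsilon> / 3 + (\<epsilon> / 3 + \<epsilon> / 3)) ((*v) C ` ?\<xi>) (?U H)"
      using \<epsilon> by (intro near_trans[OF 1 near_trans[OF 2 3]] grassmannian_subspace[OF gr(3)]
          grassmannian_subspace[OF grC]) auto
    then show ?thesis by simp
  qed
  show ?thesis by (rule that[OF main])
qed

text \<open>The far point \<open>\<gamma> \<otimes> a M\<close> of the translated ray is a relay:
  its axes are near the translated boundary subspace on one side and near the subspace of the limit
  ray on the other.\<close>

lemma translated_boundary_map_near_boundary_map:
  assumes \<alpha>: "\<alpha> \<in> geodesic_rays G S" and \<epsilon>: "0 < \<epsilon>"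
  obtains T where "\<And>w a \<gamma> C M i. w \<in> gromov_boundary G S \<Longrightarrow> a \<in> w \<Longrightarrow> \<gamma> \<in> carrier G \<Longrightarrow> C \<in> \<rho> \<gamma> \<Longrightarrow>
    \<forall>m\<ge>M. T \<le> gprod (\<gamma> \<otimes> a m) (\<gamma> \<otimes> a M) \<Longrightarrow> T \<le> real i \<Longrightarrow> real i \<le> gprod (\<gamma> \<otimes> a M) (\<alpha> i) \<Longrightarrow>
    near \<epsilon> ((*v) C ` boundary_map ip \<rho> k w) (boundary_map ip \<rho> k (asymptotic G S `` {\<alpha>}))"
proof -
  let ?U = "longest_axes_span ip k"
  let ?\<xi> = "boundary_map ip \<rho> k (asymptotic G S `` {\<alpha>})"
  obtain T1 where T1: "\<And>w a \<gamma> C h H M. w \<in> gromov_boundary G S \<Longrightarrow> a \<in> w \<Longrightarrow> \<gamma> \<in> carrier G \<Longrightarrow> C \<in> \<rho> \<gamma> \<Longrightarrow>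
      h \<in> carrier G \<Longrightarrow> H \<in> \<rho> h \<Longrightarrow> \<forall>m\<ge>M. T1 \<le> gprod (\<gamma> \<otimes> a m) h \<Longrightarrow>
      near (\<epsilon> / 2) ((*v) C ` boundary_map ip \<rho> k w) (?U H)"
    by (rule translated_boundary_map_near_axes[OF half_gt_zero[OF \<epsilon>]]) blast
  obtain T2 where T2: "\<And>g A i. g \<in> carrier G \<Longrightarrow> A \<in> \<rho> g \<Longrightarrow> T2 \<le> real i \<Longrightarrow> real i \<le> gprod g (\<alpha> i) \<Longrightarrow>
      near (\<epsilon> / 2) (?U A) ?\<xi>"
    using axes_near_boundary_map_ray[OF \<alpha> half_gt_zero[OF \<epsilon>]] by blast
  have main: "near \<epsilon> ((*v) C ` boundary_map ip \<rho> k w) ?\<xi>"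
    if w: "w \<in> gromov_boundary G S" "a \<in> w" and \<gamma>: "\<gamma> \<in> carrier G" "C \<in> \<rho> \<gamma>"
      and M: "\<forall>m\<ge>M. max T1 T2 \<le> gprod (\<gamma> \<otimes> a m) (\<gamma> \<otimes> a M)"
      and i: "max T1 T2 \<le> real i" "real i \<le> gprod (\<gamma> \<otimes> a M) (\<alpha> i)" for w a \<gamma> C M i
  proof -
    have car: "\<gamma> \<otimes> a M \<in> carrier G" using ray_carrier[OF boundary_ray[OF w]] \<gamma> by simp
    obtain H where H: "H \<in> \<rho> (\<gamma> \<otimes> a M)" using ex_rep[OF car] by blast
    have "near (\<epsilon> / 2 + \<epsilon> / 2) ((*v) C ` boundary_map ip \<rho> k w) ?\<xi>"
      using M i \<epsilon> by (intro near_trans[OF T1[OF w \<gamma> car H, of M] T2[OF car H, of i]]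
          grassmannian_subspace[OF rep_axes_grassmannian[OF car H]]) auto
    then show ?thesis by simp
  qed
  show ?thesis by (rule that[OF main])
qed

end

end

section \<open>Hyperconvex representations\<close>

lemma subspace_sum_image:
  "(*v) A ` subspace_sum P Q = subspace_sum ((*v) A ` P) ((*v) A ` Q)"
proof (intro equalityI subsetI)
  fix x assume "x \<in> (*v) A ` subspace_sum P Q"
  then obtain u v where "u \<in> P" "v \<in> Q" "x = A *v u + A *v v"
    unfolding subspace_sum_def using matrix_vector_right_distrib by blast
  then show "x \<in> subspace_sum ((*v) A ` P) ((*v) A ` Q)" unfolding subspace_sum_def by blast
next
  fix x assume "x \<in> subspace_sum ((*v) A ` P) ((*v) A ` Q)"
  then obtain u v where uv: "u \<in> P" "v \<in> Q" "x = A *v u + A *v v"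
    unfolding subspace_sum_def by blast
  then have "x = A *v (u + v)" by (simp add: matrix_vector_right_distrib)
  moreover have "u + v \<in> subspace_sum P Q" using uv unfolding subspace_sum_def by blast
  ultimately show "x \<in> (*v) A ` subspace_sum P Q" by blast
qed

locale hyperbolic_representation =
  hyperbolic_word_group G S \<delta> + projective_representation G S ip \<rho>
  for G :: "('g, 'b) monoid_scheme" (structure) and S \<delta>
    and ip :: "('k::real_or_complex, 'n::finite) form" and \<rho>
begin

lemma hyperconvex_near:
  assumes hc: "hyperconvex G S ip \<rho> p q r" and x: "x \<in> gromov_boundary G S" and \<epsilon>: "0 < \<epsilon>"
  shows "\<exists>R. \<forall>w\<in>boundary_nbhd G S x R. \<forall>y\<in>boundary_nbhd G S x R. w \<noteq> y \<longrightarrow>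
    near \<epsilon> (subspace_sum (boundary_map ip \<rho> p w) (boundary_map ip \<rho> q y)) (boundary_map ip \<rho> r x)"
proof (rule ccontr)
  assume "\<not> ?thesis"
  then have "\<exists>w\<in>boundary_nbhd G S x R. \<exists>y\<in>boundary_nbhd G S x R. w \<noteq> y \<and>
      \<not> near \<epsilon> (subspace_sum (boundary_map ip \<rho> p w) (boundary_map ip \<rho> q y)) (boundary_map ip \<rho> r x)" for R
    by simp
  \<comment> \<open>The failure is sampled at integer radii; the n-th pair serves for radius
    \<open>n\<close>.\<close>
  from this[of "real _"] obtain w y where wy: "\<And>n. w n \<in> boundary_nbhd G S x (real n)"
      "\<And>n. y n \<in> boundary_nbhd G S x (real n)" "\<And>n. w n \<noteq> y n"
    and far: "\<And>n. \<not> near \<epsilon> (subspace_sum (boundary_map ip \<rho> p (w n)) (boundary_map ip \<rho> q (y n)))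
      (boundary_map ip \<rho> r x)"
    by metis
  have w: "w n \<in> gromov_boundary G S" and y: "y n \<in> gromov_boundary G S" for n
    using wy unfolding boundary_nbhd_def by blast+
  have pqr: "p \<in> {1..CARD('n) - 1}" "q \<in> {1..CARD('n) - 1}" "r \<in> {1..CARD('n) - 1}"
    and anosov: "anosov G S ip \<rho> p" "anosov G S ip \<rho> q" "anosov G S ip \<rho> r"
    and transverse: "\<And>x y z. x \<in> gromov_boundary G S \<Longrightarrow> y \<in> gromov_boundary G S \<Longrightarrow> z \<in> gromov_boundary G S \<Longrightarrow>
      x \<noteq> y \<Longrightarrow> y \<noteq> z \<Longrightarrow> x \<noteq> z \<Longrightarrow> boundary_map ip \<rho> p x \<inter> boundary_map ip \<rho> q y = {0} \<and>
      subspace_sum (boundary_map ip \<rho> p x) (boundary_map ip \<rho> q y) \<inter> boundary_map ip \<rho> (CARD('n) - r) z = {0}"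
    using hc unfolding hyperconvex_def by blast+
  have kp: "1 \<le> p" "p + 1 \<le> CARD('n)" and kq: "1 \<le> q" "q + 1 \<le> CARD('n)"
    and kr: "1 \<le> r" "r + 1 \<le> CARD('n)" and ks: "1 \<le> CARD('n) - r" "CARD('n) - r + 1 \<le> CARD('n)"
    using pqr by auto
  note anosov_s = anosov_dual[OF anosov(3) pqr(3)]
  obtain c where c: "c \<in> x" using boundary_nonempty[OF x] by blast
  obtain a where a: "\<And>n. a n \<in> w n" using boundary_nonempty[OF w] by metis
  obtain b where b: "\<And>n. b n \<in> y n" using boundary_nonempty[OF y] by metis
  have "\<exists>\<gamma> M. \<gamma> \<in> carrier G \<and>
      (\<forall>m\<ge>M. real n \<le> gprod (inv \<gamma> \<otimes> a n m) (inv \<gamma> \<otimes> a n M)) \<and>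
      (\<forall>m\<ge>M. real n \<le> gprod (inv \<gamma> \<otimes> b n m) (inv \<gamma> \<otimes> b n M)) \<and>
      gprod (inv \<gamma> \<otimes> a n M) (inv \<gamma> \<otimes> b n M) \<le> 1 + \<delta> \<and>
      gprod (inv \<gamma> \<otimes> a n M) (inv \<gamma>) \<le> \<delta> \<and> gprod (inv \<gamma> \<otimes> b n M) (inv \<gamma>) \<le> \<delta> \<and>
      (\<exists>M. \<forall>m\<ge>M. real n - 4 * \<delta> - 1 \<le> gprod \<gamma> (c m))" for n
    \<comment> \<open>The free constant \<open>K\<close> is set to \<open>n\<close>, so that the
      recentred rays agree with their marked points ever longer.\<close>
    by (rule coarse_centre[OF x c wy(1)[of n] a[of n] wy(2)[of n] b[of n] wy(3)[of n], where K = "real n"]) blast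
  then obtain \<gamma> M where \<gamma>: "\<And>n. \<gamma> n \<in> carrier G"
    and ga: "\<And>n. \<forall>m\<ge>M n. real n \<le> gprod (inv (\<gamma> n) \<otimes> a n m) (inv (\<gamma> n) \<otimes> a n (M n))"
    and gb: "\<And>n. \<forall>m\<ge>M n. real n \<le> gprod (inv (\<gamma> n) \<otimes> b n m) (inv (\<gamma> n) \<otimes> b n (M n))"
    and gab: "\<And>n. gprod (inv (\<gamma> n) \<otimes> a n (M n)) (inv (\<gamma> n) \<otimes> b n (M n)) \<le> 1 + \<delta>"
    and gak: "\<And>n. gprod (inv (\<gamma> n) \<otimes> a n (M n)) (inv (\<gamma> n)) \<le> \<delta>"
    and gbk: "\<And>n. gprod (inv (\<gamma> n) \<otimes> b n (M n)) (inv (\<gamma> n)) \<le> \<delta>"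
    and gc: "\<And>n. \<exists>M. \<forall>m\<ge>M. real n - 4 * \<delta> - 1 \<le> gprod (\<gamma> n) (c m)"
    by metis
  have i\<gamma>: "inv (\<gamma> n) \<in> carrier G" for n using \<gamma> by simp
  define g where "g n = inv (\<gamma> n) \<otimes> a n (M n)" for n
  define h where "h n = inv (\<gamma> n) \<otimes> b n (M n)" for n
  have g: "g n \<in> carrier G" and h: "h n \<in> carrier G" for n
    unfolding g_def h_def using i\<gamma> ray_carrier[OF boundary_ray[OF w a]] ray_carrier[OF boundary_ray[OF y b]]
    by simp_all
  have lg: "real n \<le> real (len (g n))" and lh: "real n \<le> real (len (h n))" for n
    using ga[of n] gb[of n] gprod_self[OF g] gprod_self[OF h] unfolding g_def h_def by fastforce+
  have l\<gamma>: "real n - 4 * \<delta> - 1 \<le> real (len (\<gamma> n))" for n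
  proof -
    obtain m where "real n - 4 * \<delta> - 1 \<le> gprod (\<gamma> n) (c m)" using gc by blast
    then show ?thesis using gprod_le_len(1)[OF \<gamma> ray_carrier[OF boundary_ray[OF x c]], of n m] by linarith
  qed
  have "\<exists>N0. \<forall>n\<ge>N0. B \<le> len (g n)" for B using lg by (meson of_nat_le_iff order_trans)
  then obtain r1 \<alpha> where r1: "strict_mono r1" and \<alpha>: "\<alpha> \<in> geodesic_rays G S"
      "\<And>j n. j \<le> n \<Longrightarrow> real j \<le> gprod (g (r1 n)) (\<alpha> j)"
    using geodesics_subconverge[of g] g by metis
  have up1: "n \<le> r1 n" for n using strict_mono_imp_increasing[OF r1] .
  have "\<exists>N0. \<forall>n\<ge>N0. B \<le> len (h (r1 n))" for B
    using lh up1 by (meson of_nat_le_iff order_trans)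
  then obtain r2 \<beta> where r2: "strict_mono r2" and \<beta>: "\<beta> \<in> geodesic_rays G S"
      "\<And>j n. j \<le> n \<Longrightarrow> real j \<le> gprod (h (r1 (r2 n))) (\<beta> j)"
    using geodesics_subconverge[of "\<lambda>n. h (r1 n)"] h by metis
  have up2: "n \<le> r2 n" for n using strict_mono_imp_increasing[OF r2] .
  have "\<exists>N0. \<forall>n\<ge>N0. B \<le> len (inv (\<gamma> (r1 (r2 n))))" for B
  proof -
    have "B \<le> len (inv (\<gamma> (r1 (r2 n))))" if "nat \<lceil>real B + 4 * \<delta> + 1\<rceil> \<le> n" for n
    proof -
      have "n \<le> r1 (r2 n)" using up1 up2 order_trans by blast
      then have "real B \<le> real (len (\<gamma> (r1 (r2 n))))" using l\<gamma>[of "r1 (r2 n)"] that by linarith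
      then show ?thesis using len_inv[OF \<gamma>] by simp
    qed
    then show ?thesis by blast
  qed
  then obtain r3 \<zeta> where r3: "strict_mono r3" and \<zeta>: "\<zeta> \<in> geodesic_rays G S"
      "\<And>j n. j \<le> n \<Longrightarrow> real j \<le> gprod (inv (\<gamma> (r1 (r2 (r3 n))))) (\<zeta> j)"
    using geodesics_subconverge[of "\<lambda>n. inv (\<gamma> (r1 (r2 n)))"] i\<gamma> by metis
  have up3: "n \<le> r3 n" for n using strict_mono_imp_increasing[OF r3] .
  define s where "s n = r1 (r2 (r3 n))" for n
  have s: "n \<le> s n" for n unfolding s_def using up1 up2 up3 order_trans by metis
  \<comment> \<open>Three successive extractions; each bound survives the later ones because
    subsequence indices only grow.\<close>
  have s\<alpha>: "real n \<le> gprod (g (s n)) (\<alpha> n)" and s\<beta>: "real n \<le> gprod (h (s n)) (\<beta> n)"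
    and s\<zeta>: "real n \<le> gprod (inv (\<gamma> (s n))) (\<zeta> n)" for n
    unfolding s_def using \<alpha>(2) \<beta>(2) \<zeta>(2) up2 up3 order_trans by (metis order_refl)+
  define X Y Z where "X = asymptotic G S `` {\<alpha>}" and "Y = asymptotic G S `` {\<beta>}"
    and "Z = asymptotic G S `` {\<zeta>}"
  have X: "X \<in> gromov_boundary G S" "\<alpha> \<in> X" and Y: "Y \<in> gromov_boundary G S" "\<beta> \<in> Y"
    and Z: "Z \<in> gromov_boundary G S" "\<zeta> \<in> Z"
    unfolding X_def Y_def Z_def using ray_class \<alpha>(1) \<beta>(1) \<zeta>(1) by blast+
  \<comment> \<open>The recentred vertices have mutual products at most 1 + \<delta>, independently
    of \<open>n\<close>, so their three limits are distinct.\<close>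
  have "(\<alpha>, \<beta>) \<notin> asymptotic G S"
    by (rule not_asymptotic_if_gprod_bounded[OF \<alpha>(1) \<beta>(1) g s\<alpha> h s\<beta>]) (use gab in \<open>unfold g_def h_def\<close>)
  moreover have "(\<alpha>, \<zeta>) \<notin> asymptotic G S"
    by (rule not_asymptotic_if_gprod_bounded[OF \<alpha>(1) \<zeta>(1) g s\<alpha> i\<gamma> s\<zeta>]) (use gak in \<open>unfold g_def\<close>)
  moreover have "(\<beta>, \<zeta>) \<notin> asymptotic G S"
    by (rule not_asymptotic_if_gprod_bounded[OF \<beta>(1) \<zeta>(1) h s\<beta> i\<gamma> s\<zeta>]) (use gbk in \<open>unfold h_def\<close>)
  ultimately have "X \<noteq> Y" "Y \<noteq> Z" "X \<noteq> Z"
    using boundary_eq_iff X Y Z by blast+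
  note tr = transverse[OF X(1) Y(1) Z(1) this]
  let ?P = "boundary_map ip \<rho> p X" and ?Q = "boundary_map ip \<rho> q Y"
    and ?Z = "boundary_map ip \<rho> (CARD('n) - r) Z"
  have sub: "vec.subspace ?P" "vec.subspace ?Q" "vec.subspace ?Z"
    using boundary_map_grassmannian[OF anosov(1) kp X(1)] boundary_map_grassmannian[OF anosov(2) kq Y(1)]
      boundary_map_grassmannian[OF anosov_s ks Z(1)] grassmannian_subspace by blast+
  obtain e where e: "0 < e"
      "\<And>v u z. v \<in> ?P \<Longrightarrow> u \<in> ?Q \<Longrightarrow> z \<in> ?Z \<Longrightarrow> e * (N v + N u + N z) \<le> N (v + u + z)"
    using direct_sum_bound[OF sub] tr by blast
  define \<eta> where "\<eta> = e / (2 * (e + 1))"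
  have \<eta>: "0 < \<eta>" unfolding \<eta>_def using e(1) by simp
  \<comment> \<open>Stability leaves the transversality constant \<open>e / 2\<close>; the gap must
    be \<open>\<epsilon> / 2\<close> even after division by it.\<close>
  have \<epsilon>2: "0 < \<epsilon> / 2" and e\<epsilon>: "0 < \<epsilon> / 2 * (e / 2)" using \<epsilon> e(1) by simp_all
  obtain T1 where T1: "\<And>w a \<gamma> C M i. w \<in> gromov_boundary G S \<Longrightarrow> a \<in> w \<Longrightarrow> \<gamma> \<in> carrier G \<Longrightarrow> C \<in> \<rho> \<gamma> \<Longrightarrow>
      \<forall>m\<ge>M. T1 \<le> gprod (\<gamma> \<otimes> a m) (\<gamma> \<otimes> a M) \<Longrightarrow> T1 \<le> real i \<Longrightarrow> real i \<le> gprod (\<gamma> \<otimes> a M) (\<alpha> i) \<Longrightarrow>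
      near \<eta> ((*v) C ` boundary_map ip \<rho> p w) ?P"
    by (rule translated_boundary_map_near_boundary_map[OF anosov(1) kp \<alpha>(1) \<eta>, folded X_def]) blast
  obtain T2 where T2: "\<And>w a \<gamma> C M i. w \<in> gromov_boundary G S \<Longrightarrow> a \<in> w \<Longrightarrow> \<gamma> \<in> carrier G \<Longrightarrow> C \<in> \<rho> \<gamma> \<Longrightarrow>
      \<forall>m\<ge>M. T2 \<le> gprod (\<gamma> \<otimes> a m) (\<gamma> \<otimes> a M) \<Longrightarrow> T2 \<le> real i \<Longrightarrow> real i \<le> gprod (\<gamma> \<otimes> a M) (\<beta> i) \<Longrightarrow>
      near \<eta> ((*v) C ` boundary_map ip \<rho> q w) ?Q"
    by (rule translated_boundary_map_near_boundary_map[OF anosov(2) kq \<beta>(1) \<eta>, folded Y_def]) blast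
  obtain T3 where T3: "\<And>g A i. g \<in> carrier G \<Longrightarrow> A \<in> \<rho> g \<Longrightarrow> T3 \<le> real i \<Longrightarrow> real i \<le> gprod g (\<zeta> i) \<Longrightarrow>
      near \<eta> (longest_axes_span ip (CARD('n) - r) A) ?Z"
    using axes_near_boundary_map_ray[OF anosov_s ks \<zeta>(1) \<eta>] unfolding Z_def by blast
  obtain T4 where T4: "\<And>g A M. g \<in> carrier G \<Longrightarrow> A \<in> \<rho> g \<Longrightarrow> \<forall>m\<ge>M. T4 \<le> gprod g (c m) \<Longrightarrow>
      near (\<epsilon> / 2) (longest_axes_span ip r A) (boundary_map ip \<rho> r x)"
    using axes_near_boundary_map[OF anosov(3) kr x c \<epsilon>2] by blast
  obtain T5 where T5: "\<And>g A. g \<in> carrier G \<Longrightarrow> A \<in> \<rho> g \<Longrightarrow> T5 \<le> real (len g) \<Longrightarrow>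
      singular_value ip (r + 1) A / singular_value ip r A \<le> \<epsilon> / 2 * (e / 2)"
    using ratio_small[OF anosov(3) kr e\<epsilon>] by blast
  \<comment> \<open>One index beyond all thresholds is enough for the contradiction. The summand
    \<open>4 * \<delta> + 1\<close> offsets the loss in the bounds on \<gamma> \<open>n\<close> from
    \<open>coarse_centre\<close>.\<close>
  define i where "i = nat \<lceil>\<bar>T1\<bar> + \<bar>T2\<bar> + \<bar>T3\<bar> + \<bar>T4\<bar> + \<bar>T5\<bar> + 4 * \<delta> + 1\<rceil>"
  define n where "n = s i"
  have iT: "T1 \<le> real i" "T2 \<le> real i" "T3 \<le> real i" "T4 + 4 * \<delta> + 1 \<le> real i" "T5 + 4 * \<delta> + 1 \<le> real i"
    unfolding i_def using \<delta>_nonneg by linarith+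
  have "real i \<le> real n" unfolding n_def using s by simp
  then have nT: "T1 \<le> real n" "T2 \<le> real n" "T4 \<le> real n - 4 * \<delta> - 1" "T5 \<le> real n - 4 * \<delta> - 1"
    using iT by linarith+
  obtain A where A: "A \<in> \<rho> (\<gamma> n)" using ex_rep[OF \<gamma>] by blast
  obtain C where C: "C \<in> \<rho> (inv (\<gamma> n))" "A ** C = mat 1" "C ** A = mat 1" using rep_inverse[OF \<gamma> A] by blast
  note invA = rep_invertible[OF \<gamma> A] and invC = rep_invertible[OF i\<gamma> C(1)]
  let ?V = "subspace_sum (boundary_map ip \<rho> p (w n)) (boundary_map ip \<rho> q (y n))"
  have "\<forall>m\<ge>M n. T1 \<le> gprod (inv (\<gamma> n) \<otimes> a n m) (inv (\<gamma> n) \<otimes> a n (M n))"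
    using ga[of n] nT(1) order_trans by blast
  from T1[OF w[of n] a[of n] i\<gamma>[of n] C(1) this iT(1) s\<alpha>[of i, folded n_def, unfolded g_def]]
  have n1: "near \<eta> ((*v) C ` boundary_map ip \<rho> p (w n)) ?P" .
  have "\<forall>m\<ge>M n. T2 \<le> gprod (inv (\<gamma> n) \<otimes> b n m) (inv (\<gamma> n) \<otimes> b n (M n))"
    using gb[of n] nT(2) order_trans by blast
  from T2[OF y[of n] b[of n] i\<gamma>[of n] C(1) this iT(2) s\<beta>[of i, folded n_def, unfolded h_def]]
  have n2: "near \<eta> ((*v) C ` boundary_map ip \<rho> q (y n)) ?Q" .
  have n3: "near \<eta> (longest_axes_span ip (CARD('n) - r) C) ?Z"
    using T3[OF i\<gamma> C(1), of i] iT(3) s\<zeta>[of i] unfolding n_def by blast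
  have trans: "e / 2 * N v \<le> N (v + z)"
    if vz: "v \<in> (*v) C ` ?V" "z \<in> longest_axes_span ip (CARD('n) - r) C" for v z
  proof -
    obtain v1 v2 where v12: "v1 \<in> (*v) C ` boundary_map ip \<rho> p (w n)" "v2 \<in> (*v) C ` boundary_map ip \<rho> q (y n)"
      and v: "v = v1 + v2"
      using vz(1)[unfolded subspace_sum_image] unfolding subspace_sum_def by auto
    show ?thesis
      unfolding v
      by (rule transversality_stable[OF e(1) _ n1 n2 n3 less_imp_le[OF \<eta>] eq_refl[OF \<eta>_def] v12 vz(2)])
        (rule e(2))
  qed
  \<comment> \<open>The estimate was made for the recentred sum; applying \<open>A\<close> restores
    the original one.\<close>
  have AC: "(*v) A ` (*v) C ` ?V = ?V"
    unfolding image_image by (simp add: matrix_vector_mul_assoc C(2))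
  have e2: "0 < e / 2" using e(1) by simp
  have "near (singular_value ip (r + 1) A / singular_value ip r A / (e / 2)) ?V (longest_axes_span ip r A)"
    by (rule transverse_image_near_attractor[OF invA C(3) invC kr e2, where W = "(*v) C ` ?V", unfolded AC])
      (rule trans)
  moreover have "singular_value ip (r + 1) A / singular_value ip r A / (e / 2) \<le> \<epsilon> / 2"
    using T5[OF \<gamma> A] nT(4) l\<gamma>[of n] unfolding pos_divide_le_eq[OF e2] by linarith
  ultimately have "near (\<epsilon> / 2) ?V (longest_axes_span ip r A)" by (rule near_mono)
  moreover have "near (\<epsilon> / 2) (longest_axes_span ip r A) (boundary_map ip \<rho> r x)"
  proof -
    obtain M' where "\<forall>m\<ge>M'. real n - 4 * \<delta> - 1 \<le> gprod (\<gamma> n) (c m)" using gc by blast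
    then have "\<forall>m\<ge>M'. T4 \<le> gprod (\<gamma> n) (c m)" using nT(3) order_trans by blast
    then show ?thesis by (rule T4[OF \<gamma> A])
  qed
  ultimately have "near (\<epsilon> / 2 + \<epsilon> / 2) ?V (boundary_map ip \<rho> r x)"
    using \<epsilon> kr by (intro near_trans[OF _ _ grassmannian_subspace[OF longest_axes_span_grassmannian[OF invA, of r]]]) auto
  then show False using far[of n] by simp
qed

end

section \<open>The limit in the boundary topology\<close>

theorem theorem2:
  fixes G :: "('g, 'b) monoid_scheme"
    and S :: "'g set"
    and ip :: "('k::real_or_complex, 'n::finite) form"
    and \<rho> :: "'g \<Rightarrow> ('k ^ 'n ^ 'n) set"
    and p q r :: nat
    and x :: "(nat \<Rightarrow> 'g) set"
  assumes "group G"
    and "finite S" and "symmetric_generating_set G S"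
    and "word_hyperbolic G S"
    and "inner_product ip"
    and "\<rho> \<in> hom G PGL"
    and "hyperconvex G S ip \<rho> p q r"
    and "x \<in> gromov_boundary G S"
  shows "((\<lambda>(w, y). subspace_dist ip
             (subspace_sum (boundary_map ip \<rho> p w) (boundary_map ip \<rho> q y))
             (boundary_map ip \<rho> r x)) \<longlongrightarrow> 0)
         (atin_within (prod_topology (boundary_topology G S) (boundary_topology G S))
            (x, x) {(w, y). w \<noteq> y})"
proof -
  obtain \<delta> where \<delta>: "0 \<le> \<delta>" "\<And>o' g h k. o' \<in> carrier G \<Longrightarrow> g \<in> carrier G \<Longrightarrow> h \<in> carrier G \<Longrightarrow> k \<in> carrier G \<Longrightarrow>
      min (gromov_product G S o' g h) (gromov_product G S o' h k) - \<delta> \<le> gromov_product G S o' g k"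
    using assms(4) unfolding word_hyperbolic_def by blast
  interpret group G by (rule assms)
  interpret hyperbolic_representation G S \<delta> ip \<rho>
    by unfold_locales (use assms \<delta> in auto)
  let ?T = "boundary_topology G S"
  let ?V = "\<lambda>w y. subspace_sum (boundary_map ip \<rho> p w) (boundary_map ip \<rho> q y)"
  let ?X = "boundary_map ip \<rho> r x"
  have pqr: "anosov G S ip \<rho> p" "1 \<le> p" "p + 1 \<le> CARD('n)" "anosov G S ip \<rho> q" "1 \<le> q" "q + 1 \<le> CARD('n)"
    "anosov G S ip \<rho> r" "1 \<le> r" "r + 1 \<le> CARD('n)"
    using assms(7) unfolding hyperconvex_def by auto
  note X = boundary_map_grassmannian[OF pqr(7-9) assms(8)]
  show ?thesis
  proof (rule tendstoI)
    fix \<epsilon> :: real assume \<epsilon>: "0 < \<epsilon>"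
    obtain R where R: "\<And>w y. w \<in> boundary_nbhd G S x R \<Longrightarrow> y \<in> boundary_nbhd G S x R \<Longrightarrow> w \<noteq> y \<Longrightarrow>
        near (\<epsilon> / 2) (?V w y) ?X"
      using hyperconvex_near[OF assms(7,8) half_gt_zero[OF \<epsilon>]] by blast
    obtain U where U: "openin ?T U" "x \<in> U" "U \<subseteq> boundary_nbhd G S x R"
      using open_in_boundary_nbhd[OF assms(8)] by blast
    have "dist (subspace_dist ip (?V w y) ?X) 0 < \<epsilon>" if wy: "w \<in> U" "y \<in> U" "w \<noteq> y" for w y
    proof -
      have bd: "w \<in> gromov_boundary G S" "y \<in> gromov_boundary G S"
        using wy U(3) unfolding boundary_nbhd_def by blast+
      note P = boundary_map_grassmannian[OF pqr(1-3) bd(1)] and Q = boundary_map_grassmannian[OF pqr(4-6) bd(2)]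
      have sub: "vec.subspace (?V w y)"
        unfolding subspace_sum_def
        by (rule vec.subspace_sums[OF grassmannian_subspace[OF P] grassmannian_subspace[OF Q]])
      \<comment> \<open>The translation between \<open>near\<close> and \<open>subspace_dist\<close>
        requires nonzero subspaces; \<open>1 \<le> p\<close> ensures this for the sum.\<close>
      obtain v where v: "v \<in> boundary_map ip \<rho> p w" "v \<noteq> 0"
        using grassmannian_nonzero[OF P pqr(2)] vec.subspace_0[OF grassmannian_subspace[OF P]] by blast
      have "v + 0 \<in> ?V w y"
        using v vec.subspace_0[OF grassmannian_subspace[OF Q]] unfolding subspace_sum_def by blast
      then have ne: "?V w y \<noteq> {0}" using v by auto
      note dist = sub ne grassmannian_subspace[OF X] grassmannian_nonzero[OF X pqr(8)]
      have "subspace_dist ip (?V w y) ?X \<le> \<epsilon> / 2"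
        unfolding subspace_dist_le_iff[OF dist] using R wy U(3) by blast
      then show ?thesis using subspace_dist_nonneg[OF dist] \<epsilon> by simp
    qed
    \<comment> \<open>A square of one open neighbourhood suffices, since the estimate is uniform in
      both points; the pair (x, x) is itself excluded by \<open>w \<noteq> y\<close>.\<close>
    moreover have "openin (prod_topology ?T ?T) (U \<times> U)" using U(1) by (simp add: openin_prod_Times_iff)
    ultimately show "\<forall>\<^sub>F z in atin_within (prod_topology ?T ?T) (x, x) {(w, y). w \<noteq> y}.
        dist (case z of (w, y) \<Rightarrow> subspace_dist ip (?V w y) ?X) 0 < \<epsilon>"
      unfolding eventually_atin_within using U(2) by (intro disjI2 exI[of _ "U \<times> U"]) auto
  qed
qed

end
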